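(* Let $G$ be a profinite group such that $\mathcal{S}(G)$ is not perfect. Let $k$ be the number of primes $p$ such that $p^{\infty}$ divides the order $o(G)$ of $G$. Then $\mathrm{ht}(\mathcal{S}(G))\leqslant k+1$. In particular, if $G$ is any pro-$p$ group ($p$ a prime), then $\mathrm{ht}(\mathcal{S}(G))\leqslant 2$.
   Context: For a profinite group $G$, $\mathcal{S}(G)$ is the set of closed subgroups of $G$ with its natural profinite topology: a base of open neighbourhoods of $H\in\mathcal{S}(G)$ is given by the sets $B(H,N)=\{K \text{ closed subgroup of } G \mid KN=HN\}$, with $N$ ranging over the open normal subgroups of $G$. A space is perfect if it has no isolated points. The order $o(G)$ is the supernatural number given by the least common multiple of the orders of the finite continuous quotients of $G$. For a space $X$, let $X'$ be $X$ minus its isolated points, $X^{(0)}=X$, $X^{(\alpha+1)}=(X^{(\alpha)})'$, and $X^{(\lambda)}=\bigcap_{\mu<\lambda}X^{(\mu)}$ for limit ordinals $\lambda$. The scattered height $\mathrm{ht}(X)$ is the least ordinal $\lambda$ such that $X^{(\lambda)}=X^{(\lambda+1)}$. *)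

theory Defs
  imports
    "HOL-Analysis.Analysis"
    "HOL-Algebra.Coset"
    "HOL-Computational_Algebra.Primes"
    "HOL-Library.Extended_Nat"
begin

unbundle cardinal_syntax

section \<open>Profinite groups\<close>

definition topological_group :: "('a, 'b) monoid_scheme \<Rightarrow> 'a topology \<Rightarrow> bool" where
  "topological_group G T \<longleftrightarrow>
     group G \<and> topspace T = carrier G \<and>
     continuous_map (prod_topology T T) T (\<lambda>(x, y). x \<otimes>\<^bsub>G\<^esub> y) \<and>
     continuous_map T T (\<lambda>x. inv\<^bsub>G\<^esub> x)"

definition totally_disconnected_space :: "'a topology \<Rightarrow> bool" where
  "totally_disconnected_space X \<longleftrightarrow>
     (\<forall>x\<in>topspace X. connected_component_of_set X x = {x})"

definition profinite_group :: "('a, 'b) monoid_scheme \<Rightarrow> 'a topology \<Rightarrow> bool" where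
  "profinite_group G T \<longleftrightarrow>
     topological_group G T \<and> compact_space T \<and> Hausdorff_space T \<and>
     totally_disconnected_space T"

definition open_normal_subgroups :: "('a, 'b) monoid_scheme \<Rightarrow> 'a topology \<Rightarrow> 'a set set" where
  "open_normal_subgroups G T = {N. N \<lhd> G \<and> openin T N}"

definition pro_p_group :: "nat \<Rightarrow> ('a, 'b) monoid_scheme \<Rightarrow> 'a topology \<Rightarrow> bool" where
  "pro_p_group p G T \<longleftrightarrow>
     profinite_group G T \<and> (\<forall>N\<in>open_normal_subgroups G T. \<exists>n. order (G Mod N) = p ^ n)"

text \<open>
  A supernatural number, i.e. a formal product of the powers \<open>p ^ e p\<close> over all primes \<open>p\<close> with
  \<open>0 \<le> e p \<le> \<infinity>\<close>, is represented by its exponent function \<open>e\<close>, of which only the values at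
  primes are meaningful. The least common multiple is the pointwise supremum of the exponents,
  and \<open>p\<close> to the power \<open>\<infinity>\<close> divides it iff \<open>e p = \<infinity>\<close>. The finite continuous quotients of a
  profinite group are its quotients by open normal subgroups.
\<close>

definition supernatural_order :: "('a, 'b) monoid_scheme \<Rightarrow> 'a topology \<Rightarrow> nat \<Rightarrow> enat" where
  "supernatural_order G T p =
     (SUP N\<in>open_normal_subgroups G T. enat (multiplicity p (order (G Mod N))))"


section \<open>The space of closed subgroups\<close>

definition closed_subgroups :: "('a, 'b) monoid_scheme \<Rightarrow> 'a topology \<Rightarrow> 'a set set" where
  "closed_subgroups G T = {H. subgroup H G \<and> closedin T H}"

definition subgroup_nhd ::
    "('a, 'b) monoid_scheme \<Rightarrow> 'a topology \<Rightarrow> 'a set \<Rightarrow> 'a set \<Rightarrow> 'a set set" where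
  "subgroup_nhd G T H N = {K \<in> closed_subgroups G T. K <#>\<^bsub>G\<^esub> N = H <#>\<^bsub>G\<^esub> N}"

definition subgroup_space :: "('a, 'b) monoid_scheme \<Rightarrow> 'a topology \<Rightarrow> 'a set topology" where
  "subgroup_space G T = topology_generated_by
     {subgroup_nhd G T H N | H N. H \<in> closed_subgroups G T \<and> N \<in> open_normal_subgroups G T}"

lemma subgroup_nhd_antimono:
  assumes "group G" "N \<lhd> G" "M \<lhd> G" "N \<subseteq> M" "H \<in> closed_subgroups G T"
  shows "subgroup_nhd G T H N \<subseteq> subgroup_nhd G T H M"
proof
  fix K assume K: "K \<in> subgroup_nhd G T H N"
  interpret group G by fact
  have sub: "N \<subseteq> carrier G" "M \<subseteq> carrier G" "H \<subseteq> carrier G" "K \<subseteq> carrier G"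
    using assms K by (auto simp: subgroup_nhd_def closed_subgroups_def
        dest: normal_imp_subgroup subgroup.subset)
  have sN: "subgroup N G" and sM: "subgroup M G"
    using assms by (auto dest: normal_imp_subgroup)
  have "N <#>\<^bsub>G\<^esub> M = M"
  proof
    show "N <#>\<^bsub>G\<^esub> M \<subseteq> M"
      using assms(4) subgroup.m_closed[OF sM] by (auto simp: set_mult_def)
    show "M \<subseteq> N <#>\<^bsub>G\<^esub> M"
    proof
      fix x assume "x \<in> M"
      then show "x \<in> N <#>\<^bsub>G\<^esub> M"
        using subgroup.one_closed[OF sN] sub(2) by (force simp: set_mult_def)
    qed
  qed
  then have "K <#>\<^bsub>G\<^esub> M = (K <#>\<^bsub>G\<^esub> N) <#>\<^bsub>G\<^esub> M" "H <#>\<^bsub>G\<^esub> M = (H <#>\<^bsub>G\<^esub> N) <#>\<^bsub>G\<^esub> M"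
    using set_mult_assoc sub by simp_all
  then show "K \<in> subgroup_nhd G T H M"
    using K by (simp add: subgroup_nhd_def)
qed

text \<open>The generating family is a base, and the sets \<^term>\<open>subgroup_nhd G T H N\<close> form a base of
  neighbourhoods of \<open>H\<close>:\<close>

lemma openin_subgroup_space_iff:
  assumes G: "topological_group G T"
  shows "openin (subgroup_space G T) U \<longleftrightarrow>
           U \<subseteq> closed_subgroups G T \<and>
           (\<forall>H\<in>U. \<exists>N\<in>open_normal_subgroups G T. subgroup_nhd G T H N \<subseteq> U)"
proof
  interpret group G using G by (simp add: topological_group_def)
  let ?B = "{subgroup_nhd G T H N | H N.
      H \<in> closed_subgroups G T \<and> N \<in> open_normal_subgroups G T}"
  show "openin (subgroup_space G T) U" if
    U: "U \<subseteq> closed_subgroups G T \<and>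
      (\<forall>H\<in>U. \<exists>N\<in>open_normal_subgroups G T. subgroup_nhd G T H N \<subseteq> U)"
  proof -
    have "U = \<Union>{S \<in> ?B. S \<subseteq> U}"
    proof
      show "U \<subseteq> \<Union>{S \<in> ?B. S \<subseteq> U}"
      proof
        fix H assume H: "H \<in> U"
        then obtain N where "N \<in> open_normal_subgroups G T" "subgroup_nhd G T H N \<subseteq> U"
          using U by blast
        moreover have "H \<in> subgroup_nhd G T H N" "H \<in> closed_subgroups G T"
          using H U by (auto simp: subgroup_nhd_def)
        ultimately show "H \<in> \<Union>{S \<in> ?B. S \<subseteq> U}" by blast
      qed
    qed blast
    moreover have "openin (subgroup_space G T) (\<Union>{S \<in> ?B. S \<subseteq> U})"
      unfolding subgroup_space_def
      by (rule openin_Union) (blast intro: topology_generated_by_Basis)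
    ultimately show ?thesis by simp
  qed
  assume "openin (subgroup_space G T) U"
  then have "generate_topology_on ?B U"
    by (simp add: subgroup_space_def openin_topology_generated_by_iff)
  then show "U \<subseteq> closed_subgroups G T \<and>
      (\<forall>H\<in>U. \<exists>N\<in>open_normal_subgroups G T. subgroup_nhd G T H N \<subseteq> U)"
  proof induction
    case Empty
    then show ?case by simp
  next
    case (Int a b)
    show ?case
    proof (intro conjI ballI)
      show "a \<inter> b \<subseteq> closed_subgroups G T" using Int by blast
      fix H assume H: "H \<in> a \<inter> b"
      then obtain N M where N: "N \<in> open_normal_subgroups G T" "subgroup_nhd G T H N \<subseteq> a"
        and M: "M \<in> open_normal_subgroups G T" "subgroup_nhd G T H M \<subseteq> b"
        using Int by blast
      have nNM: "N \<inter> M \<lhd> G"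
        using N M by (auto simp: open_normal_subgroups_def normal_inv_iff subgroups_Inter_pair)
      have "N \<inter> M \<in> open_normal_subgroups G T"
        using nNM N M by (auto simp: open_normal_subgroups_def)
      moreover have "subgroup_nhd G T H (N \<inter> M) \<subseteq> a \<inter> b"
        using subgroup_nhd_antimono[OF is_group nNM, of N H T]
          subgroup_nhd_antimono[OF is_group nNM, of M H T] N M H Int
        by (auto simp: open_normal_subgroups_def)
      ultimately show "\<exists>N\<in>open_normal_subgroups G T. subgroup_nhd G T H N \<subseteq> a \<inter> b" by blast
    qed
  next
    case (UN K)
    then show ?case by (meson Union_iff Union_least subset_iff)
  next
    case (Basis s)
    then show ?case by (fastforce simp: subgroup_nhd_def)
  qed
qed

lemma topspace_subgroup_space:
  assumes "topological_group G T"
  shows "topspace (subgroup_space G T) = closed_subgroups G T"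
proof -
  have "openin (subgroup_space G T) (closed_subgroups G T)"
  proof -
    interpret group G using assms by (simp add: topological_group_def)
    have "carrier G \<in> open_normal_subgroups G T"
      using assms normal_inv_iff subgroup_self openin_topspace[of T]
      by (auto simp: open_normal_subgroups_def topological_group_def)
    then show ?thesis
      unfolding openin_subgroup_space_iff[OF assms] by (auto simp: subgroup_nhd_def)
  qed
  moreover have "topspace (subgroup_space G T) \<subseteq> closed_subgroups G T"
    using openin_subgroup_space_iff[OF assms] openin_topspace by blast
  ultimately show ?thesis by (simp add: openin_subset subset_antisym)
qed


section \<open>Perfect spaces and the scattered height\<close>

definition isolated_points :: "'a topology \<Rightarrow> 'a set" where
  "isolated_points X = {x \<in> topspace X. openin X {x}}"

definition perfect_topology :: "'a topology \<Rightarrow> bool" where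
  "perfect_topology X \<longleftrightarrow> isolated_points X = {}"

text \<open>The derivative \<open>S'\<close> of a subset \<open>S\<close> of \<open>X\<close>, regarded as a space in its own right.\<close>

definition cb_derivative :: "'a topology \<Rightarrow> 'a set \<Rightarrow> 'a set" where
  "cb_derivative X S = S - isolated_points (subtopology X S)"

text \<open>
  Ordinals are represented by well-order relations, compared by \<^term>\<open>ordLeq\<close>; an element \<open>i\<close> of
  the field of a well-order \<open>r\<close> stands for the order type of its strict predecessors
  \<^term>\<open>underS r i\<close>.
\<close>

definition immediate_pred :: "'i rel \<Rightarrow> 'i \<Rightarrow> 'i \<Rightarrow> bool" where
  "immediate_pred r j i \<longleftrightarrow> j \<in> underS r i \<and> (\<forall>k\<in>underS r i. (k, j) \<in> r)"

definition iterated_derivative :: "'a topology \<Rightarrow> 'i rel \<Rightarrow> 'i \<Rightarrow> 'a set" where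
  "iterated_derivative X r = wo_rel.worec r (\<lambda>D i.
     if underS r i = {} then topspace X
     else if \<exists>j. immediate_pred r j i then cb_derivative X (D (THE j. immediate_pred r j i))
     else (\<Inter>j\<in>underS r i. D j))"

lemma iterated_derivative_unfold:
  fixes X :: "'a topology" and r :: "'i rel"
  assumes "Well_order r"
  shows "iterated_derivative X r i =
    (if underS r i = {} then topspace X
     else if \<exists>j. immediate_pred r j i
       then cb_derivative X (iterated_derivative X r (THE j. immediate_pred r j i))
     else (\<Inter>j\<in>underS r i. iterated_derivative X r j))"
proof -
  interpret wo_rel r using assms by (simp add: wo_rel_def)
  have uniq: "(THE j. immediate_pred r j i) = j" if "immediate_pred r j i" for i j
    using that ANTISYM by (intro the_equality) (auto simp: immediate_pred_def antisym_def)
  let ?H = "\<lambda>D i. if underS i = {} then topspace X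
     else if \<exists>j. immediate_pred r j i then cb_derivative X (D (THE j. immediate_pred r j i))
     else (\<Inter>j\<in>underS i. D j)"
  have "adm_wo ?H"
    unfolding adm_wo_def
  proof (intro allI impI)
    fix f g :: "'i \<Rightarrow> 'a set" and i
    assume eq: "\<forall>j\<in>underS i. f j = g j"
    have "f (THE j. immediate_pred r j i) = g (THE j. immediate_pred r j i)"
      if "immediate_pred r j i" for j
      using that uniq[OF that] eq by (simp add: immediate_pred_def)
    then show "?H f i = ?H g i" using eq by auto
  qed
  from worec_fixpoint[OF this] show ?thesis
    unfolding iterated_derivative_def by meson
qed

lemma iterated_derivative_zero:
  assumes "Well_order r" "underS r i = {}"
  shows "iterated_derivative X r i = topspace X"
  using assms by (simp add: iterated_derivative_unfold)

lemma iterated_derivative_Suc: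
  assumes "Well_order r" "immediate_pred r j i"
  shows "iterated_derivative X r i = cb_derivative X (iterated_derivative X r j)"
proof -
  interpret wo_rel r using assms by (simp add: wo_rel_def)
  have "(THE j. immediate_pred r j i) = j"
    using assms(2) ANTISYM by (intro the_equality) (auto simp: immediate_pred_def antisym_def)
  moreover have "underS i \<noteq> {}" using assms(2) by (auto simp: immediate_pred_def)
  ultimately show ?thesis
    using assms by (subst iterated_derivative_unfold) auto
qed

lemma iterated_derivative_limit:
  assumes "Well_order r" "underS r i \<noteq> {}" "\<nexists>j. immediate_pred r j i"
  shows "iterated_derivative X r i = (\<Inter>j\<in>underS r i. iterated_derivative X r j)"
  using assms by (subst iterated_derivative_unfold) auto

text \<open>
  The successor cardinal of the cardinality of \<open>X\<close> is a sufficiently long well-order along which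
  to iterate the derivative: the sequence becomes stationary at one of its elements.
\<close>

definition height_index :: "'a topology \<Rightarrow> 'a set" where
  "height_index X = (let r = cardSuc |topspace X| in
     wo_rel.minim r {i \<in> Field r.
       iterated_derivative X r i = cb_derivative X (iterated_derivative X r i)})"

definition scattered_height :: "'a topology \<Rightarrow> 'a set rel" where
  "scattered_height X = (let r = cardSuc |topspace X| in Restr r (underS r (height_index X)))"

lemma iterated_derivative_mono:
  assumes r: "Well_order r"
  shows "j \<in> underS r i \<Longrightarrow>
    iterated_derivative X r i \<subseteq> cb_derivative X (iterated_derivative X r j)"
proof -
  interpret wo_rel r using r by (simp add: wo_rel_def)
  show "j \<in> underS i \<Longrightarrow>
    iterated_derivative X r i \<subseteq> cb_derivative X (iterated_derivative X r j)"
  proof (induction i arbitrary: j rule: well_order_induct)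
    case (1 i)
    note IH = this(1) and j = this(2)
    have jF: "j \<in> Field r" using j by (auto simp: underS_def Field_def)
    show ?case
    proof (cases "\<exists>k. immediate_pred r k i")
      case True
      then obtain k where k: "immediate_pred r k i" by blast
      have ieq: "iterated_derivative X r i = cb_derivative X (iterated_derivative X r k)"
        by (rule iterated_derivative_Suc[OF r k])
      show ?thesis
      proof (cases "j = k")
        case False
        then have "j \<in> underS k" "k \<noteq> i" "(k, i) \<in> r"
          using k j by (auto simp: immediate_pred_def underS_def)
        then have "iterated_derivative X r k \<subseteq> cb_derivative X (iterated_derivative X r j)"
          using IH by blast
        then show ?thesis using ieq by (auto simp: cb_derivative_def)
      qed (simp add: ieq)
    next
      case False
      then obtain k where k: "k \<in> underS i" "(k, j) \<notin> r"
        using j by (auto simp: immediate_pred_def)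
      have kF: "k \<in> Field r" using k by (auto simp: underS_def Field_def)
      have "j \<in> underS k"
        using k kF jF TOTALS REFL by (auto simp: underS_def refl_on_def)
      then have "iterated_derivative X r k \<subseteq> cb_derivative X (iterated_derivative X r j)"
        using IH k by (auto simp: underS_def)
      moreover have "iterated_derivative X r i \<subseteq> iterated_derivative X r k"
      proof -
        have "underS i \<noteq> {}" using k by blast
        then show ?thesis using iterated_derivative_limit[OF r _ False, of X] k(1) by simp blast
      qed
      ultimately show ?thesis by blast
    qed
  qed
qed

lemma iterated_derivative_stationary:
  fixes X :: "'a topology"
  defines "r \<equiv> cardSuc |topspace X|"
  shows "\<exists>i\<in>Field r. iterated_derivative X r i = cb_derivative X (iterated_derivative X r i)"
proof (rule ccontr)
  assume neg: "\<not> ?thesis"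
  let ?D = "iterated_derivative X r"
  have r: "Card_order r" "Well_order r"
    by (simp_all add: r_def cardSuc_Card_order cardSuc_Well_order card_of_Card_order)
  interpret wo_rel r using r by (simp add: wo_rel_def)
  have sub: "?D i \<subseteq> topspace X" for i
  proof (induction i rule: well_order_induct)
    case (1 i)
    show ?case
    proof (cases "underS i = {}")
      case False
      then obtain j where j: "j \<in> underS i" by blast
      then have "?D i \<subseteq> cb_derivative X (?D j)" by (rule iterated_derivative_mono[OF r(2)])
      moreover have "?D j \<subseteq> topspace X" using 1 j by (auto simp: underS_def)
      ultimately show ?thesis by (auto simp: cb_derivative_def)
    qed (simp add: iterated_derivative_zero[OF r(2)])
  qed
  have "\<forall>i\<in>Field r. \<exists>x. x \<in> ?D i \<and> x \<notin> cb_derivative X (?D i)"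
    using neg by (auto simp: cb_derivative_def)
  then obtain f where f: "\<And>i. i \<in> Field r \<Longrightarrow> f i \<in> ?D i \<and> f i \<notin> cb_derivative X (?D i)"
    by metis
  have ne: "f i \<noteq> f j" if "i \<in> Field r" "j \<in> underS i" for i j
  proof -
    have "j \<in> Field r" using that(2) by (auto simp: underS_def Field_def)
    then show ?thesis
      using f[of i] f[of j] that iterated_derivative_mono[OF r(2) that(2), of X] by (metis subsetD)
  qed
  have "inj_on f (Field r)"
  proof (rule inj_onI, rule ccontr)
    fix i j assume ij: "i \<in> Field r" "j \<in> Field r" "f i = f j" "i \<noteq> j"
    then have "i \<in> underS j \<or> j \<in> underS i" using TOTALS by (auto simp: underS_def)
    then show False using ne ij by metis
  qed
  moreover have "f ` Field r \<subseteq> topspace X" using f sub by blast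
  ultimately have "|Field r| \<le>o |topspace X|" using card_of_ordLeq by blast
  moreover have "|Field r| =o r" by (rule card_of_Field_ordIso[OF r(1)])
  moreover have "|topspace X| <o r" by (simp add: r_def cardSuc_greater card_of_Card_order)
  ultimately show False
    using not_ordLess_ordLeq ordIso_ordLeq_trans ordIso_symmetric by metis
qed

end

theory Submission
  imports Defs "HOL-Algebra.Sylow" "HOL-Algebra.Generated_Groups"
begin

text \<open>
  Call a closed subgroup \<open>K\<close> scattered if some neighbourhood of it is a scattered space. Isolated
  points of suitable families of closed subgroups near \<open>K\<close> show that \<open>K\<close> is normal in an open
  subgroup that is topologically generated by \<open>K\<close> and one further element. Let \<open>B(K)\<close> be the set
  of primes \<open>p\<close> such that \<open>p\<^sup>\<infinity>\<close> divides the index of \<open>K\<close>; it is finite. If \<open>L \<noteq> K\<close> is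
  sufficiently close to \<open>K\<close>, then \<open>B(L)\<close> is a proper subset of \<open>B(K)\<close>: the inclusion holds because
  nongenerating normal subgroups are nilpotent in every finite quotient, by the Frattini argument,
  and equality would produce a procyclic group with an infinite \<open>p\<close>-subgroup of infinite
  \<open>p\<close>-index. Inductively, \<open>K\<close> is no longer present after \<open>card B(K) + 1\<close> derivatives. An isolated
  point of the \<open>(k+1)\<close>-st derivative would be scattered, so there is none.
\<close>

section \<open>Relative indices and Sylow subgroups\<close>

text \<open>Nongenerating normal subgroups come from the family of closed subgroups of
  \<open>K\<close> near \<open>K\<close>: isolation yields an open normal \<open>M\<close> such that
  no proper closed subgroup of \<open>K\<close> has the image of \<open>K\<close> modulo
  \<open>M\<close>. Applied to the open subgroups \<open>K <#> N\<close>, which are scattered as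
  well for small \<open>N\<close>, this brings in finite group theory. Infinite exponents cannot be
  cancelled from an equation between indices, so every comparison is made at a finite level: the
  index of a small open subgroup is split along a tower in which all factors but one have a bounded
  power of the prime, the bounds being fixed before the subgroup is chosen. The number k may be
  infinite. As B(K) is finite all the same, every scattered \<open>K\<close> leaves at a finite
  stage, and the intersection of the finite derivatives has no isolated points: the height is then
  at most \<omega>. For finite k, B(K) has at most k elements because the index of \<open>K\<close>
  divides the order of \<open>G\<close>. The additional 1 comes from the base case: with B(K) empty,
  \<open>K\<close> is isolated and the first derivative removes it.\<close>

lemma card_image_kernel_cong:
  assumes "\<And>x y. x \<in> F \<Longrightarrow> y \<in> F \<Longrightarrow> f x = f y \<longleftrightarrow> g x = g y"
  shows "card (f ` F) = card (g ` F)"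
proof -
  define h where "h C = g (SOME x. x \<in> F \<and> f x = C)" for C
  have h: "h (f x) = g x" if "x \<in> F" for x
  proof -
    have "\<exists>y. y \<in> F \<and> f y = f x" using that by blast
    from someI_ex[OF this] show ?thesis unfolding h_def using assms that by blast
  qed
  have "bij_betw h (f ` F) (g ` F)"
    unfolding bij_betw_def
  proof
    show "inj_on h (f ` F)" using h assms by (auto simp: inj_on_def)
    show "h ` f ` F = g ` F" using h by (simp add: image_image)
  qed
  then show ?thesis by (rule bij_betw_same_card)
qed

context group
begin

lemmas sgp_one = subgroup.one_closed[where G = G]
lemmas sgp_mult = subgroup.m_closed[where G = G]
lemmas sgp_inv = subgroup.m_inv_closed[where G = G]
lemmas sgp_mem = subgroup.mem_carrier[where G = G]
lemmas sgp_sub = subgroup.subset[where G = G]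

lemma inv_mult_cancel: "x \<in> carrier G \<Longrightarrow> y \<in> carrier G \<Longrightarrow> inv x \<otimes> (x \<otimes> y) = y"
  by (simp flip: m_assoc)

lemma mult_inv_cancel: "x \<in> carrier G \<Longrightarrow> y \<in> carrier G \<Longrightarrow> x \<otimes> (inv x \<otimes> y) = y"
  by (simp flip: m_assoc)

lemmas grp_simps = m_assoc inv_mult_group inv_mult_cancel mult_inv_cancel

section \<open>Indices of subgroups that need not be nested\<close>

text \<open>For subgroups this is the index of \<open>F \<inter> H\<close> in \<open>F\<close>; the
  trace of an open subgroup on a closed one thus has an index without forming the intersection.
  Infinitely many cosets give the value 0, hence the finiteness hypotheses below.\<close>

definition rel_index :: "'a set \<Rightarrow> 'a set \<Rightarrow> nat" where
  "rel_index F H = card ((\<lambda>x. H #> x) ` F)"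

lemma rcos_eq_iff:
  assumes "subgroup H G" "x \<in> carrier G" "y \<in> carrier G"
  shows "H #> x = H #> y \<longleftrightarrow> x \<otimes> inv y \<in> H"
proof
  assume "H #> x = H #> y"
  then have "x \<in> H #> y" using rcos_self[OF assms(2,1)] by simp
  then show "x \<otimes> inv y \<in> H"
    using assms subgroup.rcos_module_imp is_group by metis
next
  assume "x \<otimes> inv y \<in> H"
  then have "x \<in> H #> y"
    using assms subgroup.rcos_module_rev is_group by metis
  then show "H #> x = H #> y" using repr_independence assms by metis
qed

lemma rcos_eq_mem_iff:
  assumes "subgroup H G" "x \<in> carrier G" "y \<in> carrier G"
  shows "H #> x = H #> y \<longleftrightarrow> x \<in> H #> y"
  using assms rcos_self repr_independence by metis

lemma rel_index_cong:
  assumes "\<And>x y. x \<in> F \<Longrightarrow> y \<in> F \<Longrightarrow> H #> x = H #> y \<longleftrightarrow> H' #> x = H' #> y"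
  shows "rel_index F H = rel_index F H'"
  unfolding rel_index_def by (rule card_image_kernel_cong) (rule assms)

lemma rel_index_inter:
  assumes "subgroup H G" "subgroup E G" "F \<subseteq> E"
  shows "rel_index F (E \<inter> H) = rel_index F H"
proof (rule rel_index_cong)
  fix x y assume xy: "x \<in> F" "y \<in> F"
  then have c: "x \<in> carrier G" "y \<in> carrier G" "x \<in> E" "y \<in> E"
    using assms subgroup.subset by blast+
  have "x \<otimes> inv y \<in> E" using c assms by (simp add: subgroup.m_closed subgroup.m_inv_closed)
  then show "(E \<inter> H) #> x = (E \<inter> H) #> y \<longleftrightarrow> H #> x = H #> y"
    using c assms subgroups_Inter_pair[of E H] by (simp add: rcos_eq_iff)
qed

lemma rel_index_same_cosets:
  assumes "A \<subseteq> B" "\<And>x. x \<in> B \<Longrightarrow> \<exists>y\<in>A. H #> x = H #> y"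
  shows "rel_index B H = rel_index A H"
proof -
  have "(\<lambda>x. H #> x) ` B = (\<lambda>x. H #> x) ` A"
    using assms by (force simp: image_iff)
  then show ?thesis by (simp add: rel_index_def)
qed

text \<open>\<open>H #> x\<close> equals \<open>H <#> (H' #> x)\<close>, so each coset of the larger
  subgroup is determined by one of the smaller.\<close>

lemma finite_cosets_mono:
  assumes "subgroup H G" "subgroup H' G" "H' \<subseteq> H" "F \<subseteq> carrier G" "finite ((\<lambda>x. H' #> x) ` F)"
  shows "finite ((\<lambda>x. H #> x) ` F)"
proof -
  have "(\<lambda>x. H #> x) ` F \<subseteq> (\<lambda>C. H <#> C) ` (\<lambda>x. H' #> x) ` F"
  proof
    fix C assume "C \<in> (\<lambda>x. H #> x) ` F"
    then obtain x where x: "x \<in> F" "C = H #> x" by blast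
    have "H <#> H' = H"
    proof
      show "H <#> H' \<subseteq> H" using assms subgroup.m_closed by (fastforce simp: set_mult_def)
      show "H \<subseteq> H <#> H'"
      proof
        fix h assume "h \<in> H"
        moreover have "h \<otimes> \<one> = h" using calculation assms subgroup.mem_carrier by fastforce
        moreover have "\<one> \<in> H'" using assms subgroup.one_closed by blast
        ultimately show "h \<in> H <#> H'" unfolding set_mult_def by fastforce
      qed
    qed
    then have "H <#> (H' #> x) = H #> x"
      using assms x subgroup.subset setmult_rcos_assoc by (metis subsetD)
    then show "C \<in> (\<lambda>C. H <#> C) ` (\<lambda>x. H' #> x) ` F" using x by blast
  qed
  then show ?thesis using assms(5) finite_surj finite_subset by blast
qed

text \<open>The cosets of \<open>H'\<close> meeting \<open>F\<close> are sorted by the coset of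
  \<open>H\<close> containing them. Right translation by \<open>x\<close> carries the cosets met by
  \<open>F \<inter> H\<close> onto \<open>cls x\<close>, so all classes have the same size.\<close>

lemma rel_index_tower:
  assumes F: "subgroup F G" and H: "subgroup H G" and H': "subgroup H' G" and "H' \<subseteq> H"
    and fin: "finite ((\<lambda>x. H' #> x) ` F)"
  shows "rel_index F H' = rel_index F H * rel_index (F \<inter> H) H'"
proof -
  let ?X = "(\<lambda>x. H' #> x) ` F" and ?Y = "(\<lambda>x. H #> x) ` F"
  define cls where "cls x = {H' #> y | y. y \<in> F \<and> H #> y = H #> x}" for x
  have Fc: "F \<subseteq> carrier G" and Hc: "H \<subseteq> carrier G" and H'c: "H' \<subseteq> carrier G" using assms subgroup.subset by blast+
  have card_cls: "card (cls x) = rel_index (F \<inter> H) H'" if x: "x \<in> F" for x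
  proof -
    have xc: "x \<in> carrier G" using x Fc by blast
    have eq: "cls x = (\<lambda>C. C #> x) ` (\<lambda>h. H' #> h) ` (F \<inter> H)"
    proof (intro equalityI subsetI)
      fix C assume "C \<in> cls x"
      then obtain y where y: "y \<in> F" "H #> y = H #> x" "C = H' #> y" by (auto simp: cls_def)
      have yc: "y \<in> carrier G" using y Fc by blast
      have "y \<otimes> inv x \<in> F \<inter> H"
        using y x yc xc F H by (auto simp: rcos_eq_iff subgroup.m_closed subgroup.m_inv_closed)
      moreover have "(H' #> (y \<otimes> inv x)) #> x = H' #> y"
        using yc xc H'c by (simp add: coset_mult_assoc m_assoc)
      ultimately show "C \<in> (\<lambda>C. C #> x) ` (\<lambda>h. H' #> h) ` (F \<inter> H)"
        using y(3) by (metis image_eqI)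
    next
      fix C assume "C \<in> (\<lambda>C. C #> x) ` (\<lambda>h. H' #> h) ` (F \<inter> H)"
      then obtain h where h: "h \<in> F" "h \<in> H" "C = (H' #> h) #> x" by auto
      have hc: "h \<in> carrier G" using h Fc by blast
      have "C = H' #> (h \<otimes> x)" using h hc xc H'c by (simp add: coset_mult_assoc)
      moreover have "h \<otimes> x \<in> F" using h x F subgroup.m_closed by metis
      moreover have "H #> (h \<otimes> x) = H #> x"
        using H h hc xc by (simp add: rcos_eq_iff m_assoc)
      ultimately show "C \<in> cls x" by (auto simp: cls_def)
    qed
    have "inj_on (\<lambda>C. C #> x) ((\<lambda>h. H' #> h) ` (F \<inter> H))"
    proof (rule inj_onI)
      fix C D assume "C \<in> (\<lambda>h. H' #> h) ` (F \<inter> H)" "D \<in> (\<lambda>h. H' #> h) ` (F \<inter> H)"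
        and e: "C #> x = D #> x"
      then have c: "C \<subseteq> carrier G" "D \<subseteq> carrier G" using Fc H'c r_coset_subset_G by blast+
      have "(C #> x) #> inv x = (D #> x) #> inv x" using e by simp
      then show "C = D" using c xc by (simp add: coset_mult_assoc)
    qed
    then show ?thesis unfolding eq rel_index_def by (rule card_image)
  qed
  have un: "\<Union> (cls ` F) = ?X" by (auto simp: cls_def)
  have clseq: "cls x = cls y" if "H #> x = H #> y" for x y using that by (simp add: cls_def)
  have disj: "cls x \<inter> cls y = {}" if xy: "x \<in> F" "y \<in> F" "H #> x \<noteq> H #> y" for x y
  proof (rule ccontr)
    assume "cls x \<inter> cls y \<noteq> {}"
    then obtain a b where ab: "a \<in> F" "b \<in> F" "H #> a = H #> x" "H #> b = H #> y" "H' #> a = H' #> b"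
      unfolding cls_def by blast
    then have ac: "a \<in> carrier G" "b \<in> carrier G" using Fc by blast+
    have "a \<otimes> inv b \<in> H'" using ab(5) rcos_eq_iff[OF H' ac] by simp
    then have "H #> a = H #> b" using \<open>H' \<subseteq> H\<close> rcos_eq_iff[OF H ac] by blast
    then show False using ab xy by simp
  qed
  have bij: "card (cls ` F) = card ?Y"
  proof -
    have ne: "H' #> x \<in> cls x" if "x \<in> F" for x using that by (auto simp: cls_def)
    define g where "g C = cls (SOME x. x \<in> F \<and> H #> x = C)" for C
    have g: "g (H #> x) = cls x" if "x \<in> F" for x
    proof -
      have "\<exists>y. y \<in> F \<and> H #> y = H #> x" using that by blast
      from someI_ex[OF this] show ?thesis unfolding g_def using clseq by blast
    qed
    have "bij_betw g ?Y (cls ` F)"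
      unfolding bij_betw_def
    proof
      show "inj_on g ?Y"
      proof (rule inj_onI)
        fix C D assume "C \<in> ?Y" "D \<in> ?Y" "g C = g D"
        then obtain x y where xy: "x \<in> F" "y \<in> F" "C = H #> x" "D = H #> y" "cls x = cls y"
          using g by auto
        then show "C = D" using disj[of x y] ne by blast
      qed
      show "g ` ?Y = cls ` F" using g by (simp add: image_image)
    qed
    then show ?thesis using bij_betw_same_card by metis
  qed
  have "card (\<Union> (cls ` F)) = rel_index (F \<inter> H) H' * card (cls ` F)"
  proof (rule card_partition[symmetric])
    show "finite (\<Union> (cls ` F))" using fin un by simp
    then show "finite (cls ` F)" using finite_UnionD by blast
    show "card c = rel_index (F \<inter> H) H'" if "c \<in> cls ` F" for c using that card_cls by auto
    show "c1 \<inter> c2 = {}" if "c1 \<in> cls ` F" "c2 \<in> cls ` F" "c1 \<noteq> c2" for c1 c2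
      using that disj clseq by blast
  qed
  then show ?thesis using un bij unfolding rel_index_def by simp
qed

lemma rel_index_pos:
  assumes "F \<noteq> {}" "finite ((\<lambda>x. H #> x) ` F)"
  shows "rel_index F H > 0"
  using assms by (simp add: rel_index_def card_gt_0_iff)

lemma rel_index_one: "H \<subseteq> carrier G \<Longrightarrow> rel_index H {\<one>} = card H"
proof -
  assume "H \<subseteq> carrier G"
  then have "(\<lambda>x. {\<one>} #> x) ` H = (\<lambda>x. {x}) ` H"
    by (intro image_cong) (auto simp: r_coset_def)
  then show ?thesis by (simp add: rel_index_def card_image)
qed

lemma rel_index_eq_1D:
  assumes "rel_index F H = 1" "subgroup F G" "subgroup H G"
  shows "F \<subseteq> H"
proof
  fix x assume x: "x \<in> F"
  from assms(1) obtain C where "(\<lambda>x. H #> x) ` F = {C}"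
    unfolding rel_index_def by (meson card_1_singletonE)
  then have "H #> x = C" "H #> \<one> = C" using x assms(2) subgroup.one_closed by blast+
  then have "H #> x = H #> \<one>" by simp
  then show "x \<in> H" using rcos_eq_iff[OF assms(3), of x \<one>] x assms(2) subgroup.mem_carrier by fastforce
qed

section \<open>Products of a subgroup with a subgroup normalizing it\<close>

lemma subgroup_set_mult:
  assumes K: "subgroup K G" and A: "subgroup A G"
    and norm: "\<And>a k. a \<in> A \<Longrightarrow> k \<in> K \<Longrightarrow> a \<otimes> k \<otimes> inv a \<in> K"
  shows "subgroup (K <#> A) G" "K <#> A = A <#> K" "K \<subseteq> K <#> A" "A \<subseteq> K <#> A"
proof -
  have c: "K \<subseteq> carrier G" "A \<subseteq> carrier G" using assms sgp_sub by blast+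
  show sub1: "K \<subseteq> K <#> A"
  proof
    fix x assume x: "x \<in> K"
    then have "x = x \<otimes> \<one>" using c by auto
    then show "x \<in> K <#> A" unfolding set_mult_def using x sgp_one[OF A] by blast
  qed
  show sub2: "A \<subseteq> K <#> A"
  proof
    fix x assume x: "x \<in> A"
    then have "x = \<one> \<otimes> x" using c by auto
    then show "x \<in> K <#> A" unfolding set_mult_def using x sgp_one[OF K] by blast
  qed
  show "subgroup (K <#> A) G"
  proof (rule subgroupI)
    show "K <#> A \<subseteq> carrier G" using c set_mult_closed by blast
    show "K <#> A \<noteq> {}" using sub1 sgp_one[OF K] by blast
    show "inv x \<in> K <#> A" if x: "x \<in> K <#> A" for x
    proof -
      obtain k a where ka: "k \<in> K" "a \<in> A" "x = k \<otimes> a" using x by (auto simp: set_mult_def)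
      have kac: "k \<in> carrier G" "a \<in> carrier G" using ka c by auto
      have "inv a \<otimes> inv k \<otimes> inv (inv a) \<in> K"
        using norm ka sgp_inv[OF A] sgp_inv[OF K] by blast
      moreover have "inv x = (inv a \<otimes> inv k \<otimes> inv (inv a)) \<otimes> inv a"
        using ka kac by (simp add: grp_simps)
      ultimately show ?thesis using sgp_inv[OF A ka(2)] unfolding set_mult_def by blast
    qed
    show "x \<otimes> y \<in> K <#> A" if xy: "x \<in> K <#> A" "y \<in> K <#> A" for x y
    proof -
      obtain k a where ka: "k \<in> K" "a \<in> A" "x = k \<otimes> a" using xy by (auto simp: set_mult_def)
      obtain l b where lb: "l \<in> K" "b \<in> A" "y = l \<otimes> b" using xy by (auto simp: set_mult_def)
      have kac: "k \<in> carrier G" "a \<in> carrier G" "l \<in> carrier G" "b \<in> carrier G" using ka lb c by auto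
      have "k \<otimes> (a \<otimes> l \<otimes> inv a) \<in> K" using norm ka lb sgp_mult[OF K] by blast
      moreover have "a \<otimes> b \<in> A" using ka lb sgp_mult[OF A] by blast
      moreover have "x \<otimes> y = (k \<otimes> (a \<otimes> l \<otimes> inv a)) \<otimes> (a \<otimes> b)"
        using ka lb kac by (simp add: grp_simps)
      ultimately show ?thesis unfolding set_mult_def by blast
    qed
  qed
  show "K <#> A = A <#> K"
  proof (intro equalityI subsetI)
    fix x assume "x \<in> K <#> A"
    then obtain k a where ka: "k \<in> K" "a \<in> A" "x = k \<otimes> a" by (auto simp: set_mult_def)
    have kac: "k \<in> carrier G" "a \<in> carrier G" using ka c by auto
    have "inv a \<otimes> k \<otimes> inv (inv a) \<in> K" using norm ka sgp_inv[OF A] by blast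
    moreover have "x = a \<otimes> (inv a \<otimes> k \<otimes> inv (inv a))" using ka kac by (simp add: grp_simps)
    ultimately show "x \<in> A <#> K" unfolding set_mult_def using ka by blast
  next
    fix x assume "x \<in> A <#> K"
    then obtain k a where ka: "k \<in> K" "a \<in> A" "x = a \<otimes> k" by (auto simp: set_mult_def)
    have kac: "k \<in> carrier G" "a \<in> carrier G" using ka c by auto
    have "a \<otimes> k \<otimes> inv a \<in> K" using norm ka by blast
    moreover have "x = (a \<otimes> k \<otimes> inv a) \<otimes> a" using ka kac by (simp add: grp_simps)
    ultimately show "x \<in> K <#> A" unfolding set_mult_def using ka by blast
  qed
qed

lemma normal_subgroup_set_mult:
  assumes "N \<lhd> G" "subgroup H G"
  shows "subgroup (N <#> H) G" "N <#> H = H <#> N" "N \<subseteq> N <#> H" "H \<subseteq> N <#> H"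
proof -
  have "subgroup N G" using assms normal_imp_subgroup by blast
  moreover have "a \<otimes> k \<otimes> inv a \<in> N" if "a \<in> H" "k \<in> N" for a k
    using that normal.inv_op_closed2[OF assms(1)] sgp_mem[OF assms(2)] by blast
  ultimately show "subgroup (N <#> H) G" "N <#> H = H <#> N" "N \<subseteq> N <#> H" "H \<subseteq> N <#> H"
    using subgroup_set_mult[of N H] assms(2) by auto
qed


text \<open>Lagrange's theorem, from the tower law with the trivial subgroup at the bottom.\<close>

lemma card_eq_rel_index:
  assumes "subgroup H G" "subgroup T G" "finite H"
  shows "card H = rel_index H T * card (H \<inter> T)"
proof -
  have "rel_index H {\<one>} = rel_index H T * rel_index (H \<inter> T) {\<one>}"
    by (rule rel_index_tower) (use assms triv_subgroup sgp_one in auto)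
  moreover have "H \<subseteq> carrier G" "H \<inter> T \<subseteq> carrier G" using assms sgp_sub by blast+
  ultimately show ?thesis by (simp add: rel_index_one)
qed

section \<open>Sylow theory and nongenerating normal subgroups of finite groups\<close>

lemma sylow_subgroup:
  assumes "subgroup N G" "finite N" "prime q"
  shows "\<exists>S. subgroup S G \<and> S \<subseteq> N \<and> card S = q ^ multiplicity q (card N)"
proof -
  interpret N: group "G\<lparr>carrier := N\<rparr>" using assms subgroup_imp_group by blast
  have "card N \<noteq> 0" using assms(2) sgp_one[OF assms(1)] by auto
  then obtain m where "card N = q ^ multiplicity q (card N) * m"
    using multiplicity_dvd dvdE by metis
  then obtain S where S: "subgroup S (G\<lparr>carrier := N\<rparr>)" "card S = q ^ multiplicity q (card N)"
    using sylow_thm[OF \<open>prime q\<close> N.is_group, of "multiplicity q (card N)" m] assms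
    by (auto simp: order_def)
  then show ?thesis using incl_subgroup[OF assms(1) S(1)] subgroup.subset[OF S(1)] by auto
qed

lemma subgroup_conj_vimage:
  assumes "subgroup S G" "x \<in> carrier G"
  shows "subgroup {y \<in> carrier G. x \<otimes> y \<otimes> inv x \<in> S} G"
proof (rule subgroupI)
  let ?T = "{y \<in> carrier G. x \<otimes> y \<otimes> inv x \<in> S}"
  have "\<one> \<in> ?T" using assms sgp_one by simp
  then show "?T \<noteq> {}" by blast
  show "inv y \<in> ?T" if y: "y \<in> ?T" for y
  proof -
    have "inv (x \<otimes> y \<otimes> inv x) \<in> S" using assms y sgp_inv by blast
    moreover have "inv (x \<otimes> y \<otimes> inv x) = x \<otimes> inv y \<otimes> inv x"
      using assms y by (simp add: grp_simps)
    ultimately show ?thesis using y by simp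
  qed
  show "y \<otimes> z \<in> ?T" if y: "y \<in> ?T" "z \<in> ?T" for y z
  proof -
    have "(x \<otimes> y \<otimes> inv x) \<otimes> (x \<otimes> z \<otimes> inv x) \<in> S" using assms y sgp_mult by blast
    moreover have "(x \<otimes> y \<otimes> inv x) \<otimes> (x \<otimes> z \<otimes> inv x) = x \<otimes> (y \<otimes> z) \<otimes> inv x"
      using assms y by (simp add: grp_simps)
    ultimately show ?thesis using y by simp
  qed
qed auto

text \<open>\<open>S'\<close> permutes the right cosets of \<open>S\<close> in \<open>N\<close>, whose number is prime to \<open>q\<close>, so it
  fixes one of them.\<close>

lemma sylow_conjugate:
  assumes N: "subgroup N G" "finite N" and q: "prime q"
    and S: "subgroup S G" "S \<subseteq> N" "card S = q ^ multiplicity q (card N)"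
    and S': "subgroup S' G" "S' \<subseteq> N" "card S' = q ^ a"
  shows "\<exists>n\<in>N. \<forall>s\<in>S'. n \<otimes> s \<otimes> inv n \<in> S"
proof (rule ccontr)
  assume neg: "\<not> ?thesis"
  have Nc: "N \<subseteq> carrier G" using N sgp_sub by blast
  have S'c: "S' \<subseteq> carrier G" using S' Nc by blast
  have Sc: "S \<subseteq> carrier G" using S Nc by blast
  define orb where "orb x = (\<lambda>s. S #> (x \<otimes> s)) ` S'" for x
  have dvd: "q dvd card (orb x)" if x: "x \<in> N" for x
  proof -
    have xc: "x \<in> carrier G" using x Nc by blast
    \<comment> \<open>\<open>?T\<close> is the conjugate of \<open>S\<close> by
      \<open>inv x\<close>; its trace on \<open>S'\<close> is the stabilizer of the coset
      \<open>S #> x\<close>, so the orbit has size \<open>rel_index S' ?T\<close>, a power of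
      \<open>q\<close>.\<close>
    let ?T = "{y \<in> carrier G. x \<otimes> y \<otimes> inv x \<in> S}"
    have T: "subgroup ?T G" by (rule subgroup_conj_vimage) (use S xc in auto)
    have "card (orb x) = rel_index S' ?T"
      unfolding orb_def rel_index_def
    proof (rule card_image_kernel_cong)
      fix s t assume st: "s \<in> S'" "t \<in> S'"
      then have c: "s \<in> carrier G" "t \<in> carrier G" using S'c by auto
      have "(x \<otimes> s) \<otimes> inv (x \<otimes> t) = x \<otimes> (s \<otimes> inv t) \<otimes> inv x"
        using c xc by (simp add: grp_simps)
      then show "S #> (x \<otimes> s) = S #> (x \<otimes> t) \<longleftrightarrow> ?T #> s = ?T #> t"
        using c xc rcos_eq_iff[OF S(1)] rcos_eq_iff[OF T] by simp
    qed
    moreover have "card S' = rel_index S' ?T * card (S' \<inter> ?T)"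
      by (rule card_eq_rel_index) (use S' T N finite_subset in auto)
    ultimately have "card (orb x) dvd card S'" by simp
    then have "card (orb x) dvd q ^ a" using S'(3) by simp
    then obtain i where i: "card (orb x) = q ^ i" using divides_primepow_nat[OF q] by blast
    \<comment> \<open>An orbit of size one would mean that \<open>x\<close> conjugates
      \<open>S'\<close> into \<open>S\<close>, which \<open>neg\<close> excludes.\<close>
    have "i \<noteq> 0"
    proof
      assume "i = 0"
      then have "rel_index S' ?T = 1" using i \<open>card (orb x) = rel_index S' ?T\<close> by simp
      then have "S' \<subseteq> ?T" using rel_index_eq_1D S' T by blast
      then show False using neg x by blast
    qed
    then show ?thesis using i by (simp add: dvd_power)
  qed
  have un: "\<Union> (orb ` N) = (\<lambda>x. S #> x) ` N"
  proof
    show "\<Union> (orb ` N) \<subseteq> (\<lambda>x. S #> x) ` N"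
      using S'(2) sgp_mult[OF N(1)] unfolding orb_def by blast
    show "(\<lambda>x. S #> x) ` N \<subseteq> \<Union> (orb ` N)"
    proof
      fix C assume "C \<in> (\<lambda>x. S #> x) ` N"
      then obtain x where "x \<in> N" "C = S #> (x \<otimes> \<one>)" using Nc by auto
      then show "C \<in> \<Union> (orb ` N)" using sgp_one[OF S'(1)] unfolding orb_def by blast
    qed
  qed
  have disj: "orb x = orb y" if xy: "x \<in> N" "y \<in> N" "orb x \<inter> orb y \<noteq> {}" for x y
  proof -
    have sub: "orb x \<subseteq> orb y" if xy: "x \<in> N" "y \<in> N" "s \<in> S'" "t \<in> S'" "S #> (x \<otimes> s) = S #> (y \<otimes> t)" for x y s t
    proof
      fix C assume "C \<in> orb x"
      then obtain u where u: "u \<in> S'" "C = S #> (x \<otimes> u)" by (auto simp: orb_def)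
      have c: "x \<in> carrier G" "y \<in> carrier G" "s \<in> carrier G" "t \<in> carrier G" "u \<in> carrier G"
        using xy u Nc S'c by auto
      have "S #> (x \<otimes> u) = S #> (x \<otimes> s) #> (inv s \<otimes> u)"
        using c Sc by (simp add: coset_mult_assoc grp_simps)
      also have "\<dots> = S #> (y \<otimes> (t \<otimes> (inv s \<otimes> u)))"
        using c Sc xy(5) by (simp add: coset_mult_assoc grp_simps)
      finally have "C = S #> (y \<otimes> (t \<otimes> (inv s \<otimes> u)))" using u by simp
      moreover have "t \<otimes> (inv s \<otimes> u) \<in> S'"
        using xy u S' by (simp add: sgp_mult sgp_inv)
      ultimately show "C \<in> orb y" unfolding orb_def by blast
    qed
    from xy(3) obtain s t where st: "s \<in> S'" "t \<in> S'" "S #> (x \<otimes> s) = S #> (y \<otimes> t)"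
      unfolding orb_def by blast
    show ?thesis
      using sub[OF xy(1,2) st] sub[OF xy(2,1) st(2,1) st(3)[symmetric]] by blast
  qed
  have "q dvd card (\<Union> (orb ` N))"
  proof (rule dvd_partition)
    show "finite (\<Union> (orb ` N))" using un N by simp
    show "\<forall>c\<in>orb ` N. q dvd card c" using dvd by blast
    show "\<forall>c1\<in>orb ` N. \<forall>c2\<in>orb ` N. c1 \<noteq> c2 \<longrightarrow> c1 \<inter> c2 = {}" using disj by blast
  qed
  then have "q dvd rel_index N S" using un by (simp add: rel_index_def)
  moreover have "card N = rel_index N S * card S"
    using card_eq_rel_index[OF N(1) S(1) N(2)] S(2) by (simp add: Int_absorb1)
  ultimately have "q * card S dvd card N" by (simp add: mult_dvd_mono)
  then have "q ^ Suc (multiplicity q (card N)) dvd card N" unfolding S(3) by simp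
  moreover have "card N \<noteq> 0" using N(2) sgp_one[OF N(1)] by auto
  ultimately show False
    using q by (metis multiplicity_geI not_less_eq_eq not_prime_unit order_refl)
qed

text \<open>By the Frattini argument the normalizer of \<open>S\<close> supplements \<open>N\<close>.\<close>

lemma frattini_sylow_normal:
  assumes fin: "finite (carrier G)" and N: "N \<lhd> G" and q: "prime q"
    and ng: "\<And>X. subgroup X G \<Longrightarrow> X <#> N = carrier G \<Longrightarrow> X = carrier G"
    and S: "subgroup S G" "S \<subseteq> N" "card S = q ^ multiplicity q (card N)"
  shows "S \<lhd> G"
proof -
  have Nsub: "subgroup N G" using N normal_imp_subgroup by blast
  have Nc: "N \<subseteq> carrier G" using Nsub sgp_sub by blast
  have Sc: "S \<subseteq> carrier G" using S Nc by blast
  \<comment> \<open>The normalizer of \<open>S\<close>. One direction of conjugation is enough here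
    because \<open>S\<close> is finite.\<close>
  define R where "R = {g \<in> carrier G. \<forall>s\<in>S. g \<otimes> s \<otimes> inv g \<in> S}"
  have inj: "inj_on (\<lambda>s. g \<otimes> s \<otimes> inv g) S" if "g \<in> carrier G" for g
    using that Sc by (auto simp: inj_on_def subset_iff)
  have R: "subgroup R G"
  proof (rule subgroupI)
    have "\<one> \<in> R" using Sc unfolding R_def by auto
    then show "R \<noteq> {}" by blast
    show "inv g \<in> R" if g: "g \<in> R" for g
    proof -
      have gc: "g \<in> carrier G" using g R_def by blast
      have "(\<lambda>s. g \<otimes> s \<otimes> inv g) ` S \<subseteq> S" using g R_def by blast
      moreover have "finite S" using Sc fin finite_subset by blast
      ultimately have surj: "(\<lambda>s. g \<otimes> s \<otimes> inv g) ` S = S"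
        using inj[OF gc] by (simp add: endo_inj_surj)
      have "inv g \<otimes> s \<otimes> inv (inv g) \<in> S" if s: "s \<in> S" for s
      proof -
        obtain t where t: "t \<in> S" "s = g \<otimes> t \<otimes> inv g" using surj s by blast
        have tc: "t \<in> carrier G" using t Sc by blast
        have "inv g \<otimes> s \<otimes> inv (inv g) = t" using t(2) tc gc
          by (simp add: grp_simps)
        then show ?thesis using t by simp
      qed
      then show ?thesis using gc unfolding R_def by simp
    qed
    show "g \<otimes> h \<in> R" if gh: "g \<in> R" "h \<in> R" for g h
    proof -
      have c: "g \<in> carrier G" "h \<in> carrier G" using gh R_def by auto
      have "(g \<otimes> h) \<otimes> s \<otimes> inv (g \<otimes> h) \<in> S" if s: "s \<in> S" for s
      proof -
        have "g \<otimes> (h \<otimes> s \<otimes> inv h) \<otimes> inv g \<in> S" using gh s R_def by blast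
        moreover have "g \<otimes> (h \<otimes> s \<otimes> inv h) \<otimes> inv g = (g \<otimes> h) \<otimes> s \<otimes> inv (g \<otimes> h)"
          using c s Sc by (auto simp: grp_simps)
        ultimately show ?thesis by simp
      qed
      then show ?thesis using c unfolding R_def by simp
    qed
  qed (auto simp: R_def)
  have "carrier G \<subseteq> R <#> N"
  proof
    fix g assume g: "g \<in> carrier G"
    let ?S' = "{y \<in> carrier G. inv g \<otimes> y \<otimes> inv (inv g) \<in> S}"
    have S'sub: "subgroup ?S' G" by (rule subgroup_conj_vimage) (use S g in auto)
    have eq: "?S' = (\<lambda>s. g \<otimes> s \<otimes> inv g) ` S"
    proof (intro equalityI subsetI)
      fix y assume y: "y \<in> ?S'"
      then have "y = g \<otimes> (inv g \<otimes> y \<otimes> inv (inv g)) \<otimes> inv g"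
        using g by (simp add: grp_simps)
      then show "y \<in> (\<lambda>s. g \<otimes> s \<otimes> inv g) ` S" using y by blast
    next
      fix y assume "y \<in> (\<lambda>s. g \<otimes> s \<otimes> inv g) ` S"
      then obtain s where s: "s \<in> S" "y = g \<otimes> s \<otimes> inv g" by blast
      then have "inv g \<otimes> y \<otimes> inv (inv g) = s" using g Sc
        by (auto simp: grp_simps subset_iff)
      then show "y \<in> ?S'" using s g Sc by auto
    qed
    \<comment> \<open>\<open>S\<close> and its conjugate by \<open>g\<close> are both Sylow
      subgroups of \<open>N\<close>, so some \<open>n\<close> in \<open>N\<close> moves the
      conjugate back to \<open>S\<close>; then \<open>n \<otimes> g\<close> lies in
      \<open>R\<close>.\<close>
    have "\<exists>n\<in>N. \<forall>s\<in>?S'. n \<otimes> s \<otimes> inv n \<in> S"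
    proof (rule sylow_conjugate[OF Nsub _ q S S'sub])
      show "finite N" using Nc fin finite_subset by blast
      show "?S' \<subseteq> N" unfolding eq using S(2) normal.inv_op_closed2[OF N g] by blast
      show "card ?S' = q ^ multiplicity q (card N)" unfolding eq using inj[OF g] S(3) by (simp add: card_image)
    qed
    then obtain n where n: "n \<in> N" "\<And>s. s \<in> S \<Longrightarrow> n \<otimes> (g \<otimes> s \<otimes> inv g) \<otimes> inv n \<in> S"
      unfolding eq by blast
    have nc: "n \<in> carrier G" using n Nc by blast
    have "n \<otimes> g \<in> R" unfolding R_def
    proof (intro CollectI conjI ballI)
      fix s assume s: "s \<in> S"
      have "n \<otimes> g \<otimes> s \<otimes> inv (n \<otimes> g) = n \<otimes> (g \<otimes> s \<otimes> inv g) \<otimes> inv n"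
        using nc g s Sc by (auto simp: grp_simps)
      then show "n \<otimes> g \<otimes> s \<otimes> inv (n \<otimes> g) \<in> S" using n s by simp
    qed (use nc g in simp)
    moreover have "g = inv n \<otimes> (n \<otimes> g)" using nc g by (simp add: grp_simps)
    moreover have "inv n \<in> N" using n Nsub sgp_inv by blast
    ultimately have "g \<in> N <#> R" unfolding set_mult_def by blast
    then show "g \<in> R <#> N" using normal_subgroup_set_mult(2)[OF N R] by simp
  qed
  then have "R <#> N = carrier G"
    using set_mult_closed[OF sgp_sub[OF R] Nc] by blast
  then have "R = carrier G" by (rule ng[OF R])
  then show ?thesis using S(1) unfolding normal_inv_iff R_def by blast
qed

lemma nat_power_of_prime_if:
  fixes n p :: nat
  assumes "prime p" "n > 0" "\<And>q. prime q \<Longrightarrow> q dvd n \<Longrightarrow> q = p"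
  shows "\<exists>k. n = p ^ k"
proof -
  obtain m where m: "n = p ^ multiplicity p n * m" "\<not> p dvd m"
    using assms multiplicity_decompose' [of n p] by (metis not_gr_zero not_prime_unit)
  have "m = 1"
  proof (rule ccontr)
    assume "m \<noteq> 1"
    then obtain q where "prime q" "q dvd m" using prime_factor_nat by blast
    then show False using assms(3)[of q] m by (metis dvd_mult)
  qed
  then show ?thesis using m by auto
qed

text \<open>A maximal normal subgroup of order prime to \<open>p\<close> inside \<open>N\<close> absorbs all Sylow subgroups of \<open>N\<close>
  for the primes other than \<open>p\<close>.\<close>

lemma nongenerating_p_complement:
  assumes fin: "finite (carrier G)" and N: "N \<lhd> G" and p: "prime p"
    and ng: "\<And>X. subgroup X G \<Longrightarrow> X <#> N = carrier G \<Longrightarrow> X = carrier G"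
  shows "\<exists>Q n. Q \<lhd> G \<and> Q \<subseteq> N \<and> \<not> p dvd card Q \<and> card N = card Q * p ^ n"
proof -
  have Nsub: "subgroup N G" using N normal_imp_subgroup by blast
  have finN: "finite N" using Nsub fin sgp_sub finite_subset by metis
  \<comment> \<open>The largest member will be the Hall subgroup of \<open>N\<close> for the primes
    other than \<open>p\<close>; maximality replaces forming the product of the corresponding Sylow
    subgroups.\<close>
  define QQ where "QQ = {Q. Q \<lhd> G \<and> Q \<subseteq> N \<and> \<not> p dvd card Q}"
  have "{\<one>} \<in> QQ" using one_is_normal p sgp_one[OF Nsub] by (auto simp: QQ_def)
  moreover have "\<forall>Q. Q \<in> QQ \<longrightarrow> card Q < Suc (card N)"
    using finN card_mono by (force simp: QQ_def less_Suc_eq_le)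
  ultimately obtain Q where Q: "Q \<in> QQ" "\<And>Q'. Q' \<in> QQ \<Longrightarrow> card Q' \<le> card Q"
    using ex_has_greatest_nat[of "\<lambda>Q. Q \<in> QQ" "{\<one>}" card] by blast
  have Qn: "Q \<lhd> G" "Q \<subseteq> N" "\<not> p dvd card Q" using Q by (auto simp: QQ_def)
  have Qsub: "subgroup Q G" using Qn normal_imp_subgroup by blast
  have finQ: "finite Q" using Qn finN finite_subset by blast
  have cN: "card N = rel_index N Q * card Q"
    using card_eq_rel_index[OF Nsub Qsub finN] Qn by (simp add: Int_absorb1)
  have cN0: "card N \<noteq> 0" using finN sgp_one[OF Nsub] by auto
  have "q = p" if q: "prime q" "q dvd rel_index N Q" for q
  proof (rule ccontr)
    assume "q \<noteq> p"
    obtain S where S: "subgroup S G" "S \<subseteq> N" "card S = q ^ multiplicity q (card N)"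
      using sylow_subgroup[OF Nsub finN q(1)] by blast
    have Sn: "S \<lhd> G" by (rule frattini_sylow_normal[OF fin N q(1) ng S])
    have SQ: "subgroup (S <#> Q) G" "S \<subseteq> S <#> Q" "Q \<subseteq> S <#> Q"
      using normal_subgroup_set_mult[OF Sn Qsub] by auto
    have SQN: "S <#> Q \<subseteq> N" using S(2) Qn(2) sgp_mult[OF Nsub] unfolding set_mult_def by blast
    have finSQ: "finite (S <#> Q)" using SQN finN finite_subset by blast
    have "card (S <#> Q) = rel_index (S <#> Q) S * card S"
      using card_eq_rel_index[OF SQ(1) S(1) finSQ] SQ by (simp add: Int_absorb1)
    \<comment> \<open>Hence \<open>card (S <#> Q)\<close> divides \<open>card Q * card S\<close>,
      and \<open>S <#> Q\<close> is again a member of \<open>QQ\<close>.\<close>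
    moreover have "rel_index (S <#> Q) S = rel_index Q S"
    proof (rule rel_index_same_cosets)
      fix x assume "x \<in> S <#> Q"
      then obtain s y where sy: "s \<in> S" "y \<in> Q" "x = s \<otimes> y" by (auto simp: set_mult_def)
      then have "x \<in> S #> y" by (auto simp: r_coset_def)
      then have "S #> x = S #> y"
        using rcos_eq_mem_iff[OF S(1)] sgp_mem[OF S(1) sy(1)] sgp_mem[OF Qsub sy(2)] by (simp add: sy)
      then show "\<exists>y\<in>Q. S #> x = S #> y" using sy by blast
    qed (use SQ in auto)
    moreover have "card Q = rel_index Q S * card (Q \<inter> S)" by (rule card_eq_rel_index[OF Qsub S(1) finQ])
    moreover have "\<not> p dvd card S" using S(3) q p \<open>q \<noteq> p\<close> by (metis prime_dvd_power primes_dvd_imp_eq)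
    ultimately have "\<not> p dvd card (S <#> Q)"
      using Qn(3) p by (metis dvd_mult2 prime_dvd_mult_iff)
    moreover have "S <#> Q \<lhd> G"
      using Sn Qn SQ(1) unfolding normal_inv_iff
    proof (intro conjI ballI)
      fix x h assume x: "x \<in> carrier G" "h \<in> S <#> Q"
      then obtain s y where sy: "s \<in> S" "y \<in> Q" "h = s \<otimes> y" by (auto simp: set_mult_def)
      have c: "s \<in> carrier G" "y \<in> carrier G" using sy S(1) Qsub sgp_mem by metis+
      have "x \<otimes> h \<otimes> inv x = (x \<otimes> s \<otimes> inv x) \<otimes> (x \<otimes> y \<otimes> inv x)"
        using sy c x by (simp add: grp_simps)
      then show "x \<otimes> h \<otimes> inv x \<in> S <#> Q"
        using normal.inv_op_closed2[OF Sn x(1) sy(1)] normal.inv_op_closed2[OF Qn(1) x(1) sy(2)]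
        by (auto simp: set_mult_def)
    qed auto
    ultimately have "S <#> Q \<in> QQ" using SQN by (simp add: QQ_def)
    then have "S <#> Q = Q" using Q(2) SQ(3) finSQ card_seteq by metis
    \<comment> \<open>Now the full \<open>q\<close>-part of \<open>card N\<close> divides
      \<open>card Q\<close>, leaving no factor \<open>q\<close> for the index of
      \<open>Q\<close>.\<close>
    then have "S \<subseteq> Q" using SQ by simp
    then have "card Q = rel_index Q S * card S"
      using card_eq_rel_index[OF Qsub S(1) finQ] by (simp add: Int_absorb1)
    then have "card S dvd card Q" by simp
    then have "q * card S dvd rel_index N Q * card Q" using q(2) by (rule mult_dvd_mono[rotated])
    then have "q ^ Suc (multiplicity q (card N)) dvd card N"
      unfolding S(3) cN[symmetric] by simp
    then show False using cN0 q
      by (metis multiplicity_geI not_less_eq_eq not_prime_unit order_refl)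
  qed
  moreover have "rel_index N Q > 0" using cN cN0 by (metis mult_is_0 not_gr_zero)
  ultimately obtain k where "rel_index N Q = p ^ k" using nat_power_of_prime_if[OF p] by blast
  then show ?thesis using Qn cN by (metis mult.commute)
qed

end

section \<open>Normalizers and powers modulo a subgroup\<close>

context group
begin

lemma set_mult_least: "subgroup H G \<Longrightarrow> A \<subseteq> H \<Longrightarrow> B \<subseteq> H \<Longrightarrow> A <#> B \<subseteq> H"
  using sgp_mult unfolding set_mult_def by blast

text \<open>Both directions of conjugation are required, since in an infinite group one inclusion
  between \<open>K\<close> and a conjugate does not imply equality.\<close>

definition normalizing :: "'a set \<Rightarrow> 'a set" where
  "normalizing K = {x \<in> carrier G. \<forall>k\<in>K. x \<otimes> k \<otimes> inv x \<in> K \<and> inv x \<otimes> k \<otimes> x \<in> K}"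

lemma normalizing_carrier: "normalizing K \<subseteq> carrier G" by (auto simp: normalizing_def)

lemma normalizingD: "x \<in> normalizing K \<Longrightarrow> k \<in> K \<Longrightarrow> x \<otimes> k \<otimes> inv x \<in> K" by (auto simp: normalizing_def)

lemma subset_normalizingI:
  assumes "subgroup F G" "\<And>x k. x \<in> F \<Longrightarrow> k \<in> K \<Longrightarrow> x \<otimes> k \<otimes> inv x \<in> K"
  shows "F \<subseteq> normalizing K"
proof
  fix x assume x: "x \<in> F"
  then have "inv x \<otimes> k \<otimes> x \<in> K" if "k \<in> K" for k
    using assms(2)[of "inv x" k] that sgp_inv[OF assms(1) x] sgp_mem[OF assms(1) x] by simp
  then show "x \<in> normalizing K" using assms(2) x sgp_mem[OF assms(1)] unfolding normalizing_def by blast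
qed

lemma normalizing_subgroup:
  assumes K: "subgroup K G"
  shows "subgroup (normalizing K) G"
proof (rule subgroupI)
  have Kc: "K \<subseteq> carrier G" using K sgp_sub by blast
  have "\<one> \<in> normalizing K" using Kc by (auto simp: normalizing_def)
  then show "normalizing K \<noteq> {}" by blast
  show "inv x \<in> normalizing K" if "x \<in> normalizing K" for x using that by (auto simp: normalizing_def)
  show "x \<otimes> y \<in> normalizing K" if xy: "x \<in> normalizing K" "y \<in> normalizing K" for x y
  proof -
    have c: "x \<in> carrier G" "y \<in> carrier G" using xy normalizing_carrier by auto
    have "(x \<otimes> y) \<otimes> k \<otimes> inv (x \<otimes> y) \<in> K \<and> inv (x \<otimes> y) \<otimes> k \<otimes> (x \<otimes> y) \<in> K" if k: "k \<in> K" for k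
    proof -
      have kc: "k \<in> carrier G" using k Kc by blast
      have "x \<otimes> (y \<otimes> k \<otimes> inv y) \<otimes> inv x \<in> K" "inv y \<otimes> (inv x \<otimes> k \<otimes> x) \<otimes> y \<in> K"
        using xy k by (auto simp: normalizing_def)
      moreover have "x \<otimes> (y \<otimes> k \<otimes> inv y) \<otimes> inv x = (x \<otimes> y) \<otimes> k \<otimes> inv (x \<otimes> y)"
        "inv y \<otimes> (inv x \<otimes> k \<otimes> x) \<otimes> y = inv (x \<otimes> y) \<otimes> k \<otimes> (x \<otimes> y)"
        using c kc by (simp_all add: grp_simps)
      ultimately show ?thesis by simp
    qed
    then show ?thesis using c by (auto simp: normalizing_def)
  qed
qed (rule normalizing_carrier)

lemma subset_normalizing_self: "subgroup K G \<Longrightarrow> K \<subseteq> normalizing K"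
  by (rule subset_normalizingI) (simp_all add: sgp_mult sgp_inv)

lemma normal_normalizing: "M \<lhd> G \<Longrightarrow> normalizing M = carrier G"
  using subset_normalizingI[of "carrier G" M] normal.inv_op_closed2[of M G] normalizing_carrier subgroup_self by blast

lemma normalizing_Int:
  assumes "x \<in> normalizing A" "x \<in> normalizing B" shows "x \<in> normalizing (A \<inter> B)"
  using assms by (auto simp: normalizing_def)

lemma normalizing_set_mult:
  assumes A: "subgroup A G" and B: "subgroup B G"
  shows "normalizing A \<inter> normalizing B \<subseteq> normalizing (A <#> B)"
proof (rule subset_normalizingI)
  show "subgroup (normalizing A \<inter> normalizing B) G" using subgroups_Inter_pair normalizing_subgroup A B by blast
  fix x k assume x: "x \<in> normalizing A \<inter> normalizing B" and k: "k \<in> A <#> B"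
  then obtain a b where ab: "a \<in> A" "b \<in> B" "k = a \<otimes> b" by (auto simp: set_mult_def)
  have c: "x \<in> carrier G" "a \<in> carrier G" "b \<in> carrier G" using x ab A B sgp_mem normalizing_carrier by blast+
  have "x \<otimes> k \<otimes> inv x = (x \<otimes> a \<otimes> inv x) \<otimes> (x \<otimes> b \<otimes> inv x)" using ab c by (simp add: grp_simps)
  then show "x \<otimes> k \<otimes> inv x \<in> A <#> B" using normalizingD x ab unfolding set_mult_def by blast
qed

lemma normalizing_set_mult_subgroup:
  assumes "subgroup K G" "subgroup A G" "A \<subseteq> normalizing K"
  shows "subgroup (K <#> A) G" "K <#> A = A <#> K" "K \<subseteq> K <#> A" "A \<subseteq> K <#> A"
  by (rule subgroup_set_mult[OF assms(1,2)], use assms(3) normalizingD in blast)+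

text \<open>A left factor from \<open>K\<close> is absorbed by the cosets of \<open>H\<close>, so
  \<open>A\<close> and \<open>B\<close> meet the same ones. This moves the index of \<open>H\<close>
  from a product \<open>K <#> A\<close> to \<open>A\<close>.\<close>

lemma rel_index_set_mult_left:
  assumes H: "subgroup H G" and A: "A \<subseteq> carrier G" and "K \<subseteq> H" "A \<subseteq> B" "B \<subseteq> K <#> A"
  shows "rel_index B H = rel_index A H"
proof (rule rel_index_same_cosets)
  fix x assume "x \<in> B"
  then obtain k a where ka: "k \<in> K" "a \<in> A" "x = k \<otimes> a" using assms(5) by (auto simp: set_mult_def)
  have c: "k \<in> carrier G" "a \<in> carrier G" using ka assms sgp_mem by blast+
  have "H #> x = H #> a" using rcos_eq_iff[OF H, of x a] ka c assms by (auto simp: grp_simps)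
  then show "\<exists>y\<in>A. H #> x = H #> y" using ka by blast
qed fact

text \<open>\<open>rel_index A H\<close> is the index of \<open>H\<close> in \<open>H <#> A\<close>,
  a subgroup because \<open>F\<close> normalizes \<open>H\<close>; the tower through it gives the
  divisibility. Without normality this fails already in the symmetric group on three
  letters.\<close>

lemma rel_index_dvd_normal:
  assumes A: "subgroup A G" and F: "subgroup F G" and H: "subgroup H G" and "A \<subseteq> F" "F \<subseteq> normalizing H"
    and fin: "finite ((\<lambda>x. H #> x) ` F)"
  shows "rel_index A H dvd rel_index F H"
proof -
  have HA: "subgroup (H <#> A) G" "H \<subseteq> H <#> A" "A \<subseteq> H <#> A"
    using normalizing_set_mult_subgroup[OF H A] assms by blast+
  have "rel_index F H = rel_index F (H <#> A) * rel_index (F \<inter> (H <#> A)) H"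
    by (rule rel_index_tower) (use F H HA fin in auto)
  moreover have "rel_index (F \<inter> (H <#> A)) H = rel_index A H"
    by (rule rel_index_set_mult_left[where K = H]) (use assms HA sgp_sub in auto)
  ultimately show ?thesis by simp
qed

lemma rel_index_tower':
  assumes F: "subgroup F G" and H: "subgroup H G" and H': "subgroup H' G" and "H' \<subseteq> H" "H \<subseteq> F"
    and fin: "finite ((\<lambda>x. H' #> x) ` F)"
  shows "rel_index F H' = rel_index F H * rel_index H H'"
  using rel_index_tower[of F H H'] assms by (simp add: Int_absorb1)

lemma int_pow_range_subgroup:
  assumes "g \<in> carrier G" shows "subgroup (range (\<lambda>i::int. g [^] i)) G"
proof (rule subgroupI)
  show "inv x \<in> range (\<lambda>i::int. g [^] i)" if "x \<in> range (\<lambda>i::int. g [^] i)" for x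
    using that assms by (auto simp flip: int_pow_neg)
  show "x \<otimes> y \<in> range (\<lambda>i::int. g [^] i)" if "x \<in> range (\<lambda>i::int. g [^] i)" "y \<in> range (\<lambda>i::int. g [^] i)" for x y
    using that assms by (auto simp flip: int_pow_mult)
qed (use assms in auto)

lemma int_pow_in_subgroup: "subgroup H G \<Longrightarrow> g \<in> H \<Longrightarrow> g [^] (i::int) \<in> H"
  using subgroup_int_pow_closed by blast

text \<open>The exponents \<open>i\<close> with \<open>g [^] i \<in> H\<close> form a subgroup of
  the integers. It is nontrivial because two powers share one of the finitely many cosets, and its
  positive generator \<open>c\<close> counts the cosets met by the powers of
  \<open>g\<close>.\<close>

lemma int_pow_mem_iff_card_cosets:
  assumes H: "subgroup H G" and g: "g \<in> carrier G"
    and fin: "finite (range (\<lambda>i::int. H #> g [^] i))"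
  shows "g [^] (i::int) \<in> H \<longleftrightarrow> int (card (range (\<lambda>i::int. H #> g [^] i))) dvd i"
proof -
  have eq: "H #> g [^] i = H #> g [^] j \<longleftrightarrow> g [^] (i - j) \<in> H" for i j :: int
    using rcos_eq_iff[OF H] g by (simp add: int_pow_diff)
  have "\<not> inj (\<lambda>i::int. H #> g [^] i)" using fin finite_imageD infinite_UNIV_int by blast
  then obtain i j :: int where ij: "i \<noteq> j" "g [^] (i - j) \<in> H" using eq by (auto simp: inj_def)
  have "g [^] (j - i) \<in> H"
    using sgp_inv[OF H ij(2)] g by (simp flip: int_pow_neg)
  then have ex: "\<exists>c::nat. c > 0 \<and> g [^] (int c) \<in> H"
    using ij by (intro exI[of _ "nat \<bar>i - j\<bar>"]) (auto simp: abs_if)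
  define c where "c = (LEAST c::nat. c > 0 \<and> g [^] (int c) \<in> H)"
  have c: "c > 0" "g [^] (int c) \<in> H" using LeastI_ex[OF ex] unfolding c_def by auto
  have cmin: "\<not> g [^] (int d) \<in> H" if "0 < d" "d < c" for d
    using not_less_Least[of d "\<lambda>c. c > 0 \<and> g [^] (int c) \<in> H"] that unfolding c_def by auto
  have mod: "g [^] i \<in> H \<longleftrightarrow> g [^] (i mod int c) \<in> H" for i :: int
  proof -
    have "g [^] (int c * (i div int c)) \<in> H"
      using int_pow_in_subgroup[OF H c(2), of "i div int c"] g by (simp add: int_pow_pow)
    moreover have "i mod int c = i - int c * (i div int c)" by (simp add: minus_mult_div_eq_mod)
    ultimately have "H #> g [^] (i mod int c) = H #> g [^] i"
      unfolding eq using sgp_inv[OF H] g by (fastforce simp flip: int_pow_neg)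
    then show ?thesis using eq[of i 0] eq[of "i mod int c" 0] by simp
  qed
  have dvd: "g [^] i \<in> H \<longleftrightarrow> int c dvd i" for i :: int
  proof
    assume "g [^] i \<in> H"
    then have "g [^] (int (nat (i mod int c))) \<in> H" using mod[of i] c by simp
    moreover have "nat (i mod int c) < c" using c by (simp add: nat_less_iff)
    ultimately have "nat (i mod int c) = 0" using cmin by blast
    then have "i mod int c = 0" using c pos_mod_sign[of "int c" i] by linarith
    then show "int c dvd i" by (simp add: mod_eq_0_iff_dvd)
  next
    assume "int c dvd i"
    then show "g [^] i \<in> H" using mod[of i] sgp_one[OF H] by simp
  qed
  have "range (\<lambda>i::int. H #> g [^] i) = (\<lambda>i. H #> g [^] i) ` {0..<int c}"
  proof
    show "range (\<lambda>i::int. H #> g [^] i) \<subseteq> (\<lambda>i. H #> g [^] i) ` {0..<int c}"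
    proof
      fix C assume "C \<in> range (\<lambda>i::int. H #> g [^] i)"
      then obtain i :: int where i: "C = H #> g [^] i" by blast
      have "C = H #> g [^] (i mod int c)" unfolding i eq dvd by (simp add: dvd_minus_mod)
      then show "C \<in> (\<lambda>i. H #> g [^] i) ` {0..<int c}" using c by auto
    qed
  qed auto
  moreover have "inj_on (\<lambda>i. H #> g [^] i) {0..<int c}"
  proof (rule inj_onI)
    fix i j assume ij: "i \<in> {0..<int c}" "j \<in> {0..<int c}" "H #> g [^] i = H #> g [^] j"
    then have "int c dvd i - j" by (simp only: eq dvd)
    then have "i mod int c = j mod int c" by (simp add: mod_eq_dvd_iff)
    then show "i = j" using ij(1,2) by simp
  qed
  ultimately have "card (range (\<lambda>i::int. H #> g [^] i)) = c" by (simp add: card_image)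
  then show ?thesis using dvd by simp
qed

end

section \<open>Open and closed subgroups for a base of normal subgroups\<close>

text \<open>An algebraic model of the profinite topology in which no open set occurs:
  \<open>NN\<close> stands for the open normal subgroups, a base at the identity.\<close>

locale normal_base = group G for G (structure) +
  fixes NN :: "'a set set"
  assumes NN_nonempty: "NN \<noteq> {}"
    and NN_normal: "M \<in> NN \<Longrightarrow> M \<lhd> G"
    and NN_finite_index: "M \<in> NN \<Longrightarrow> finite (rcosets M)"
    and NN_Int: "M \<in> NN \<Longrightarrow> N \<in> NN \<Longrightarrow> M \<inter> N \<in> NN"
begin

definition open_sgp :: "'a set \<Rightarrow> bool" where
  "open_sgp H \<longleftrightarrow> subgroup H G \<and> (\<exists>M\<in>NN. M \<subseteq> H)"

text \<open>The intersection of the open subgroups \<open>H <#> M\<close> is the closure of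
  \<open>H\<close>; the condition says that it adds nothing.\<close>

definition closed_sgps :: "'a set set" where
  "closed_sgps = {H. subgroup H G \<and> (\<forall>x\<in>carrier G. (\<forall>M\<in>NN. x \<in> H <#> M) \<longrightarrow> x \<in> H)}"

definition closed_gen :: "'a set \<Rightarrow> 'a set" where
  "closed_gen X = \<Inter>{H \<in> closed_sgps. X \<subseteq> H}"

lemma NN_subgroup: "M \<in> NN \<Longrightarrow> subgroup M G"
  using NN_normal normal_imp_subgroup by blast

lemma NN_carrier: "M \<in> NN \<Longrightarrow> M \<subseteq> carrier G"
  using NN_subgroup sgp_sub by blast

lemma NN_open_sgp: "M \<in> NN \<Longrightarrow> open_sgp M"
  using NN_subgroup by (auto simp: open_sgp_def)

lemma NN_conj: "M \<in> NN \<Longrightarrow> x \<in> carrier G \<Longrightarrow> m \<in> M \<Longrightarrow> x \<otimes> m \<otimes> inv x \<in> M"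
  using NN_normal normal.inv_op_closed2 by metis

lemma NN_normalizing: "M \<in> NN \<Longrightarrow> normalizing M = carrier G"
  using NN_normal normal_normalizing by blast

lemma open_sgp_subgroup: "open_sgp H \<Longrightarrow> subgroup H G" by (simp add: open_sgp_def)

lemma open_sgp_mono: "open_sgp H \<Longrightarrow> H \<subseteq> H' \<Longrightarrow> subgroup H' G \<Longrightarrow> open_sgp H'"
  by (meson open_sgp_def order_trans)

lemma open_sgp_Int: "open_sgp H \<Longrightarrow> open_sgp H' \<Longrightarrow> open_sgp (H \<inter> H')"
proof -
  assume H: "open_sgp H" "open_sgp H'"
  then obtain M N where "M \<in> NN" "M \<subseteq> H" "N \<in> NN" "N \<subseteq> H'" by (auto simp: open_sgp_def)
  then have "M \<inter> N \<in> NN" "M \<inter> N \<subseteq> H \<inter> H'" using NN_Int by auto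
  then show ?thesis using H subgroups_Inter_pair by (auto simp: open_sgp_def)
qed

lemma open_sgp_carrier: "open_sgp (carrier G)"
  using NN_nonempty NN_carrier subgroup_self by (auto simp: open_sgp_def)

lemma open_sgp_finite:
  assumes "open_sgp H" "F \<subseteq> carrier G"
  shows "finite ((\<lambda>x. H #> x) ` F)"
proof -
  obtain M where M: "M \<in> NN" "M \<subseteq> H" using assms by (auto simp: open_sgp_def)
  have "(\<lambda>x. M #> x) ` F \<subseteq> rcosets M" using assms(2) by (auto simp: RCOSETS_def)
  then have "finite ((\<lambda>x. M #> x) ` F)" using NN_finite_index[OF M(1)] finite_subset by blast
  then show ?thesis
    using finite_cosets_mono[of H M F] assms open_sgp_subgroup NN_subgroup M by blast
qed

lemma open_sgp_finite': "open_sgp H \<Longrightarrow> subgroup F G \<Longrightarrow> finite ((\<lambda>x. H #> x) ` F)"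
  using open_sgp_finite sgp_sub by blast

lemma rel_index_open_sgp_pos: "open_sgp H \<Longrightarrow> subgroup F G \<Longrightarrow> rel_index F H > 0"
  using rel_index_pos open_sgp_finite' sgp_one by blast

lemma mult_NN:
  assumes H: "subgroup H G" and M: "M \<in> NN"
  shows "open_sgp (H <#> M)" "subgroup (H <#> M) G" "H \<subseteq> H <#> M" "M \<subseteq> H <#> M" "H <#> M = M <#> H"
proof -
  show "H <#> M = M <#> H" "subgroup (H <#> M) G" "H \<subseteq> H <#> M" "M \<subseteq> H <#> M"
    using normal_subgroup_set_mult[OF NN_normal[OF M] H] by auto
  then show "open_sgp (H <#> M)" using M by (auto simp: open_sgp_def)
qed

lemma mult_NN_mono:
  assumes "M \<subseteq> M'" "H \<subseteq> H'" shows "H <#> M \<subseteq> H' <#> M'"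
  using assms unfolding set_mult_def by blast

lemma eq_mult_NN_iff:
  assumes "subgroup L G" "subgroup K G" "M \<in> NN"
  shows "L <#> M = K <#> M \<longleftrightarrow> L \<subseteq> K <#> M \<and> K \<subseteq> L <#> M"
proof
  assume "L <#> M = K <#> M"
  then show "L \<subseteq> K <#> M \<and> K \<subseteq> L <#> M" using mult_NN assms by metis
next
  assume a: "L \<subseteq> K <#> M \<and> K \<subseteq> L <#> M"
  have "L <#> M \<subseteq> K <#> M" by (rule set_mult_least) (use a mult_NN assms in auto)
  moreover have "K <#> M \<subseteq> L <#> M" by (rule set_mult_least) (use a mult_NN assms in auto)
  ultimately show "L <#> M = K <#> M" by blast
qed

lemma eq_mult_NN_mono:
  assumes "subgroup L G" "subgroup K G" "M \<in> NN" "M' \<in> NN" "M \<subseteq> M'" "L <#> M = K <#> M"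
  shows "L <#> M' = K <#> M'"
  using assms mult_NN_mono[OF assms(5) order_refl] by (simp add: eq_mult_NN_iff) blast

lemma mult_NN_absorb:
  assumes "subgroup H G" "M \<in> NN" "M \<subseteq> H" shows "H <#> M = H"
  using set_mult_least[OF assms(1) order_refl assms(3)] mult_NN[OF assms(1,2)] by blast

lemma closed_sgps_subgroup: "H \<in> closed_sgps \<Longrightarrow> subgroup H G" by (simp add: closed_sgps_def)

lemma closed_sgpsI:
  assumes "subgroup H G" "\<And>x. x \<in> carrier G \<Longrightarrow> (\<And>M. M \<in> NN \<Longrightarrow> x \<in> H <#> M) \<Longrightarrow> x \<in> H"
  shows "H \<in> closed_sgps"
  using assms by (simp add: closed_sgps_def)

lemma closed_sgpsD: "H \<in> closed_sgps \<Longrightarrow> x \<in> carrier G \<Longrightarrow> (\<And>M. M \<in> NN \<Longrightarrow> x \<in> H <#> M) \<Longrightarrow> x \<in> H"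
  by (simp add: closed_sgps_def)

lemma open_sgp_closed_sgps: "open_sgp H \<Longrightarrow> H \<in> closed_sgps"
proof (rule closed_sgpsI)
  assume H: "open_sgp H"
  then show "subgroup H G" by (rule open_sgp_subgroup)
  obtain M where "M \<in> NN" "M \<subseteq> H" using H by (auto simp: open_sgp_def)
  then show "x \<in> H" if "\<And>M. M \<in> NN \<Longrightarrow> x \<in> H <#> M" for x
    using that[of M] mult_NN_absorb[OF open_sgp_subgroup[OF H]] by simp
qed

lemma closed_sgps_Inter:
  assumes "\<H> \<subseteq> closed_sgps" "\<H> \<noteq> {}" shows "\<Inter>\<H> \<in> closed_sgps"
proof (rule closed_sgpsI)
  show "subgroup (\<Inter>\<H>) G" using assms closed_sgps_subgroup subgroups_Inter by blast
  fix x assume x: "x \<in> carrier G" "\<And>M. M \<in> NN \<Longrightarrow> x \<in> \<Inter>\<H> <#> M"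
  show "x \<in> \<Inter>\<H>"
  proof
    fix H assume H: "H \<in> \<H>"
    have "x \<in> H <#> M" if "M \<in> NN" for M
      using x(2)[OF that] mult_NN_mono[of M M "\<Inter>\<H>" H] H by blast
    then show "x \<in> H" using closed_sgpsD H assms x by blast
  qed
qed

lemma closed_sgps_Int: "A \<in> closed_sgps \<Longrightarrow> B \<in> closed_sgps \<Longrightarrow> A \<inter> B \<in> closed_sgps"
  using closed_sgps_Inter[of "{A, B}"] by simp

lemma closed_gen_closed_sgps: "X \<subseteq> carrier G \<Longrightarrow> closed_gen X \<in> closed_sgps"
  unfolding closed_gen_def using open_sgp_closed_sgps[OF open_sgp_carrier] by (intro closed_sgps_Inter) auto

lemma closed_gen_subset: "X \<subseteq> closed_gen X" by (auto simp: closed_gen_def)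

lemma closed_gen_least: "H \<in> closed_sgps \<Longrightarrow> X \<subseteq> H \<Longrightarrow> closed_gen X \<subseteq> H" by (auto simp: closed_gen_def)

text \<open>\<open>F / K\<close> is procyclic, with the image of \<open>g\<close> as a topological generator, up to closedness of
  \<open>K\<close> and \<open>F\<close>.\<close>

definition procyclic_over :: "'a set \<Rightarrow> 'a set \<Rightarrow> 'a \<Rightarrow> bool" where
  "procyclic_over K F g \<longleftrightarrow> subgroup K G \<and> subgroup F G \<and> K \<subseteq> F \<and> g \<in> F \<and> F \<subseteq> normalizing K \<and>
     (\<forall>M\<in>NN. \<forall>x\<in>F. \<exists>i::int. \<exists>c\<in>K <#> M. x = c \<otimes> g [^] i)"

text \<open>For each \<open>M\<close> the product of \<open>K <#> M\<close> with the powers of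
  \<open>g\<close> is an open, hence closed, subgroup containing the generators, so it contains the
  whole closure. Normality of \<open>K\<close> is obtained modulo every \<open>M\<close> and then
  from closedness.\<close>

lemma procyclic_over_closed_gen:
  assumes K: "K \<in> closed_sgps" and g: "g \<in> normalizing K"
  shows "procyclic_over K (closed_gen (insert g K)) g"
proof -
  let ?F = "closed_gen (insert g K)"
  have Ks: "subgroup K G" using K closed_sgps_subgroup by blast
  have gc: "g \<in> carrier G" using g normalizing_carrier by blast
  have Kc: "K \<subseteq> carrier G" using Ks sgp_sub by blast
  have F: "?F \<in> closed_sgps" by (rule closed_gen_closed_sgps) (use Kc gc in auto)
  then have Fs: "subgroup ?F G" by (rule closed_sgps_subgroup)
  let ?P = "range (\<lambda>i::int. g [^] i)"
  have P: "subgroup ?P G" by (rule int_pow_range_subgroup[OF gc])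
  have PK: "?P \<subseteq> normalizing K" using int_pow_in_subgroup[OF normalizing_subgroup[OF Ks] g] by auto
  have dense: "\<exists>i::int. \<exists>c\<in>K <#> M. x = c \<otimes> g [^] i" if M: "M \<in> NN" and x: "x \<in> ?F" for M x
  proof -
    note KM = mult_NN[OF Ks M]
    have "?P \<subseteq> normalizing (K <#> M)"
      using normalizing_set_mult[OF Ks NN_subgroup[OF M]] PK NN_normalizing[OF M] normalizing_carrier by blast
    note Y = normalizing_set_mult_subgroup[OF KM(2) P this]
    have "open_sgp ((K <#> M) <#> ?P)" using open_sgp_mono[OF KM(1)] Y by blast
    moreover have "insert g K \<subseteq> (K <#> M) <#> ?P"
    proof -
      have "g = g [^] (1::int)" using gc by simp
      then have "g \<in> ?P" by (rule range_eqI)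
      then show ?thesis using KM Y by blast
    qed
    ultimately have "x \<in> (K <#> M) <#> ?P" using x closed_gen_least open_sgp_closed_sgps by blast
    then show ?thesis unfolding set_mult_def by blast
  qed
  have "x \<otimes> k \<otimes> inv x \<in> K" if x: "x \<in> ?F" and k: "k \<in> K" for x k
  proof (rule closed_sgpsD[OF K])
    have xc: "x \<in> carrier G" using x Fs sgp_mem by blast
    have kc: "k \<in> carrier G" using k Kc by blast
    show "x \<otimes> k \<otimes> inv x \<in> carrier G" using xc kc by simp
    fix M assume M: "M \<in> NN"
    note KM = mult_NN[OF Ks M]
    obtain i :: int and c where ic: "c \<in> K <#> M" "x = c \<otimes> g [^] i" using dense[OF M x] by blast
    have cc: "c \<in> carrier G" using ic KM sgp_mem by blast
    have "g [^] i \<otimes> k \<otimes> inv (g [^] i) \<in> K" using PK k normalizingD by blast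
    then have "c \<otimes> (g [^] i \<otimes> k \<otimes> inv (g [^] i)) \<otimes> inv c \<in> K <#> M"
      using ic KM by (meson sgp_inv sgp_mult subsetD)
    moreover have "x \<otimes> k \<otimes> inv x = c \<otimes> (g [^] i \<otimes> k \<otimes> inv (g [^] i)) \<otimes> inv c"
      using ic cc kc gc by (simp add: grp_simps)
    ultimately show "x \<otimes> k \<otimes> inv x \<in> K <#> M" by simp
  qed
  then have "?F \<subseteq> normalizing K" by (rule subset_normalizingI[OF Fs])
  then show ?thesis unfolding procyclic_over_def using Ks Fs closed_gen_subset[of "insert g K"] dense by blast
qed

text \<open>\<open>H\<close> contains some \<open>K <#> M\<close>, so the powers of \<open>g\<close>
  meet all cosets of \<open>H\<close> that \<open>F\<close> meets, and the index is the order of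
  \<open>g\<close> modulo \<open>H\<close>. Membership in open subgroups over \<open>K\<close>
  thereby becomes divisibility of integers.\<close>

lemma procyclic_over_index:
  assumes F: "procyclic_over K F g" and H: "open_sgp H" "K \<subseteq> H"
  shows "g [^] (i::int) \<in> H \<longleftrightarrow> int (rel_index F H) dvd i"
proof -
  have Fs: "subgroup F G" "g \<in> F" "subgroup K G" using F by (auto simp: procyclic_over_def)
  have gc: "g \<in> carrier G" using Fs sgp_mem by blast
  have Hs: "subgroup H G" using H open_sgp_subgroup by blast
  obtain M where M: "M \<in> NN" "M \<subseteq> H" using H by (auto simp: open_sgp_def)
  have KM: "K <#> M \<subseteq> H" using set_mult_least[OF Hs H(2) M(2)] .
  have eq: "(\<lambda>x. H #> x) ` F = range (\<lambda>i::int. H #> g [^] i)"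
  proof
    show "range (\<lambda>i::int. H #> g [^] i) \<subseteq> (\<lambda>x. H #> x) ` F"
      using int_pow_in_subgroup[OF Fs(1,2)] by blast
    show "(\<lambda>x. H #> x) ` F \<subseteq> range (\<lambda>i::int. H #> g [^] i)"
    proof
      fix C assume "C \<in> (\<lambda>x. H #> x) ` F"
      then obtain x where x: "x \<in> F" "C = H #> x" by blast
      then obtain i :: int and c where ic: "c \<in> K <#> M" "x = c \<otimes> g [^] i"
        using F M unfolding procyclic_over_def by meson
      have c: "c \<in> H" "c \<in> carrier G" using ic KM Hs sgp_mem by blast+
      then have "H #> x = H #> g [^] i"
        using ic gc rcos_eq_iff[OF Hs, of x "g [^] i"] by (simp add: grp_simps)
      then show "C \<in> range (\<lambda>i::int. H #> g [^] i)" using x by blast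
    qed
  qed
  have "finite (range (\<lambda>i::int. H #> g [^] i))" using open_sgp_finite'[OF H(1) Fs(1)] eq by simp
  from int_pow_mem_iff_card_cosets[OF Hs gc this] show ?thesis by (simp add: rel_index_def eq)
qed

text \<open>\<open>p\<^sup>\<infinity>\<close> divides the index of the closure of \<open>A\<close> in \<open>F\<close>.\<close>

definition infinite_p_index :: "nat \<Rightarrow> 'a set \<Rightarrow> 'a set \<Rightarrow> bool" where
  "infinite_p_index p F A \<longleftrightarrow> (\<forall>n. \<exists>H. open_sgp H \<and> A \<subseteq> H \<and> p ^ n dvd rel_index F H)"

lemma rel_index_open_sgp_dvd:
  assumes "subgroup F G" "open_sgp H'" "H' \<subseteq> H" "subgroup H G"
  shows "rel_index F H dvd rel_index F H'"
  using rel_index_tower[OF assms(1,4) open_sgp_subgroup[OF assms(2)] assms(3) open_sgp_finite'[OF assms(2,1)]] by simp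

lemma open_sgp_shrink:
  assumes A: "subgroup A G" and H: "open_sgp H" "A \<subseteq> H" and M0: "M0 \<in> NN"
  obtains M where "M \<in> NN" "M \<subseteq> M0" "A <#> M \<subseteq> H"
proof -
  obtain M where M: "M \<in> NN" "M \<subseteq> H" using H by (auto simp: open_sgp_def)
  have "A <#> (M \<inter> M0) \<subseteq> H" by (rule set_mult_least[OF open_sgp_subgroup[OF H(1)] H(2)]) (use M in auto)
  then show ?thesis using that[of "M \<inter> M0"] NN_Int M M0 by blast
qed

text \<open>Shrinking an open subgroup multiplies its index, so the witness may be taken of the form
  \<open>A <#> M\<close> with \<open>M\<close> below a prescribed member.\<close>

lemma infinite_p_indexE:
  assumes "infinite_p_index p F A" "subgroup F G" "subgroup A G" "M0 \<in> NN"
  obtains M where "M \<in> NN" "M \<subseteq> M0" "p ^ n dvd rel_index F (A <#> M)"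
proof -
  obtain H where H: "open_sgp H" "A \<subseteq> H" "p ^ n dvd rel_index F H" using assms(1) by (auto simp: infinite_p_index_def)
  obtain M where M: "M \<in> NN" "M \<subseteq> M0" "A <#> M \<subseteq> H"
    using open_sgp_shrink[OF assms(3) H(1,2) assms(4)] .
  have "rel_index F H dvd rel_index F (A <#> M)"
    using rel_index_open_sgp_dvd[OF assms(2) mult_NN(1)[OF assms(3) M(1)] M(3) open_sgp_subgroup[OF H(1)]] .
  then show ?thesis using that M H(3) dvd_trans by blast
qed

text \<open>The \<open>p\<close>-part of a procyclic group is a quotient of the \<open>p\<close>-adic integers, where every nontrivial
  closed subgroup has finite index.\<close>

lemma procyclic_over_infinite_p_index:
  assumes F: "procyclic_over H F g" and A: "subgroup A G" "H \<subseteq> A" "A \<subseteq> F" and p: "prime p"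
    and inf: "infinite_p_index p F A" and U: "open_sgp U" "H \<subseteq> U"
  shows "\<not> p dvd rel_index A U"
proof
  assume pU: "p dvd rel_index A U"
  have Fs: "subgroup F G" "g \<in> F" "subgroup H G" "F \<subseteq> normalizing H" using F by (auto simp: procyclic_over_def)
  have gc: "g \<in> carrier G" using Fs sgp_mem by blast
  obtain M where M: "M \<in> NN" "H <#> M \<subseteq> U"
    using open_sgp_shrink[OF Fs(3) U] NN_nonempty by blast
  define O' where "O' = H <#> M"
  note O' = mult_NN[OF Fs(3) M(1), folded O'_def]
  have pO': "p dvd rel_index A O'"
    using rel_index_open_sgp_dvd[OF A(1) O'(1), of U] M open_sgp_subgroup[OF U(1)] pU dvd_trans unfolding O'_def by blast
  \<comment> \<open>\<open>t\<close> is the full exponent of \<open>p\<close> in the index of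
    \<open>O'\<close>; the contradiction will be that \<open>p ^ Suc t\<close> divides this index.
    \<open>M1\<close> is so small that \<open>p ^ t\<close> already divides the index of
    \<open>A <#> M1\<close>.\<close>
  define t where "t = multiplicity p (rel_index F O')"
  obtain M1 where M1: "M1 \<in> NN" "M1 \<subseteq> M" "p ^ t dvd rel_index F (A <#> M1)"
    using infinite_p_indexE[OF inf Fs(1) A(1) M(1)] .
  have FO': "F \<subseteq> normalizing O'"
    unfolding O'_def using normalizing_set_mult[OF Fs(3) NN_subgroup[OF M(1)]] Fs NN_normalizing[OF M(1)] sgp_sub by blast
  have AO': "A \<subseteq> normalizing O'" using FO' A by blast
  note OA = normalizing_set_mult_subgroup[OF O'(2) A(1) AO']
  have OAo: "open_sgp (O' <#> A)" using open_sgp_mono[OF O'(1)] OA by blast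
  have HOA: "H \<subseteq> O' <#> A" using O'(3) OA(3) by blast
  note A1 = mult_NN[OF A(1) M1(1)]
  \<comment> \<open>\<open>i0\<close> is the order of \<open>g\<close> modulo
    \<open>O' <#> A\<close>. Writing \<open>g [^] i0\<close> as an element of \<open>O'\<close>
    times a power \<open>g [^] j\<close> lying in \<open>A <#> M1\<close> shows that
    \<open>p ^ t\<close> divides \<open>j\<close> and \<open>i0 - j\<close>, hence
    \<open>i0\<close>.\<close>
  define i0 where "i0 = int (rel_index F (O' <#> A))"
  have "g [^] i0 \<in> O' <#> A" using procyclic_over_index[OF F OAo HOA] by (simp add: i0_def)
  then obtain b a where ba: "b \<in> O'" "a \<in> A" "g [^] i0 = b \<otimes> a" by (auto simp: set_mult_def)
  then obtain j :: int and c where jc: "c \<in> H <#> M1" "a = c \<otimes> g [^] j"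
    using F A(3) M1(1) unfolding procyclic_over_def by (meson subsetD)
  have cO': "c \<in> O'" using jc mult_NN_mono[OF M1(2) order_refl] unfolding O'_def by blast
  have cA: "c \<in> A <#> M1" using jc mult_NN_mono[OF order_refl A(2)] by blast
  have carr: "a \<in> carrier G" "b \<in> carrier G" "c \<in> carrier G"
    using ba cO' A O' sgp_mem by blast+
  have "g [^] j = inv c \<otimes> a" using jc carr gc by (simp add: grp_simps)
  then have "g [^] j \<in> A <#> M1" using A1 cA ba(2) by (metis sgp_inv sgp_mult subsetD)
  then have "int (rel_index F (A <#> M1)) dvd j"
    using procyclic_over_index[OF F A1(1)] A(2) A1(3) by blast
  then have pj: "int (p ^ t) dvd j" using M1(3) by (meson dvd_trans int_dvd_int_iff)
  have "g [^] i0 = (b \<otimes> c) \<otimes> g [^] j" using ba jc carr gc by (simp add: m_assoc)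
  then have "g [^] (i0 - j) = b \<otimes> c" using gc carr by (simp add: int_pow_diff grp_simps)
  then have "g [^] (i0 - j) \<in> O'" using ba cO' sgp_mult[OF O'(2)] by simp
  then have "int (rel_index F O') dvd i0 - j" using procyclic_over_index[OF F O'(1,3)] by blast
  moreover have "int (p ^ t) dvd int (rel_index F O')" unfolding t_def int_dvd_int_iff by (rule multiplicity_dvd)
  ultimately have "int (p ^ t) dvd i0 - j" using dvd_trans by blast
  then have "int (p ^ t) dvd i0" using pj by (metis dvd_diffD1 dvd_diff_commute diff_add_cancel dvd_add)
  then have 1: "p ^ t dvd rel_index F (O' <#> A)" unfolding i0_def int_dvd_int_iff .
  \<comment> \<open>The remaining factor of the index of \<open>O'\<close> is
    \<open>rel_index A O'\<close>, which contributes one more \<open>p\<close>.\<close>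
  have "rel_index F O' = rel_index F (O' <#> A) * rel_index (F \<inter> (O' <#> A)) O'"
    by (rule rel_index_tower) (use Fs OA O' open_sgp_finite' in auto)
  moreover have "rel_index (F \<inter> (O' <#> A)) O' = rel_index A O'"
    by (rule rel_index_set_mult_left[where K = O']) (use A OA O' sgp_sub in auto)
  ultimately have "p ^ t * p dvd rel_index F O'" using 1 pO' by (simp add: mult_dvd_mono)
  then have "p ^ Suc t dvd rel_index F O'" by (simp add: mult.commute)
  moreover have "rel_index F O' \<noteq> 0" using rel_index_open_sgp_pos[OF O'(1) Fs(1)] by simp
  ultimately have "Suc t \<le> t"
    unfolding t_def using p by (metis multiplicity_geI not_prime_unit)
  then show False by simp
qed

end

section \<open>Scattered neighbourhoods of closed subgroups\<close>

context normal_base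
begin

definition sgp_nbh :: "'a set \<Rightarrow> 'a set \<Rightarrow> 'a set set" where
  "sgp_nbh K N = {L \<in> closed_sgps. L <#> N = K <#> N}"

text \<open>\<^term>\<open>sgp_nbh K N\<close> is a scattered space: each of its nonempty subsets has an isolated point.\<close>

definition scattered_at :: "'a set \<Rightarrow> 'a set \<Rightarrow> bool" where
  "scattered_at K N \<longleftrightarrow> K \<in> closed_sgps \<and> N \<in> NN \<and> (\<forall>C\<subseteq>sgp_nbh K N. C \<noteq> {} \<longrightarrow>
     (\<exists>L\<in>C. \<exists>M\<in>NN. \<forall>L'\<in>C. L' <#> M = L <#> M \<longrightarrow> L' = L))"

lemma scattered_atD: "scattered_at K N \<Longrightarrow> K \<in> closed_sgps" "scattered_at K N \<Longrightarrow> N \<in> NN" "scattered_at K N \<Longrightarrow> subgroup K G"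
  by (auto simp: scattered_at_def closed_sgps_def)

lemma scattered_at_self: "scattered_at K N \<Longrightarrow> K \<in> sgp_nbh K N" by (simp add: sgp_nbh_def scattered_at_def)

lemma sgp_nbh_mono:
  assumes "K \<in> closed_sgps" "N \<in> NN" "N' \<in> NN" "N' \<subseteq> N"
  shows "sgp_nbh K N' \<subseteq> sgp_nbh K N"
  using assms eq_mult_NN_mono closed_sgps_subgroup unfolding sgp_nbh_def by blast

text \<open>Subspaces of scattered spaces are scattered, and a basic neighbourhood of
  \<open>L\<close> below \<open>N\<close> lies in the one of \<open>K\<close>. So whatever is proved
  for \<open>K\<close> applies to its neighbours.\<close>

lemma scattered_at_sgp_nbh:
  assumes "scattered_at K N" "L \<in> sgp_nbh K N" "N' \<in> NN" "N' \<subseteq> N"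
  shows "scattered_at L N'"
proof -
  have L: "L \<in> closed_sgps" "L <#> N = K <#> N" using assms(2) by (auto simp: sgp_nbh_def)
  have "sgp_nbh L N' \<subseteq> sgp_nbh L N" using sgp_nbh_mono L assms scattered_atD by blast
  also have "sgp_nbh L N = sgp_nbh K N" using L by (simp add: sgp_nbh_def)
  finally show ?thesis using assms L unfolding scattered_at_def by (meson order_trans)
qed

lemma scattered_at_mono: "scattered_at K N \<Longrightarrow> N' \<in> NN \<Longrightarrow> N' \<subseteq> N \<Longrightarrow> scattered_at K N'"
  using scattered_at_sgp_nbh scattered_at_self by blast

lemma sgp_nbh_memI:
  assumes "L \<in> closed_sgps" "K \<in> closed_sgps" "N \<in> NN" "L \<subseteq> K <#> N" "K \<subseteq> L <#> N"
  shows "L \<in> sgp_nbh K N"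
  using assms eq_mult_NN_iff[of L K N] closed_sgps_subgroup by (simp add: sgp_nbh_def)

lemma scattered_at_isolated:
  assumes "scattered_at K N" "C \<subseteq> sgp_nbh K N" "C \<noteq> {}" "M0 \<in> NN"
  obtains L M where "L \<in> C" "M \<in> NN" "M \<subseteq> M0" "\<And>L'. L' \<in> C \<Longrightarrow> L' <#> M = L <#> M \<Longrightarrow> L' = L"
proof -
  obtain L M where LM: "L \<in> C" "M \<in> NN" "\<And>L'. L' \<in> C \<Longrightarrow> L' <#> M = L <#> M \<Longrightarrow> L' = L"
    using assms unfolding scattered_at_def by meson
  have "L' = L" if "L' \<in> C" "L' <#> (M \<inter> M0) = L <#> (M \<inter> M0)" for L'
  proof -
    have "subgroup L' G" "subgroup L G" using that LM assms closed_sgps_subgroup unfolding sgp_nbh_def by blast+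
    then have "L' <#> M = L <#> M"
      using eq_mult_NN_mono[of L' L "M \<inter> M0" M] that NN_Int LM assms by blast
    then show ?thesis using LM that by blast
  qed
  then show ?thesis using that[of L "M \<inter> M0"] LM NN_Int assms by blast
qed

section \<open>Isolated members of families of closed subgroups near a scattered one\<close>

definition conj_sgp :: "'a \<Rightarrow> 'a set \<Rightarrow> 'a set" where
  "conj_sgp x K = {y \<in> carrier G. inv x \<otimes> y \<otimes> x \<in> K}"

lemma conj_sgp_closed_sgps:
  assumes K: "K \<in> closed_sgps" and x: "x \<in> carrier G"
  shows "conj_sgp x K \<in> closed_sgps"
proof (rule closed_sgpsI)
  have Ks: "subgroup K G" using K closed_sgps_subgroup by blast
  show sub: "subgroup (conj_sgp x K) G"
    using subgroup_conj_vimage[OF Ks, of "inv x"] x unfolding conj_sgp_def by simp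
  fix y assume y: "y \<in> carrier G" "\<And>M. M \<in> NN \<Longrightarrow> y \<in> conj_sgp x K <#> M"
  have "inv x \<otimes> y \<otimes> x \<in> K"
  proof (rule closed_sgpsD[OF K])
    fix M assume M: "M \<in> NN"
    obtain z m where zm: "z \<in> conj_sgp x K" "m \<in> M" "y = z \<otimes> m" using y(2)[OF M] by (auto simp: set_mult_def)
    have c: "z \<in> carrier G" "m \<in> carrier G" using zm NN_carrier[OF M] by (auto simp: conj_sgp_def)
    have "inv x \<otimes> z \<otimes> x \<in> K" using zm by (simp add: conj_sgp_def)
    moreover have "inv x \<otimes> m \<otimes> x \<in> M" using NN_conj[OF M, of "inv x" m] zm x by simp
    moreover have "inv x \<otimes> y \<otimes> x = (inv x \<otimes> z \<otimes> x) \<otimes> (inv x \<otimes> m \<otimes> x)"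
      using zm c x by (simp add: grp_simps)
    ultimately show "inv x \<otimes> y \<otimes> x \<in> K <#> M" unfolding set_mult_def by blast
  qed (use x y in simp)
  then show "y \<in> conj_sgp x K" using y by (simp add: conj_sgp_def)
qed

lemma conj_sgp_mem: "x \<in> carrier G \<Longrightarrow> K \<subseteq> carrier G \<Longrightarrow> k \<in> K \<Longrightarrow> x \<otimes> k \<otimes> inv x \<in> conj_sgp x K"
  unfolding conj_sgp_def by (auto simp: grp_simps subset_iff)

lemma conj_sgp_memE: "x \<in> carrier G \<Longrightarrow> y \<in> conj_sgp x K \<Longrightarrow> \<exists>k\<in>K. y = x \<otimes> k \<otimes> inv x"
  unfolding conj_sgp_def by (intro bexI[of _ "inv x \<otimes> y \<otimes> x"]) (auto simp: grp_simps)

lemma conj_sgp_near: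
  assumes K: "K \<in> closed_sgps" and x: "x \<in> carrier G" and M: "M \<in> NN" and m: "m \<in> M"
  shows "conj_sgp (m \<otimes> x) K \<subseteq> conj_sgp x K <#> M"
proof
  fix y assume y: "y \<in> conj_sgp (m \<otimes> x) K"
  have mc: "m \<in> carrier G" using m NN_carrier M by blast
  have Kc: "K \<subseteq> carrier G" using K closed_sgps_subgroup sgp_sub by blast
  obtain k where k: "k \<in> K" "y = (m \<otimes> x) \<otimes> k \<otimes> inv (m \<otimes> x)" using conj_sgp_memE y mc x by blast
  note cM = mult_NN[OF closed_sgps_subgroup[OF conj_sgp_closed_sgps[OF K x]] M]
  have "x \<otimes> k \<otimes> inv x \<in> conj_sgp x K <#> M" using conj_sgp_mem[OF x Kc k(1)] cM by blast
  then have "m \<otimes> (x \<otimes> k \<otimes> inv x) \<otimes> inv m \<in> conj_sgp x K <#> M"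
    using cM m by (meson sgp_inv sgp_mult subsetD)
  moreover have "y = m \<otimes> (x \<otimes> k \<otimes> inv x) \<otimes> inv m"
    using k Kc mc x by (auto simp: grp_simps)
  ultimately show "y \<in> conj_sgp x K <#> M" by simp
qed

text \<open>The family to which scatteredness is applied consists of the conjugates of \<open>K\<close> by \<open>N\<close>.\<close>

lemma scattered_at_normalizer_open:
  assumes s: "scattered_at K N"
  obtains M where "M \<in> NN" "M \<subseteq> N" "M \<subseteq> normalizing K"
proof -
  note K = scattered_atD[OF s]
  have Kc: "K \<subseteq> carrier G" using K sgp_sub by blast
  have Nc: "N \<subseteq> carrier G" using K NN_carrier by blast
  define C where "C = (\<lambda>x. conj_sgp x K) ` N"
  have "conj_sgp x K \<in> sgp_nbh K N" if x: "x \<in> N" for x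
  proof -
    have xc: "x \<in> carrier G" using x Nc by blast
    \<comment> \<open>Rewritten so that \<open>conj_sgp_near\<close> applies in both directions,
      from \<open>\<one>\<close> to \<open>x\<close> and back by \<open>inv x\<close>.\<close>
    have "conj_sgp x K = conj_sgp (x \<otimes> \<one>) K" "K = conj_sgp \<one> K" "K = conj_sgp (inv x \<otimes> x) K"
      using xc Kc by (auto simp: conj_sgp_def)
    then show ?thesis
      using sgp_nbh_memI[OF conj_sgp_closed_sgps[OF K(1) xc] K(1,2)] conj_sgp_near[OF K(1) one_closed K(2) x]
        conj_sgp_near[OF K(1) xc K(2) sgp_inv[OF NN_subgroup[OF K(2)] x]] by simp
  qed
  then have "C \<subseteq> sgp_nbh K N" by (auto simp: C_def)
  moreover have "C \<noteq> {}" using sgp_one[OF NN_subgroup[OF K(2)]] by (auto simp: C_def)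
  ultimately obtain L M where LM: "L \<in> C" "M \<in> NN" "M \<subseteq> N"
    "\<And>L'. L' \<in> C \<Longrightarrow> L' <#> M = L <#> M \<Longrightarrow> L' = L"
    using scattered_at_isolated[OF s] K(2) by metis
  obtain x where x: "x \<in> N" "L = conj_sgp x K" using LM by (auto simp: C_def)
  have xc: "x \<in> carrier G" using x Nc by blast
  have Ms: "subgroup M G" using NN_subgroup LM by blast
  \<comment> \<open>Conjugating further by \<open>M\<close> stays in the isolating neighbourhood, so
    it fixes \<open>L\<close>. Thus \<open>M\<close> normalizes a conjugate of \<open>K\<close> and,
    being normal in \<open>G\<close>, also \<open>K\<close>.\<close>
  have eq: "conj_sgp (m \<otimes> x) K = conj_sgp x K" if m: "m \<in> M" for m
  proof -
    have mc: "m \<in> carrier G" using m Ms sgp_mem by blast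
    have mx: "m \<otimes> x \<in> N" "m \<otimes> x \<in> carrier G" using m x LM(3) sgp_mult[OF NN_subgroup[OF K(2)]] mc xc by auto
    have "x = inv m \<otimes> (m \<otimes> x)" using mc xc by (simp add: grp_simps)
    then have "conj_sgp x K \<subseteq> conj_sgp (m \<otimes> x) K <#> M"
      using conj_sgp_near[OF K(1) mx(2) LM(2) sgp_inv[OF Ms m]] by simp
    then have "conj_sgp (m \<otimes> x) K <#> M = conj_sgp x K <#> M"
      using conj_sgp_near[OF K(1) xc LM(2) m] eq_mult_NN_iff[OF _ _ LM(2)] conj_sgp_closed_sgps[OF K(1)] closed_sgps_subgroup mx xc
      by metis
    then show ?thesis using LM(4)[of "conj_sgp (m \<otimes> x) K"] mx x by (auto simp: C_def)
  qed
  have "M \<subseteq> normalizing K"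
  proof (rule subset_normalizingI[OF Ms])
    fix m k assume m: "m \<in> M" and k: "k \<in> K"
    have mc: "m \<in> carrier G" and kc: "k \<in> carrier G" using m k Ms Kc sgp_mem by blast+
    \<comment> \<open>With this choice \<open>m' \<otimes> x\<close> equals
      \<open>x \<otimes> inv m\<close>, and conjugating back gives
      \<open>m \<otimes> k \<otimes> inv m\<close>.\<close>
    define m' where "m' = x \<otimes> inv m \<otimes> inv x"
    have m': "m' \<in> M" unfolding m'_def using NN_conj[OF LM(2) xc] sgp_inv[OF Ms m] by blast
    have "x \<otimes> k \<otimes> inv x \<in> conj_sgp (m' \<otimes> x) K" using eq[OF m'] conj_sgp_mem[OF xc Kc k] by simp
    then have "inv (m' \<otimes> x) \<otimes> (x \<otimes> k \<otimes> inv x) \<otimes> (m' \<otimes> x) \<in> K" by (simp add: conj_sgp_def)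
    moreover have "inv (m' \<otimes> x) \<otimes> (x \<otimes> k \<otimes> inv x) \<otimes> (m' \<otimes> x) = m \<otimes> k \<otimes> inv m"
      using mc kc xc unfolding m'_def by (simp add: grp_simps)
    ultimately show "m \<otimes> k \<otimes> inv m \<in> K" by simp
  qed
  then show ?thesis using that LM by blast
qed

lemma closed_gen_insert_near:
  assumes K: "K \<subseteq> carrier G" and x: "x \<in> carrier G" "y \<in> carrier G" and M: "M \<in> NN"
    and xy: "y \<otimes> inv x \<in> M"
  shows "closed_gen (insert x K) \<subseteq> closed_gen (insert y K) <#> M"
proof -
  have F: "closed_gen (insert y K) \<in> closed_sgps" using closed_gen_closed_sgps K x by simp
  note FM = mult_NN[OF closed_sgps_subgroup[OF F] M]
  have "x = inv (y \<otimes> inv x) \<otimes> y" using x by (simp add: grp_simps)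
  moreover have "inv (y \<otimes> inv x) \<in> closed_gen (insert y K) <#> M"
    using sgp_inv[OF NN_subgroup[OF M] xy] FM by blast
  moreover have "y \<in> closed_gen (insert y K) <#> M" using closed_gen_subset FM by blast
  ultimately have "x \<in> closed_gen (insert y K) <#> M" using sgp_mult[OF FM(2)] by metis
  moreover have "K \<subseteq> closed_gen (insert y K) <#> M" using closed_gen_subset FM by blast
  ultimately show ?thesis using closed_gen_least open_sgp_closed_sgps[OF FM(1)] by blast
qed

lemma closed_gen_of_closed_sgps: "K \<in> closed_sgps \<Longrightarrow> closed_gen K = K"
  using closed_gen_subset closed_gen_least by blast

lemma closed_gen_insert_near_eq:
  assumes K: "K \<subseteq> carrier G" and x: "x \<in> carrier G" "m \<in> M" and M: "M \<in> NN"
  shows "closed_gen (insert (x \<otimes> m) K) <#> M = closed_gen (insert x K) <#> M"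
proof -
  have m: "m \<in> carrier G" using x NN_carrier M by blast
  have c: "closed_gen (insert (x \<otimes> m) K) \<in> closed_sgps" "closed_gen (insert x K) \<in> closed_sgps" using closed_gen_closed_sgps K x m by auto
  have i: "x \<otimes> m \<otimes> inv x \<in> M" using NN_conj M x by blast
  have "inv (x \<otimes> m \<otimes> inv x) \<in> M" using sgp_inv[OF NN_subgroup[OF M] i] .
  then have j: "x \<otimes> inv (x \<otimes> m) \<in> M" using x m by (simp add: grp_simps)
  show ?thesis
    using eq_mult_NN_iff[OF closed_sgps_subgroup[OF c(1)] closed_sgps_subgroup[OF c(2)] M] K x m M i j
      closed_gen_insert_near[OF K _ _ M] by simp
qed

text \<open>Here the family consists of the closed subgroups generated by \<open>K\<close> and one element of \<open>N\<close>.\<close>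

lemma scattered_at_open_cyclic:
  assumes s: "scattered_at K N"
  obtains g M where "g \<in> N" "M \<in> NN" "M \<subseteq> N" "M \<subseteq> closed_gen (insert g K)" "closed_gen (insert g K) \<in> sgp_nbh K N"
proof -
  note K = scattered_atD[OF s]
  have Kc: "K \<subseteq> carrier G" using K sgp_sub by blast
  have Nc: "N \<subseteq> carrier G" using K NN_carrier by blast
  have Ns: "subgroup N G" using K NN_subgroup by blast
  define C where "C = (\<lambda>x. closed_gen (insert x K)) ` N"
  have nb: "closed_gen (insert x K) \<in> sgp_nbh K N" if x: "x \<in> N" for x
  proof -
    have xc: "x \<in> carrier G" using x Nc by blast
    have "closed_gen (insert (\<one> \<otimes> x) K) <#> N = closed_gen (insert \<one> K) <#> N"
      by (rule closed_gen_insert_near_eq[OF Kc one_closed x K(2)])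
    moreover have "insert \<one> K = K" using sgp_one[OF K(3)] by blast
    ultimately show ?thesis using closed_gen_of_closed_sgps[OF K(1)] closed_gen_closed_sgps Kc xc by (simp add: sgp_nbh_def)
  qed
  then have "C \<subseteq> sgp_nbh K N" by (auto simp: C_def)
  moreover have "C \<noteq> {}" using sgp_one[OF Ns] by (auto simp: C_def)
  ultimately obtain L M where LM: "L \<in> C" "M \<in> NN" "M \<subseteq> N"
    "\<And>L'. L' \<in> C \<Longrightarrow> L' <#> M = L <#> M \<Longrightarrow> L' = L"
    using scattered_at_isolated[OF s] K(2) by metis
  obtain x where x: "x \<in> N" "L = closed_gen (insert x K)" using LM by (auto simp: C_def)
  have xc: "x \<in> carrier G" using x Nc by blast
  have Ls: "subgroup L G" using x closed_gen_closed_sgps Kc xc closed_sgps_subgroup by simp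
  \<comment> \<open>Isolation makes \<open>x\<close> and \<open>x \<otimes> m\<close> generate the
    same closed subgroup over \<open>K\<close>, which therefore contains \<open>m\<close>.\<close>
  have "M \<subseteq> L"
  proof
    fix m assume m: "m \<in> M"
    have mc: "m \<in> carrier G" using m NN_carrier LM by blast
    have "closed_gen (insert (x \<otimes> m) K) \<in> C" using m x LM(3) sgp_mult[OF Ns] by (auto simp: C_def)
    then have "closed_gen (insert (x \<otimes> m) K) = L"
      using LM(4) closed_gen_insert_near_eq[OF Kc xc m LM(2)] x by simp
    then have "x \<otimes> m \<in> L" "x \<in> L" using closed_gen_subset x by blast+
    then have "inv x \<otimes> (x \<otimes> m) \<in> L" using Ls sgp_inv sgp_mult by blast
    then show "m \<in> L" using xc mc by (simp add: grp_simps)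
  qed
  then show ?thesis using that x LM nb by blast
qed

text \<open>\<open>N\<close> is shrunk into the normalizer of \<open>K\<close> before the additional
  generator is chosen, so that this generator normalizes \<open>K\<close>.\<close>

lemma scattered_at_procyclic_over:
  assumes s: "scattered_at K N"
  obtains F g where "procyclic_over K F g" "F \<in> sgp_nbh K N" "open_sgp F"
proof -
  note K = scattered_atD[OF s]
  obtain N1 where N1: "N1 \<in> NN" "N1 \<subseteq> N" "N1 \<subseteq> normalizing K" using scattered_at_normalizer_open[OF s] .
  have s1: "scattered_at K N1" using scattered_at_mono[OF s] N1 by blast
  obtain g M where g: "g \<in> N1" "M \<in> NN" "M \<subseteq> closed_gen (insert g K)" "closed_gen (insert g K) \<in> sgp_nbh K N1"
    using scattered_at_open_cyclic[OF s1] by metis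
  have p: "procyclic_over K (closed_gen (insert g K)) g" by (rule procyclic_over_closed_gen[OF K(1)]) (use g N1 in blast)
  moreover have "closed_gen (insert g K) \<in> sgp_nbh K N" using g(4) sgp_nbh_mono[OF K(1,2) N1(1,2)] by blast
  moreover have "open_sgp (closed_gen (insert g K))" using g p by (auto simp: open_sgp_def procyclic_over_def)
  ultimately show ?thesis using that by blast
qed

text \<open>The modular law: as \<open>L\<close> lies in \<open>R\<close>, the trace of
  \<open>L <#> M\<close> on \<open>R\<close> is \<open>L <#> (R \<inter> M)\<close>.\<close>

lemma mult_NN_Int_cancel:
  assumes L: "subgroup L G" and R: "subgroup R G" and LR: "L \<subseteq> R" and M: "M \<in> NN"
    and eq: "L <#> M = R <#> M" and "R \<inter> M \<subseteq> L"
  shows "L = R"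
proof
  show "R \<subseteq> L"
  proof
    fix x assume x: "x \<in> R"
    then have "x \<in> L <#> M" using mult_NN(3)[OF R M] eq by blast
    then obtain l m where lm: "l \<in> L" "m \<in> M" "x = l \<otimes> m" by (auto simp: set_mult_def)
    have c: "l \<in> carrier G" "m \<in> carrier G" using lm L NN_carrier[OF M] sgp_mem by blast+
    have "m = inv l \<otimes> x" using lm c by (simp add: grp_simps)
    then have "m \<in> R" using sgp_inv[OF R, of l] sgp_mult[OF R] lm(1) LR x by auto
    then show "x \<in> L" using lm assms(6) sgp_mult[OF L] by blast
  qed
qed fact

text \<open>An isolated \<open>R\<close> among the closed subgroups of \<open>K\<close> near
  \<open>K\<close> contains \<open>K \<inter> M\<close>, since \<open>K \<inter> (R <#> M)\<close>
  agrees with it modulo \<open>M\<close>. If \<open>L <#> M = K <#> M\<close>, then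
  \<open>L \<inter> R\<close> agrees with \<open>R\<close> modulo \<open>M\<close>, so
  \<open>L\<close> contains \<open>R\<close>, hence \<open>K \<inter> M\<close>, and the modular law
  gives \<open>L = K\<close>.\<close>

lemma scattered_at_isolated_below:
  assumes s: "scattered_at K N" and M0: "M0 \<in> NN"
  obtains M where "M \<in> NN" "M \<subseteq> M0" "\<And>L. L \<in> closed_sgps \<Longrightarrow> L \<subseteq> K \<Longrightarrow> L <#> M = K <#> M \<Longrightarrow> L = K"
proof -
  note K = scattered_atD[OF s]
  define C where "C = {L \<in> sgp_nbh K N. L \<subseteq> K}"
  have "C \<subseteq> sgp_nbh K N" "C \<noteq> {}" using scattered_at_self[OF s] by (auto simp: C_def)
  moreover have "M0 \<inter> N \<in> NN" using M0 K NN_Int by blast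
  ultimately obtain R M where RM: "R \<in> C" "M \<in> NN" "M \<subseteq> M0 \<inter> N"
    "\<And>L. L \<in> C \<Longrightarrow> L <#> M = R <#> M \<Longrightarrow> L = R"
    using scattered_at_isolated[OF s, of C "M0 \<inter> N"] by metis
  have R: "R \<in> closed_sgps" "R <#> N = K <#> N" "R \<subseteq> K" using RM by (auto simp: C_def sgp_nbh_def)
  have Rs: "subgroup R G" using R closed_sgps_subgroup by blast
  have CI: "L \<in> C" if "L \<in> closed_sgps" "L \<subseteq> K" "L <#> M = R <#> M" for L
  proof -
    have "L <#> N = R <#> N"
      using eq_mult_NN_mono[OF _ Rs RM(2) K(2) _ that(3)] closed_sgps_subgroup that RM(3) by blast
    then show ?thesis using that R by (simp add: C_def sgp_nbh_def)
  qed
  note RMm = mult_NN[OF Rs RM(2)]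
  have KM: "K \<inter> M \<subseteq> R"
  proof -
    have "K \<inter> (R <#> M) \<in> closed_sgps" using closed_sgps_Int K(1) open_sgp_closed_sgps[OF RMm(1)] by blast
    moreover have "(K \<inter> (R <#> M)) <#> M = R <#> M"
      using eq_mult_NN_iff[OF closed_sgps_subgroup[OF calculation] Rs RM(2)] R RMm
        mult_NN(3)[OF closed_sgps_subgroup[OF calculation] RM(2)] by blast
    ultimately have "K \<inter> (R <#> M) = R" using RM(4) CI by blast
    then show ?thesis using RMm by blast
  qed
  have "L = K" if L: "L \<in> closed_sgps" "L \<subseteq> K" "L <#> M = K <#> M" for L
  proof -
    have Ls: "subgroup L G" using L closed_sgps_subgroup by blast
    have LR: "L \<inter> R \<in> closed_sgps" using closed_sgps_Int L R by blast
    \<comment> \<open>In \<open>x = l \<otimes> m\<close> the factor \<open>m\<close> lies in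
      \<open>K \<inter> M\<close>, hence in \<open>R\<close>, and then so does
      \<open>l\<close>.\<close>
    have "R \<subseteq> (L \<inter> R) <#> M"
    proof
      fix x assume x: "x \<in> R"
      then have "x \<in> L <#> M" using R L(3) mult_NN(3)[OF K(3) RM(2)] by blast
      then obtain l m where lm: "l \<in> L" "m \<in> M" "x = l \<otimes> m" by (auto simp: set_mult_def)
      have c: "l \<in> carrier G" "m \<in> carrier G" using lm Ls NN_carrier[OF RM(2)] sgp_mem by blast+
      have "m = inv l \<otimes> x" using lm c by (simp add: grp_simps)
      then have "m \<in> K" using lm L(2) x R(3) K(3) by (metis sgp_inv sgp_mult subsetD)
      then have "m \<in> R" using KM lm by blast
      have "l = x \<otimes> inv m" using lm c by (simp add: grp_simps)
      then have "l \<in> R" using x \<open>m \<in> R\<close> Rs by (metis sgp_inv sgp_mult)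
      then show "x \<in> (L \<inter> R) <#> M" using lm unfolding set_mult_def by blast
    qed
    then have "(L \<inter> R) <#> M = R <#> M"
      using eq_mult_NN_iff[OF closed_sgps_subgroup[OF LR] Rs RM(2)] RMm by blast
    then have "L \<inter> R = R" using RM(4) CI LR L by blast
    then show ?thesis using mult_NN_Int_cancel[OF Ls K(3) L(2) RM(2) L(3)] KM by blast
  qed
  then show ?thesis using that RM by blast
qed

end

section \<open>Primes of infinite index near a subgroup\<close>

text \<open>The substitute for cancelling in infinite exponents: the power of \<open>p\<close> is
  chosen larger in advance by the exponent that the harmless factor \<open>a\<close> can
  absorb.\<close>

lemma prime_power_dvd_cofactor:
  fixes p a b :: nat
  assumes p: "prime p" and a: "a > 0" and d: "p ^ (multiplicity p a + n) dvd a * b"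
  shows "p ^ n dvd b"
proof (cases "b = 0")
  case False
  have "multiplicity p a + n \<le> multiplicity p (a * b)"
    using p a False d by (intro multiplicity_geI) (auto simp: prime_gt_1_nat)
  also have "\<dots> = multiplicity p a + multiplicity p b"
    using p a False by (simp add: prime_elem_multiplicity_mult_distrib)
  finally show ?thesis by (simp add: multiplicity_dvd')
qed simp

lemma prime_power_dvd_cofactor':
  fixes p a b :: nat
  assumes p: "prime p" and a: "\<not> p ^ s dvd a" and d: "p ^ (s + n) dvd a * b"
  shows "p ^ n dvd b"
proof -
  have a0: "a > 0" using a by (cases a) auto
  have "multiplicity p a < s" using a multiplicity_dvd' not_less by blast
  then have "p ^ (multiplicity p a + n) dvd p ^ (s + n)" by (intro le_imp_power_dvd) simp
  then show ?thesis using prime_power_dvd_cofactor[OF p a0] d dvd_trans by blast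
qed

context normal_base
begin

definition infinite_primes :: "'a set \<Rightarrow> nat set" where
  "infinite_primes K = {p. prime p \<and> infinite_p_index p (carrier G) K}"

lemma infinite_p_index_open:
  assumes p: "prime p" and inf: "infinite_p_index p (carrier G) K" and K: "subgroup K G" and F: "open_sgp F" "K \<subseteq> F"
  shows "infinite_p_index p F K"
  unfolding infinite_p_index_def
proof
  fix n
  have Fs: "subgroup F G" using F open_sgp_subgroup by blast
  obtain M0 where M0: "M0 \<in> NN" "M0 \<subseteq> F" using F by (auto simp: open_sgp_def)
  obtain M where M: "M \<in> NN" "M \<subseteq> M0"
    "p ^ (multiplicity p (rel_index (carrier G) F) + n) dvd rel_index (carrier G) (K <#> M)"
    using infinite_p_indexE[OF inf subgroup_self K M0(1)] .
  note KM = mult_NN[OF K M(1)]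
  have "K <#> M \<subseteq> F" by (rule set_mult_least[OF Fs F(2)]) (use M M0 in blast)
  then have e: "rel_index (carrier G) (K <#> M) = rel_index (carrier G) F * rel_index F (K <#> M)"
    using rel_index_tower'[OF subgroup_self Fs KM(2)] sgp_sub[OF Fs] open_sgp_finite[OF KM(1)] by blast
  have "p ^ n dvd rel_index F (K <#> M)"
    by (rule prime_power_dvd_cofactor[OF p rel_index_open_sgp_pos[OF F(1) subgroup_self]]) (rule M(3)[unfolded e])
  then show "\<exists>H. open_sgp H \<and> K \<subseteq> H \<and> p ^ n dvd rel_index F H" using KM by blast
qed

text \<open>Let \<open>M\<close> isolate \<open>F\<close> among its closed subgroups; the primes in
  question all divide \<open>rel_index F M\<close>. For any other one, the closed subgroup generated
  by \<open>K\<close> and the \<open>p\<close>-th power of \<open>g\<close> has full image modulo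
  \<open>M\<close>, so it is \<open>F\<close>. Then \<open>g\<close> is a power of its
  \<open>p\<close>-th power modulo \<open>U\<close>, impossible when \<open>p\<close> divides the
  order of \<open>g\<close> modulo \<open>U\<close>.\<close>

lemma procyclic_over_finite_primes:
  assumes s: "scattered_at F N" and F: "procyclic_over K F g" "open_sgp F" and K: "K \<in> closed_sgps"
  shows "finite {p. prime p \<and> (\<exists>U. open_sgp U \<and> K \<subseteq> U \<and> p dvd rel_index F U)}"
proof -
  have Fs: "subgroup F G" "g \<in> F" "K \<subseteq> F" "F \<subseteq> normalizing K" "subgroup K G" using F by (auto simp: procyclic_over_def)
  have gc: "g \<in> carrier G" using Fs sgp_mem by blast
  have FF: "F \<in> closed_sgps" using F open_sgp_closed_sgps by blast
  obtain M0 where M0: "M0 \<in> NN" "M0 \<subseteq> F" using F by (auto simp: open_sgp_def)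
  obtain M where M: "M \<in> NN" "M \<subseteq> M0" and
    iso: "\<And>L. L \<in> closed_sgps \<Longrightarrow> L \<subseteq> F \<Longrightarrow> L <#> M = F <#> M \<Longrightarrow> L = F"
    using scattered_at_isolated_below[OF s M0(1)] by metis
  have MF: "M \<subseteq> F" using M M0 by blast
  have "p dvd rel_index F M" if p: "prime p" and U: "open_sgp U" "K \<subseteq> U" "p dvd rel_index F U" for p U
  proof (rule ccontr)
    assume nd: "\<not> p dvd rel_index F M"
    define h where "h = g [^] (int p)"
    have h: "h \<in> normalizing K" "h \<in> F" unfolding h_def
      using int_pow_in_subgroup[OF normalizing_subgroup[OF Fs(5)]] int_pow_in_subgroup[OF Fs(1,2)] Fs by blast+
    define L where "L = closed_gen (insert h K)"
    have Lp: "procyclic_over K L h" unfolding L_def by (rule procyclic_over_closed_gen[OF K h(1)])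
    have LF: "L \<subseteq> F" unfolding L_def using closed_gen_least[OF FF] h Fs by blast
    have Ls: "subgroup L G" "h \<in> L" "K \<subseteq> L" using Lp by (auto simp: procyclic_over_def)
    note LM = mult_NN[OF Ls(1) M(1)]
    have LMF: "L <#> M \<subseteq> F" by (rule set_mult_least[OF Fs(1) LF MF])
    have "h \<in> L <#> M" "K \<subseteq> L <#> M" using LM Ls by blast+
    \<comment> \<open>The index divides \<open>p\<close>, as \<open>L\<close> contains the
      \<open>p\<close>-th power of \<open>g\<close>; it also divides \<open>rel_index F M\<close>,
      which is prime to \<open>p\<close>.\<close>
    then have "int (rel_index F (L <#> M)) dvd int p"
      using procyclic_over_index[OF F(1) LM(1)] unfolding h_def by blast
    then have "rel_index F (L <#> M) = 1 \<or> rel_index F (L <#> M) = p" using p prime_nat_iff by auto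
    moreover have "rel_index F (L <#> M) dvd rel_index F M"
      by (rule rel_index_open_sgp_dvd[OF Fs(1) NN_open_sgp[OF M(1)] LM(4,2)])
    ultimately have "rel_index F (L <#> M) = 1" using nd by auto
    then have "L <#> M = F" using rel_index_eq_1D[OF _ Fs(1) LM(2)] LMF by blast
    moreover have "F <#> M = F" by (rule mult_NN_absorb[OF Fs(1) M(1) MF])
    moreover have "L \<in> closed_sgps" unfolding L_def using closed_gen_closed_sgps h normalizing_carrier sgp_sub[OF Fs(5)] by blast
    ultimately have "L = F" using iso LF by simp
    obtain M1 where M1: "M1 \<in> NN" "K <#> M1 \<subseteq> U" using open_sgp_shrink[OF Fs(5) U(1,2) M(1)] .
    obtain i :: int and c where ic: "c \<in> K <#> M1" "g = c \<otimes> h [^] i"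
      using Lp M1 Fs(2) \<open>L = F\<close> unfolding procyclic_over_def by meson
    have cU: "c \<in> U" "c \<in> carrier G" using ic M1 open_sgp_subgroup[OF U(1)] sgp_mem by blast+
    have "h [^] i = g [^] (int p * i)" using gc unfolding h_def by (simp add: int_pow_pow)
    then have "c = g \<otimes> inv (g [^] (int p * i))" using ic cU gc by (metis int_pow_closed inv_solve_right')
    then have "c = g [^] (1 - int p * i)" using gc by (simp add: int_pow_diff)
    then have "int (rel_index F U) dvd 1 - int p * i" using procyclic_over_index[OF F(1) U(1,2)] cU by simp
    moreover have "int p dvd int (rel_index F U)" using U(3) by simp
    ultimately have "int p dvd 1 - int p * i" by (rule dvd_trans[rotated])
    then have "int p dvd 1" by (metis dvd_diff_commute dvd_triv_left dvd_diffD1 diff_add_cancel dvd_add)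
    then show False using p by simp
  qed
  then have "{p. prime p \<and> (\<exists>U. open_sgp U \<and> K \<subseteq> U \<and> p dvd rel_index F U)} \<subseteq> {p. p dvd rel_index F M}" by blast
  moreover have "finite {p. p dvd rel_index F M}"
    using rel_index_open_sgp_pos[OF NN_open_sgp[OF M(1)] Fs(1)] by simp
  ultimately show ?thesis using finite_subset by blast
qed

lemma infinite_primes_subset_primes:
  assumes F: "open_sgp F" "K \<subseteq> F" and K: "subgroup K G"
  shows "infinite_primes K \<subseteq> {p. prime p \<and> (\<exists>U. open_sgp U \<and> K \<subseteq> U \<and> p dvd rel_index F U)}"
proof
  fix p assume p: "p \<in> infinite_primes K"
  then have "infinite_p_index p F K" using infinite_p_index_open K F by (auto simp: infinite_primes_def)
  then obtain U where "open_sgp U" "K \<subseteq> U" "p ^ 1 dvd rel_index F U" unfolding infinite_p_index_def by blast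
  then show "p \<in> {p. prime p \<and> (\<exists>U. open_sgp U \<and> K \<subseteq> U \<and> p dvd rel_index F U)}"
    using p by (auto simp: infinite_primes_def)
qed

lemma finite_infinite_primes:
  assumes s: "scattered_at K N" shows "finite (infinite_primes K)"
proof -
  obtain F g where F: "procyclic_over K F g" "F \<in> sgp_nbh K N" "open_sgp F" using scattered_at_procyclic_over[OF s] .
  have "K \<subseteq> F" using F(1) by (simp add: procyclic_over_def)
  have "scattered_at F N" using scattered_at_sgp_nbh[OF s F(2)] scattered_atD[OF s] by blast
  from procyclic_over_finite_primes[OF this F(1,3) scattered_atD(1)[OF s]]
  show ?thesis by (rule finite_subset[OF infinite_primes_subset_primes[OF F(3) \<open>K \<subseteq> F\<close> scattered_atD(3)[OF s]]])
qed

text \<open>Take \<open>U\<close> with the largest exponent of \<open>p\<close> in its index; a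
  factor \<open>p\<close> in a further step down would exceed it.\<close>

lemma not_infinite_p_index_open:
  assumes p: "prime p" and K: "subgroup K G" and n: "\<not> infinite_p_index p (carrier G) K"
  obtains U where "open_sgp U" "K \<subseteq> U" "\<And>U'. open_sgp U' \<Longrightarrow> K \<subseteq> U' \<Longrightarrow> U' \<subseteq> U \<Longrightarrow> \<not> p dvd rel_index U U'"
proof -
  obtain n where n: "\<And>H. open_sgp H \<Longrightarrow> K \<subseteq> H \<Longrightarrow> \<not> p ^ n dvd rel_index (carrier G) H"
    using n unfolding infinite_p_index_def by blast
  let ?P = "\<lambda>H. open_sgp H \<and> K \<subseteq> H"
  have "?P (carrier G)" using open_sgp_carrier sgp_sub[OF K] by blast
  moreover have "\<forall>H. ?P H \<longrightarrow> multiplicity p (rel_index (carrier G) H) < n"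
    using n multiplicity_dvd' not_less by blast
  ultimately obtain U where U: "?P U"
    "\<And>H. ?P H \<Longrightarrow> multiplicity p (rel_index (carrier G) H) \<le> multiplicity p (rel_index (carrier G) U)"
    using ex_has_greatest_nat[of ?P "carrier G" "\<lambda>H. multiplicity p (rel_index (carrier G) H)" n] by blast
  have "\<not> p dvd rel_index U U'" if U': "open_sgp U'" "K \<subseteq> U'" "U' \<subseteq> U" for U'
  proof
    assume d: "p dvd rel_index U U'"
    have Us: "subgroup U G" "subgroup U' G" using U U' open_sgp_subgroup by blast+
    have e: "rel_index (carrier G) U' = rel_index (carrier G) U * rel_index U U'"
      using rel_index_tower'[OF subgroup_self Us U'(3)] sgp_sub[OF Us(1)] open_sgp_finite[OF U'(1)] by blast
    have "rel_index (carrier G) U > 0" "rel_index U U' > 0"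
      using rel_index_open_sgp_pos U U' Us subgroup_self by blast+
    then have "multiplicity p (rel_index (carrier G) U') = multiplicity p (rel_index (carrier G) U) + multiplicity p (rel_index U U')"
      unfolding e using p by (simp add: prime_elem_multiplicity_mult_distrib)
    moreover have "multiplicity p (rel_index U U') \<ge> 1"
      using d \<open>rel_index U U' > 0\<close> p by (intro multiplicity_geI) auto
    ultimately show False using U(2)[of U'] U' by simp
  qed
  then show ?thesis using that U by blast
qed

text \<open>Among the primes outside \<open>infinite_primes K\<close> only finitely many divide the
  index in \<open>F\<close> of an open subgroup over \<open>K\<close>. Each is exhausted by one open
  subgroup, and \<open>W\<close> intersects these with \<open>F\<close>. As a result, only primes of
  \<open>infinite_primes K\<close> occur in the index of \<open>K\<close> in
  \<open>K <#> N1\<close>.\<close>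

lemma good_sgp_nbh:
  assumes s: "scattered_at K N" and F: "procyclic_over K F g" "F \<in> sgp_nbh K N" "open_sgp F" and M0: "M0 \<in> NN"
  obtains N1 where "N1 \<in> NN" "N1 \<subseteq> M0" "K <#> N1 \<subseteq> F"
    "\<And>p U. prime p \<Longrightarrow> p \<notin> infinite_primes K \<Longrightarrow> open_sgp U \<Longrightarrow> K \<subseteq> U \<Longrightarrow> U \<subseteq> K <#> N1 \<Longrightarrow> \<not> p dvd rel_index (K <#> N1) U"
proof -
  note K = scattered_atD[OF s]
  have Fs: "subgroup F G" "K \<subseteq> F" using F by (auto simp: procyclic_over_def)
  define B where "B = {p. prime p \<and> (\<exists>U. open_sgp U \<and> K \<subseteq> U \<and> p dvd rel_index F U)} - infinite_primes K"
  have "scattered_at F N" using scattered_at_sgp_nbh[OF s F(2)] K by blast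
  then have finB: "finite B" unfolding B_def using procyclic_over_finite_primes[OF _ F(1,3) K(1)] by blast
  have "\<exists>U. open_sgp U \<and> K \<subseteq> U \<and> (\<forall>U'. open_sgp U' \<longrightarrow> K \<subseteq> U' \<longrightarrow> U' \<subseteq> U \<longrightarrow> \<not> p dvd rel_index U U')"
    if "p \<in> B" for p
  proof -
    have p: "prime p" "\<not> infinite_p_index p (carrier G) K" using that by (auto simp: B_def infinite_primes_def)
    obtain U where "open_sgp U" "K \<subseteq> U" "\<And>U'. open_sgp U' \<Longrightarrow> K \<subseteq> U' \<Longrightarrow> U' \<subseteq> U \<Longrightarrow> \<not> p dvd rel_index U U'"
      by (rule not_infinite_p_index_open[OF p(1) K(3) p(2)]) blast
    then show ?thesis by blast
  qed
  then have "\<exists>V. \<forall>p\<in>B. open_sgp (V p) \<and> K \<subseteq> V p \<and> (\<forall>U'. open_sgp U' \<longrightarrow> K \<subseteq> U' \<longrightarrow> U' \<subseteq> V p \<longrightarrow> \<not> p dvd rel_index (V p) U')"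
    by (intro bchoice ballI)
  then obtain V where V: "\<And>p. p \<in> B \<Longrightarrow> open_sgp (V p)" "\<And>p. p \<in> B \<Longrightarrow> K \<subseteq> V p"
    "\<And>p U'. p \<in> B \<Longrightarrow> open_sgp U' \<Longrightarrow> K \<subseteq> U' \<Longrightarrow> U' \<subseteq> V p \<Longrightarrow> \<not> p dvd rel_index (V p) U'"
    by blast
  have int: "open_sgp (F \<inter> \<Inter>(V ` C))" if "finite C" "C \<subseteq> B" for C
    using that
  proof (induction C)
    case (insert p C)
    then have "open_sgp (F \<inter> \<Inter>(V ` C) \<inter> V p)" using open_sgp_Int V(1) by blast
    moreover have "F \<inter> \<Inter>(V ` C) \<inter> V p = F \<inter> \<Inter>(V ` insert p C)" by auto
    ultimately show ?case by simp
  qed (use F in simp)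
  define W where "W = F \<inter> \<Inter>(V ` B)"
  have W: "open_sgp W" "K \<subseteq> W" unfolding W_def using int finB V(2) Fs by auto
  obtain N1 where N1: "N1 \<in> NN" "N1 \<subseteq> M0" "K <#> N1 \<subseteq> W" using open_sgp_shrink[OF K(3) W M0] .
  note KN = mult_NN[OF K(3) N1(1)]
  have "\<not> p dvd rel_index (K <#> N1) U"
    if p: "prime p" "p \<notin> infinite_primes K" and U: "open_sgp U" "K \<subseteq> U" "U \<subseteq> K <#> N1" for p U
  proof -
    have *: "\<not> p dvd rel_index (K <#> N1) U" if X: "open_sgp X" "K <#> N1 \<subseteq> X" "\<not> p dvd rel_index X U" for X
      using rel_index_tower'[OF open_sgp_subgroup[OF X(1)] KN(2) open_sgp_subgroup[OF U(1)] U(3) X(2)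
          open_sgp_finite'[OF U(1) open_sgp_subgroup[OF X(1)]]] X(3) by (metis dvd_mult)
    show ?thesis
    proof (cases "p \<in> B")
      case True
      then show ?thesis using *[of "V p"] V N1 U unfolding W_def by blast
    next
      case False
      then show ?thesis using *[of F] F N1 U p unfolding W_def B_def by blast
    qed
  qed
  then show ?thesis using that N1 unfolding W_def by blast
qed

text \<open>The finite result is applied to \<open>H\<close> modulo \<open>M\<close>. There the
  image of \<open>N\<close> is nongenerating, because preimages of subgroups are open, hence closed,
  and \<open>ng\<close> applies to them. \<open>Q\<close> is the preimage of the normal
  \<open>p\<close>-complement of the image of \<open>N\<close>.\<close>

lemma nongenerating_open_p_complement:
  assumes H: "open_sgp H" and N: "N \<in> NN" "N \<subseteq> H" and M: "M \<in> NN" "M \<subseteq> N" and p: "prime p"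
    and ng: "\<forall>L\<in>closed_sgps. L \<subseteq> H \<longrightarrow> L <#> N = H <#> N \<longrightarrow> L = H"
  obtains Q n where "subgroup Q G" "M \<subseteq> Q" "Q \<subseteq> N" "H \<subseteq> normalizing Q" "\<not> p dvd rel_index Q M" "rel_index N Q = p ^ n"
proof -
  have Hs: "subgroup H G" using H open_sgp_subgroup by blast
  have Hc: "H \<subseteq> carrier G" using Hs sgp_sub by blast
  have Ms: "subgroup M G" and Ns: "subgroup N G" using M N NN_subgroup by blast+
  have Mc: "M \<subseteq> carrier G" using Ms sgp_sub by blast
  let ?H = "G\<lparr>carrier := H\<rparr>"
  have MH: "M \<lhd> ?H" using normal_restrict_supergroup[OF Hs NN_normal[OF M(1)]] M N by blast
  define \<Gamma> where "\<Gamma> = ?H Mod M"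
  have gr: "group \<Gamma>" unfolding \<Gamma>_def by (rule normal.factorgroup_is_group[OF MH])
  interpret Q: group \<Gamma> by (rule gr)
  define \<phi> where "\<phi> x = M #> x" for x
  have car: "carrier \<Gamma> = \<phi> ` H"
    unfolding \<Gamma>_def FactGroup_def RCOSETS_def \<phi>_def r_coset_def by auto
  have mult: "\<phi> x \<otimes>\<^bsub>\<Gamma>\<^esub> \<phi> y = \<phi> (x \<otimes> y)" if "x \<in> H" "y \<in> H" for x y
  proof -
    have "\<phi> x \<otimes>\<^bsub>\<Gamma>\<^esub> \<phi> y = \<phi> x <#> \<phi> y" unfolding \<Gamma>_def FactGroup_def by (simp add: set_mult_def)
    then show ?thesis using normal.rcos_sum[OF NN_normal[OF M(1)], of x y] that Hc unfolding \<phi>_def by auto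
  qed
  have hom: "\<phi> \<in> hom ?H \<Gamma>" using car mult by (auto simp: hom_def)
  have grH: "group ?H" using Hs subgroup_imp_group by blast
  interpret gh: group_hom ?H \<Gamma> \<phi> using grH gr hom by (simp add: group_hom_def group_hom_axioms_def)
  have inv_H: "inv\<^bsub>?H\<^esub> x = inv x" if "x \<in> H" for x using that m_inv_consistent[OF Hs] by simp
  have inv: "inv\<^bsub>\<Gamma>\<^esub> (\<phi> x) = \<phi> (inv x)" if "x \<in> H" for x
    using gh.hom_inv[of x] that inv_H by simp
  have one: "\<phi> \<one> = \<one>\<^bsub>\<Gamma>\<^esub>" using gh.hom_one by simp
  have \<phi>eq: "\<phi> x = \<phi> y \<longleftrightarrow> x \<otimes> inv y \<in> M" if "x \<in> H" "y \<in> H" for x y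
    unfolding \<phi>_def using rcos_eq_iff[OF Ms] that Hc by blast
  have img_subgroup: "subgroup (\<phi> ` X) \<Gamma>" if X: "subgroup X G" "X \<subseteq> H" for X
  proof (rule Q.subgroupI)
    show "\<phi> ` X \<subseteq> carrier \<Gamma>" using X car by blast
    show "\<phi> ` X \<noteq> {}" using sgp_one[OF X(1)] by blast
    show "inv\<^bsub>\<Gamma>\<^esub> a \<in> \<phi> ` X" if "a \<in> \<phi> ` X" for a using that X inv sgp_inv[OF X(1)] by auto
    show "a \<otimes>\<^bsub>\<Gamma>\<^esub> b \<in> \<phi> ` X" if ab: "a \<in> \<phi> ` X" "b \<in> \<phi> ` X" for a b
    proof -
      obtain x y where xy: "x \<in> X" "y \<in> X" "a = \<phi> x" "b = \<phi> y" using ab by blast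
      then have "a \<otimes>\<^bsub>\<Gamma>\<^esub> b = \<phi> (x \<otimes> y)" using mult X by blast
      then show ?thesis using xy sgp_mult[OF X(1)] by blast
    qed
  qed
  define pre where "pre Y = {x \<in> H. \<phi> x \<in> Y}" for Y
  have pre_subgroup: "subgroup (pre Y) G" if Y: "subgroup Y \<Gamma>" for Y
  proof (rule subgroupI)
    show "pre Y \<subseteq> carrier G" using Hc by (auto simp: pre_def)
    have "\<one> \<in> pre Y" using sgp_one[OF Hs] one subgroup.one_closed[OF Y] by (simp add: pre_def)
    then show "pre Y \<noteq> {}" by blast
    show "inv a \<in> pre Y" if "a \<in> pre Y" for a
      using that sgp_inv[OF Hs] inv subgroup.m_inv_closed[OF Y, of "\<phi> a"] by (auto simp: pre_def)
    show "a \<otimes> b \<in> pre Y" if "a \<in> pre Y" "b \<in> pre Y" for a b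
      using that sgp_mult[OF Hs] mult subgroup.m_closed[OF Y, of "\<phi> a" "\<phi> b"] by (auto simp: pre_def)
  qed
  have img_pre: "\<phi> ` pre Y = Y" if "Y \<subseteq> carrier \<Gamma>" for Y using that car by (auto simp: pre_def)
  have M_pre: "M \<subseteq> pre Y" if Y: "subgroup Y \<Gamma>" for Y
  proof
    fix m assume m: "m \<in> M"
    then have mH: "m \<in> H" using M N by blast
    have "\<phi> m = \<phi> \<one>" using \<phi>eq[OF mH sgp_one[OF Hs]] m mH Hc by auto
    then show "m \<in> pre Y" using one subgroup.one_closed[OF Y] mH by (simp add: pre_def)
  qed
  have fin: "finite (carrier \<Gamma>)" unfolding car \<phi>_def using open_sgp_finite'[OF NN_open_sgp[OF M(1)] Hs] .
  have Nn: "\<phi> ` N \<lhd> \<Gamma>"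
    unfolding Q.normal_inv_iff
  proof (intro conjI ballI)
    show "subgroup (\<phi> ` N) \<Gamma>" by (rule img_subgroup[OF Ns N(2)])
    fix a b assume "a \<in> carrier \<Gamma>" "b \<in> \<phi> ` N"
    then obtain x n where xn: "x \<in> H" "n \<in> N" "a = \<phi> x" "b = \<phi> n" using car by blast
    then have "a \<otimes>\<^bsub>\<Gamma>\<^esub> b \<otimes>\<^bsub>\<Gamma>\<^esub> inv\<^bsub>\<Gamma>\<^esub> a = \<phi> (x \<otimes> n \<otimes> inv x)"
      using N(2) Hs inv mult sgp_mult sgp_inv by (metis subsetD)
    then show "a \<otimes>\<^bsub>\<Gamma>\<^esub> b \<otimes>\<^bsub>\<Gamma>\<^esub> inv\<^bsub>\<Gamma>\<^esub> a \<in> \<phi> ` N" using NN_conj[OF N(1)] xn Hc by blast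
  qed
  have "Y = carrier \<Gamma>" if Y: "subgroup Y \<Gamma>" "Y <#>\<^bsub>\<Gamma>\<^esub> \<phi> ` N = carrier \<Gamma>" for Y
  proof -
    note PY = pre_subgroup[OF Y(1)] M_pre[OF Y(1)]
    have po: "open_sgp (pre Y)" using PY M by (auto simp: open_sgp_def)
    have sub: "pre Y \<subseteq> H" by (auto simp: pre_def)
    note PN = mult_NN[OF PY(1) N(1)]
    have "H \<subseteq> pre Y <#> N"
    proof
      fix x assume x: "x \<in> H"
      then have "\<phi> x \<in> Y <#>\<^bsub>\<Gamma>\<^esub> \<phi> ` N" using Y(2) car by blast
      then obtain y n where yn: "y \<in> Y" "n \<in> N" "\<phi> x = y \<otimes>\<^bsub>\<Gamma>\<^esub> \<phi> n" by (auto simp: set_mult_def)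
      then obtain z where z: "z \<in> pre Y" "y = \<phi> z" using img_pre[OF subgroup.subset[OF Y(1)]] by blast
      have zH: "z \<in> H" "n \<in> H" using z yn sub N by blast+
      have "x \<otimes> inv (z \<otimes> n) \<in> M"
        using yn z \<phi>eq[OF x sgp_mult[OF Hs zH]] mult[OF zH] by simp
      moreover have "x = (x \<otimes> inv (z \<otimes> n)) \<otimes> (z \<otimes> n)" using x zH Hc by (auto simp: grp_simps subset_iff)
      moreover have "z \<in> pre Y <#> N" "n \<in> pre Y <#> N" "M \<subseteq> pre Y <#> N" using z yn PN M by blast+
      ultimately show "x \<in> pre Y <#> N" using sgp_mult[OF PN(2)] by (metis subsetD)
    qed
    moreover have "pre Y <#> N \<subseteq> H" by (rule set_mult_least[OF Hs sub N(2)])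
    ultimately have "pre Y <#> N = H <#> N" using mult_NN_absorb[OF Hs N] by blast
    then have "pre Y = H" using ng open_sgp_closed_sgps[OF po] sub by blast
    then show ?thesis using img_pre[OF subgroup.subset[OF Y(1)]] car by simp
  qed
  then obtain Q' n where Q': "Q' \<lhd> \<Gamma>" "Q' \<subseteq> \<phi> ` N" "\<not> p dvd card Q'" "card (\<phi> ` N) = card Q' * p ^ n"
    using Q.nongenerating_p_complement[OF fin Nn p] by blast
  have Q's: "subgroup Q' \<Gamma>" using Q' normal_imp_subgroup by blast
  define Q0 where "Q0 = pre Q'"
  note Q0 = pre_subgroup[OF Q's, folded Q0_def] M_pre[OF Q's, folded Q0_def]
  have "Q0 \<subseteq> N"
  proof
    fix x assume x: "x \<in> Q0"
    then have xH: "x \<in> H" "\<phi> x \<in> \<phi> ` N" using Q' by (auto simp: Q0_def pre_def)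
    then obtain y where y: "y \<in> N" "\<phi> x = \<phi> y" by blast
    then have "x \<otimes> inv y \<in> N" using \<phi>eq[OF xH(1)] N M by blast
    then have "(x \<otimes> inv y) \<otimes> y \<in> N" using y sgp_mult[OF Ns] by blast
    then show "x \<in> N" using xH y Hc N(2) by (auto simp: grp_simps subset_iff)
  qed
  moreover have "H \<subseteq> normalizing Q0"
  proof (rule subset_normalizingI[OF Hs])
    fix x q assume x: "x \<in> H" and q: "q \<in> Q0"
    then have qH: "q \<in> H" "\<phi> q \<in> Q'" by (auto simp: Q0_def pre_def)
    have "\<phi> (x \<otimes> q \<otimes> inv x) = \<phi> x \<otimes>\<^bsub>\<Gamma>\<^esub> \<phi> q \<otimes>\<^bsub>\<Gamma>\<^esub> inv\<^bsub>\<Gamma>\<^esub> \<phi> x"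
      using x qH mult inv sgp_mult[OF Hs] sgp_inv[OF Hs] by simp
    also have "\<dots> \<in> Q'" using normal.inv_op_closed2[OF Q'(1)] qH x car by blast
    finally show "x \<otimes> q \<otimes> inv x \<in> Q0"
      using x qH sgp_mult[OF Hs] sgp_inv[OF Hs] by (simp add: Q0_def pre_def)
  qed
  moreover have iQ: "rel_index Q0 M = card Q'"
    unfolding rel_index_def Q0_def using img_pre[OF subgroup.subset[OF Q's]] by (simp add: \<phi>_def[abs_def])
  moreover have "rel_index N Q0 = p ^ n"
  proof -
    have "rel_index N M = rel_index N Q0 * rel_index Q0 M"
      by (rule rel_index_tower'[OF Ns Q0(1) Ms Q0(2) _ open_sgp_finite'[OF NN_open_sgp[OF M(1)] Ns]]) fact
    moreover have "rel_index N M = card (\<phi> ` N)" by (simp add: rel_index_def \<phi>_def[abs_def])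
    moreover have "card Q' > 0"
      using iQ rel_index_open_sgp_pos[OF NN_open_sgp[OF M(1)] Q0(1)] by simp
    ultimately show ?thesis using iQ Q'(4) by simp
  qed
  ultimately show ?thesis using that[of Q0 n] Q0 Q'(3) by simp
qed

text \<open>\<open>Q\<close> below is the normal \<open>p\<close>-complement of \<open>N0\<close> modulo \<open>M\<close>: as \<open>K\<close> supplements it in
  \<open>K <#> N0\<close>, so does every \<open>L\<close> near \<open>K\<close>, and the order of \<open>Q\<close> is prime to \<open>p\<close>.\<close>

lemma near_infinite_primes_subset:
  assumes s: "scattered_at K N"
  obtains N3 where "N3 \<in> NN" "\<And>L. L \<in> sgp_nbh K N3 \<Longrightarrow> infinite_primes L \<subseteq> infinite_primes K"
proof -
  note K = scattered_atD[OF s]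
  obtain F g where F: "procyclic_over K F g" "F \<in> sgp_nbh K N" "open_sgp F" using scattered_at_procyclic_over[OF s] .
  obtain N1 where N1: "N1 \<in> NN" "N1 \<subseteq> N" and good:
    "\<And>p U. prime p \<Longrightarrow> p \<notin> infinite_primes K \<Longrightarrow> open_sgp U \<Longrightarrow> K \<subseteq> U \<Longrightarrow> U \<subseteq> K <#> N1 \<Longrightarrow> \<not> p dvd rel_index (K <#> N1) U"
    using good_sgp_nbh[OF s F K(2)] by metis
  have near: "scattered_at (K <#> N') N" if N': "N' \<in> NN" "N' \<subseteq> N" for N'
  proof -
    note KN' = mult_NN[OF K(3) N'(1)]
    have "K <#> N' \<in> sgp_nbh K N"
      by (rule sgp_nbh_memI[OF open_sgp_closed_sgps[OF KN'(1)] K(1,2)])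
        (use KN'(3) mult_NN_mono[OF N'(2) order_refl] mult_NN(3)[OF KN'(2) K(2)] in blast)+
    then show ?thesis using scattered_at_sgp_nbh[OF s] K by blast
  qed
  \<comment> \<open>Three levels over \<open>K\<close>: in \<open>H\<close> the indices over
    \<open>K\<close> are controlled by \<open>good\<close>; \<open>N0\<close> is nongenerating in
    \<open>H\<close> and supplies the \<open>p\<close>-complements; \<open>N3\<close> is
    nongenerating in \<open>H0\<close> and says how near \<open>L\<close> must be.\<close>
  define H where "H = K <#> N1"
  note H = mult_NN[OF K(3) N1(1), folded H_def]
  obtain N0 where N0: "N0 \<in> NN" "N0 \<subseteq> N1" and
    ngH: "\<And>L. L \<in> closed_sgps \<Longrightarrow> L \<subseteq> H \<Longrightarrow> L <#> N0 = H <#> N0 \<Longrightarrow> L = H"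
    using scattered_at_isolated_below[OF near[OF N1] N1(1)] unfolding H_def by metis
  define H0 where "H0 = K <#> N0"
  note H0 = mult_NN[OF K(3) N0(1), folded H0_def]
  have H0H: "H0 \<subseteq> H" unfolding H0_def H_def by (rule mult_NN_mono[OF N0(2) order_refl])
  obtain N3 where N3: "N3 \<in> NN" "N3 \<subseteq> N0" and
    ngH0: "\<And>L. L \<in> closed_sgps \<Longrightarrow> L \<subseteq> H0 \<Longrightarrow> L <#> N3 = H0 <#> N3 \<Longrightarrow> L = H0"
    using scattered_at_isolated_below[OF near[OF N0(1)] N0(1)] N0(2) N1(2) unfolding H0_def by (metis order_trans)
  have "p \<in> infinite_primes K" if L: "L \<in> sgp_nbh K N3" and pL: "p \<in> infinite_primes L" for L p
  proof (rule ccontr)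
    assume pK: "p \<notin> infinite_primes K"
    have p: "prime p" "infinite_p_index p (carrier G) L" using pL by (auto simp: infinite_primes_def)
    have Lc: "L \<in> closed_sgps" "L <#> N3 = K <#> N3" using L by (auto simp: sgp_nbh_def)
    have Ls: "subgroup L G" using Lc closed_sgps_subgroup by blast
    have LH0: "L \<subseteq> H0"
      using mult_NN(3)[OF Ls N3(1)] Lc mult_NN_mono[OF N3(2) order_refl, of K] unfolding H0_def by blast
    have "infinite_p_index p H0 L" by (rule infinite_p_index_open[OF p Ls H0(1) LH0])
    \<comment> \<open>\<open>M\<close> witnesses that \<open>p\<close> divides the index of
      \<open>L\<close> in \<open>H0\<close>; this index will be moved to \<open>Q\<close>, where it
      divides \<open>rel_index Q M\<close>.\<close>
    then obtain M where M: "M \<in> NN" "M \<subseteq> N3" "p ^ 1 dvd rel_index H0 (L <#> M)"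
      using infinite_p_indexE[OF _ H0(2) Ls N3(1)] by metis
    note LM = mult_NN[OF Ls M(1)]
    have N0H: "N0 \<subseteq> H" using H0H H0 by blast
    have MN0: "M \<subseteq> N0" using M(2) N3(2) by blast
    have "\<forall>L\<in>closed_sgps. L \<subseteq> H \<longrightarrow> L <#> N0 = H <#> N0 \<longrightarrow> L = H" using ngH by blast
    then obtain Q n where Q: "subgroup Q G" "M \<subseteq> Q" "Q \<subseteq> N0" "H \<subseteq> normalizing Q" "\<not> p dvd rel_index Q M" "rel_index N0 Q = p ^ n"
      by (rule nongenerating_open_p_complement[OF H(1) N0(1) N0H M(1) MN0 p(1)])
    have Qo: "open_sgp Q" using Q M by (auto simp: open_sgp_def)
    have KQn: "K \<subseteq> normalizing Q" using H(3) Q(4) by blast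
    note QK = normalizing_set_mult_subgroup[OF Q(1) K(3) KQn]
    have QKo: "open_sgp (Q <#> K)" using open_sgp_mono[OF Qo] QK by blast
    have QKH0: "Q <#> K \<subseteq> H0" by (rule set_mult_least[OF H0(2)]) (use Q H0 in blast)+
    \<comment> \<open>The index of \<open>Q <#> K\<close> in \<open>H0\<close> equals the one seen
      from \<open>N0\<close>, which divides a power of \<open>p\<close> since \<open>Q\<close> lies
      below; by \<open>good\<close> it is prime to \<open>p\<close>, so it is 1.\<close>
    have N0QK: "N0 \<subseteq> Q <#> K"
    proof (rule rel_index_eq_1D[OF _ NN_subgroup[OF N0(1)] QK(1)])
      have N0s: "subgroup N0 G" using N0 NN_subgroup by blast
      have "rel_index H0 (Q <#> K) = rel_index N0 (Q <#> K)"
        by (rule rel_index_set_mult_left[where K = K]) (use QK H0 N0 NN_carrier H0_def in auto)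
      moreover have "rel_index H (Q <#> K) = rel_index H H0 * rel_index H0 (Q <#> K)"
        by (rule rel_index_tower'[OF H(2) H0(2) QK(1) QKH0 H0H open_sgp_finite'[OF QKo H(2)]])
      moreover have "\<not> p dvd rel_index H (Q <#> K)"
        using good[OF p(1) pK QKo QK(4)] QKH0 H0H unfolding H_def by blast
      moreover have "rel_index N0 (Q <#> K) dvd p ^ n"
        using rel_index_open_sgp_dvd[OF N0s Qo QK(3,1)] Q(6) by simp
      ultimately show "rel_index N0 (Q <#> K) = 1"
        using divides_primepow_nat[OF p(1)] by (metis dvd_mult dvd_power neq0_conv power_0)
    qed
    have LQn: "L \<subseteq> normalizing Q" using LH0 H0H Q(4) by blast
    note QL = normalizing_set_mult_subgroup[OF Q(1) Ls LQn]
    have QLo: "open_sgp (Q <#> L)" using open_sgp_mono[OF Qo] QL by blast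
    have QLH0: "Q <#> L \<subseteq> H0" by (rule set_mult_least[OF H0(2)]) (use Q H0 LH0 in blast)+
    note QLN = mult_NN[OF QL(1) N3(1)]
    \<comment> \<open>\<open>L\<close> and \<open>K\<close> agree modulo \<open>N3\<close>, so
      \<open>Q <#> L\<close> fills \<open>H0\<close> modulo \<open>N3\<close>, and
      \<open>ngH0\<close> removes the modulus.\<close>
    have "L <#> N3 \<subseteq> Q <#> L <#> N3" by (rule set_mult_least[OF QLN(2)]) (use QL QLN in blast)+
    then have "K \<subseteq> Q <#> L <#> N3" using mult_NN(3)[OF K(3) N3(1)] Lc(2) by blast
    then have "Q <#> K \<subseteq> Q <#> L <#> N3" using set_mult_least[OF QLN(2)] QL QLN by blast
    moreover have "H0 \<subseteq> Q <#> K" unfolding H0_def by (rule set_mult_least[OF QK(1) QK(4) N0QK])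
    ultimately have "Q <#> L <#> N3 = H0 <#> N3"
      using eq_mult_NN_iff[OF QL(1) H0(2) N3(1)] QLH0 mult_NN(3)[OF H0(2) N3(1)] by blast
    then have eq: "Q <#> L = H0" using ngH0 open_sgp_closed_sgps[OF QLo] QLH0 by blast
    have "rel_index H0 (L <#> M) = rel_index Q (L <#> M)"
    proof (rule rel_index_set_mult_left[where K = L])
      show "H0 \<subseteq> L <#> Q" using eq QL(2) by simp
    qed (use LM sgp_sub Q eq QL in auto)
    moreover have "rel_index Q (L <#> M) dvd rel_index Q M"
      by (rule rel_index_open_sgp_dvd[OF Q(1) NN_open_sgp[OF M(1)] LM(4,2)])
    ultimately show False using Q(5) M(3) dvd_trans by auto
  qed
  then show ?thesis using that N3 by blast
qed

end

section \<open>Neighbours lose a prime of infinite index\<close>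

text \<open>Compactness in the form needed for intersections: as \<open>M'\<close> shrinks,
  \<open>A \<inter> (B <#> M')\<close> decreases to \<open>A \<inter> B\<close>, so at some point it
  falls into the open subgroup \<open>(A \<inter> B) <#> M\<close>.\<close>

locale compact_normal_base = normal_base +
  assumes compact: "A \<in> closed_sgps \<Longrightarrow> B \<in> closed_sgps \<Longrightarrow> M \<in> NN \<Longrightarrow> \<exists>M'\<in>NN. A \<inter> (B <#> M') \<subseteq> (A \<inter> B) <#> M"
begin

text \<open>The quotient of \<open>L\<close> by \<open>L \<inter> K\<close> sits in the procyclic
  \<open>F / K\<close>, so \<open>L\<close> is cyclic modulo the open \<open>P\<close>. Compactness
  chooses \<open>P\<close> so that its trace on \<open>L\<close> lies in \<open>L \<inter> K\<close>
  modulo \<open>M4\<close>; the isolating \<open>M4\<close> then turns a generator in a finite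
  quotient into a topological one.\<close>

lemma scattered_at_generator_mod:
  assumes F: "procyclic_over K F g" and K: "K \<in> closed_sgps" and s: "scattered_at L N" and L: "L \<subseteq> F"
  obtains l where "l \<in> L" "closed_gen (insert l (L \<inter> K)) = L"
proof -
  note Ls = scattered_atD[OF s]
  have Fs: "subgroup F G" "g \<in> F" "F \<subseteq> normalizing K" "subgroup K G" using F by (auto simp: procyclic_over_def)
  have gc: "g \<in> carrier G" using Fs sgp_mem by blast
  have I: "L \<inter> K \<in> closed_sgps" using closed_sgps_Int Ls K by blast
  obtain M4 where M4: "M4 \<in> NN" and iso: "\<And>R. R \<in> closed_sgps \<Longrightarrow> R \<subseteq> L \<Longrightarrow> R <#> M4 = L <#> M4 \<Longrightarrow> R = L"
    using scattered_at_isolated_below[OF s Ls(2)] by metis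
  obtain M5 where M5: "M5 \<in> NN" "L \<inter> (K <#> M5) \<subseteq> (L \<inter> K) <#> M4" using compact[OF Ls(1) K M4] by blast
  define P where "P = K <#> M5"
  note P = mult_NN[OF Fs(4) M5(1), folded P_def]
  have nrmP: "normalizing K \<subseteq> normalizing P"
    unfolding P_def using normalizing_set_mult[OF Fs(4) NN_subgroup[OF M5(1)]] NN_normalizing[OF M5(1)] normalizing_carrier by blast
  have LP: "L \<subseteq> normalizing P" using L Fs nrmP by blast
  note T = normalizing_set_mult_subgroup[OF P(2) Ls(3) LP]
  have To: "open_sgp (P <#> L)" using open_sgp_mono[OF P(1)] T by blast
  have KT: "K \<subseteq> P <#> L" using P T by blast
  \<comment> \<open>\<open>d\<close> is the order of \<open>g\<close> modulo \<open>P <#> L\<close>,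
    so the powers of \<open>g\<close> in \<open>P <#> L\<close> are those of \<open>g [^] d\<close>;
    its factor \<open>l\<close> in \<open>L\<close> generates \<open>L\<close> modulo
    \<open>P\<close>.\<close>
  define d where "d = int (rel_index F (P <#> L))"
  have "g [^] d \<in> P <#> L" using procyclic_over_index[OF F To KT] by (simp add: d_def)
  then obtain c l where cl: "c \<in> P" "l \<in> L" "g [^] d = c \<otimes> l" by (auto simp: set_mult_def)
  have lc: "l \<in> carrier G" using cl Ls sgp_mem by blast
  define R where "R = closed_gen (insert l (L \<inter> K))"
  have Rc: "R \<in> closed_sgps" unfolding R_def by (rule closed_gen_closed_sgps) (use lc sgp_sub[OF Ls(3)] in auto)
  have Rs: "subgroup R G" using Rc closed_sgps_subgroup by blast
  have RL: "R \<subseteq> L" unfolding R_def by (rule closed_gen_least[OF Ls(1)]) (use cl in auto)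
  have lR: "l \<in> R" "L \<inter> K \<subseteq> R" unfolding R_def using closed_gen_subset[of "insert l (L \<inter> K)"] by auto
  note RM = mult_NN[OF Rs M4]
  let ?P = "range (\<lambda>i::int. l [^] i)"
  have Pw: "subgroup ?P G" by (rule int_pow_range_subgroup[OF lc])
  have "?P \<subseteq> normalizing P" using int_pow_in_subgroup[OF Ls(3) cl(2)] LP by blast
  note W = normalizing_set_mult_subgroup[OF P(2) Pw this]
  have "l = l [^] (1::int)" using lc by simp
  then have "l \<in> ?P" by (rule range_eqI)
  then have gW: "g [^] d \<in> P <#> ?P" unfolding cl(3) using W(3,4) cl(1) sgp_mult[OF W(1)] by blast
  have "L \<subseteq> R <#> M4"
  proof
    fix y assume y: "y \<in> L"
    obtain i :: int and c' where ic: "c' \<in> P" "y = c' \<otimes> g [^] i"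
      using F M5(1) y L unfolding procyclic_over_def P_def by (meson subsetD)
    have cc: "c' \<in> carrier G" using ic P sgp_mem by blast
    have "g [^] i = inv c' \<otimes> y" using ic cc gc by (simp add: grp_simps)
    moreover have "inv c' \<in> P <#> L" "y \<in> P <#> L" using ic T y sgp_inv[OF P(2)] by blast+
    ultimately have "g [^] i \<in> P <#> L" using sgp_mult[OF T(1)] by simp
    then have "d dvd i" using procyclic_over_index[OF F To KT] by (simp add: d_def)
    then obtain j where "i = d * j" by blast
    then have "g [^] i = (g [^] d) [^] j" using gc by (simp add: int_pow_pow)
    then have "g [^] i \<in> P <#> ?P" using int_pow_in_subgroup[OF W(1) gW] by simp
    then have "y \<in> P <#> ?P" using ic W(3) sgp_mult[OF W(1)] by blast
    then obtain e and k :: int where ek: "e \<in> P" "y = e \<otimes> l [^] k" by (auto simp: set_mult_def)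
    have lk: "l [^] k \<in> R" "l [^] k \<in> L" using int_pow_in_subgroup Rs lR(1) Ls(3) cl(2) by blast+
    have ec: "e \<in> carrier G" using ek P sgp_mem by blast
    have "e = y \<otimes> inv (l [^] k)" using ek ec lc by (simp add: grp_simps)
    then have "e \<in> L" using y lk sgp_mult[OF Ls(3)] sgp_inv[OF Ls(3)] by simp
    then have "e \<in> (L \<inter> K) <#> M4" using ek M5(2) unfolding P_def by blast
    moreover have "(L \<inter> K) <#> M4 \<subseteq> R <#> M4" by (rule mult_NN_mono[OF order_refl lR(2)])
    ultimately show "y \<in> R <#> M4" using ek lk RM sgp_mult[OF RM(2)] by blast
  qed
  then have "R <#> M4 = L <#> M4"
    using eq_mult_NN_iff[OF Rs Ls(3) M4] RL mult_NN(3)[OF Ls(3) M4] by blast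
  then have "R = L" using iso Rc RL by blast
  then show ?thesis using that cl(2) unfolding R_def by blast
qed

text \<open>Let \<open>p\<close> divide the order of \<open>LK / K\<close>. If \<open>p\<close> had infinite exponent in the indices of both \<open>K\<close>
  and \<open>L\<close>, then an isolated member of the family of closed subgroups generated by \<open>I = L \<inter> K\<close> and
  \<open>l \<otimes> x\<close>, for \<open>x\<close> in \<open>K\<close> close to \<open>\<one>\<close>, would be procyclic over \<open>I\<close> and contain an open
  subgroup of \<open>K\<close>; this contradicts the bound on the \<open>p\<close>-part of a procyclic group.\<close>

lemma near_infinite_primes_ne:
  assumes s: "scattered_at K N"
  obtains N1 where "N1 \<in> NN" "\<And>L. L \<in> sgp_nbh K N1 \<Longrightarrow> L \<noteq> K \<Longrightarrow> \<exists>p\<in>infinite_primes K. p \<notin> infinite_primes L"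
proof -
  note K = scattered_atD[OF s]
  obtain F g where F: "procyclic_over K F g" "F \<in> sgp_nbh K N" "open_sgp F" using scattered_at_procyclic_over[OF s] .
  have Fs: "subgroup F G" "K \<subseteq> F" "F \<subseteq> normalizing K" "g \<in> F" using F by (auto simp: procyclic_over_def)
  have FF: "F \<in> closed_sgps" using F open_sgp_closed_sgps by blast
  \<comment> \<open>No proper closed subgroup of \<open>K\<close> is this close to \<open>K\<close>,
    so a neighbour other than \<open>K\<close> has elements outside \<open>K\<close>.\<close>
  obtain N4 where N4: "N4 \<in> NN" "N4 \<subseteq> N" and
    iso: "\<And>L. L \<in> closed_sgps \<Longrightarrow> L \<subseteq> K \<Longrightarrow> L <#> N4 = K <#> N4 \<Longrightarrow> L = K"
    using scattered_at_isolated_below[OF s K(2)] by metis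
  obtain N1 where N1: "N1 \<in> NN" "N1 \<subseteq> N4" "K <#> N1 \<subseteq> F" and good:
    "\<And>p U. prime p \<Longrightarrow> p \<notin> infinite_primes K \<Longrightarrow> open_sgp U \<Longrightarrow> K \<subseteq> U \<Longrightarrow> U \<subseteq> K <#> N1 \<Longrightarrow> \<not> p dvd rel_index (K <#> N1) U"
    using good_sgp_nbh[OF s F N4(1)] by metis
  note KN = mult_NN[OF K(3) N1(1)]
  have nrmK: "F \<subseteq> normalizing (K <#> M)" if "M \<in> NN" for M
    using normalizing_set_mult[OF K(3) NN_subgroup[OF that]] Fs NN_normalizing[OF that] sgp_sub by blast
  have "\<exists>p\<in>infinite_primes K. p \<notin> infinite_primes L" if L: "L \<in> sgp_nbh K N1" and ne: "L \<noteq> K" for L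
  proof -
    have Lc: "L \<in> closed_sgps" "L <#> N1 = K <#> N1" using L by (auto simp: sgp_nbh_def)
    have Ls: "subgroup L G" using Lc closed_sgps_subgroup by blast
    have LKN: "L \<subseteq> K <#> N1" using Lc mult_NN(3)[OF Ls N1(1)] by blast
    have LF: "L \<subseteq> F" using LKN N1 by blast
    have LK: "L \<subseteq> normalizing K" using LF Fs by blast
    have "\<not> L \<subseteq> K"
    proof
      assume "L \<subseteq> K"
      then have "L = K" using iso Lc(1) eq_mult_NN_mono[OF Ls K(3) N1(1) N4(1) N1(2) Lc(2)] by blast
      then show False using ne by blast
    qed
    then obtain x M where xM: "x \<in> L" "M \<in> NN" "x \<notin> K <#> M"
      using closed_sgpsD[OF K(1)] sgp_mem[OF Ls] by blast
    define U where "U = K <#> (M \<inter> N1)"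
    have MN: "M \<inter> N1 \<in> NN" using NN_Int xM N1 by blast
    note U = mult_NN[OF K(3) MN, folded U_def]
    have UKN: "U \<subseteq> K <#> N1" unfolding U_def by (rule mult_NN_mono) auto
    have "x \<notin> U" using xM mult_NN_mono[of "M \<inter> N1" M K K] unfolding U_def by blast
    then have "rel_index L U \<noteq> 1" using rel_index_eq_1D[OF _ Ls U(2)] xM by blast
    \<comment> \<open>\<open>p\<close> divides the order of the image of \<open>L\<close> in the
      finite quotient of \<open>F\<close> by \<open>U\<close>. It is in
      \<open>infinite_primes K\<close> because \<open>N1\<close> admits no other primes.\<close>
    then obtain p where p: "prime p" "p dvd rel_index L U" using prime_factor_nat by blast
    have "p \<in> infinite_primes K"
    proof (rule ccontr)
      assume "p \<notin> infinite_primes K"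
      then have "\<not> p dvd rel_index (K <#> N1) U" using good p U UKN by blast
      moreover have "rel_index L U dvd rel_index (K <#> N1) U"
        by (rule rel_index_dvd_normal[OF Ls KN(2) U(2) LKN _ open_sgp_finite'[OF U(1) KN(2)]])
          (use nrmK[OF MN] N1(3) U_def in blast)
      ultimately show False using p dvd_trans by blast
    qed
    moreover have "p \<notin> infinite_primes L"
    proof
      assume "p \<in> infinite_primes L"
      then have infL: "infinite_p_index p (carrier G) L" by (simp add: infinite_primes_def)
      have infK: "infinite_p_index p F K"
        using infinite_p_index_open[OF p(1) _ K(3) F(3) Fs(2)] \<open>p \<in> infinite_primes K\<close> by (simp add: infinite_primes_def)
      note KL = normalizing_set_mult_subgroup[OF K(3) Ls LK]
      have KLF: "K <#> L \<subseteq> F" by (rule set_mult_least[OF Fs(1,2) LF])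
      have indKL: "rel_index (K <#> L) V = rel_index L V" if "open_sgp V" "K \<subseteq> V" for V
        by (rule rel_index_set_mult_left[where K = K]) (use that open_sgp_subgroup KL sgp_sub[OF Ls] in auto)
      \<comment> \<open>In the procyclic \<open>F\<close> over \<open>K\<close> the subgroup
        \<open>K <#> L\<close> is nontrivial at \<open>p\<close>, so its own index has bounded
        exponent at \<open>p\<close>. The bound \<open>t\<close> is used twice below.\<close>
      have "\<not> infinite_p_index p F (K <#> L)"
        using procyclic_over_infinite_p_index[OF F(1) KL(1,3) KLF p(1) _ U(1,3)] indKL[OF U(1,3)] p(2) by auto
      then obtain t where t: "\<And>V. open_sgp V \<Longrightarrow> K <#> L \<subseteq> V \<Longrightarrow> \<not> p ^ t dvd rel_index F V"
        unfolding infinite_p_index_def by blast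
      have "L \<in> sgp_nbh K N" using L sgp_nbh_mono[OF K(1,2) N1(1)] N1 N4 by blast
      have sL: "scattered_at L N1" by (rule scattered_at_sgp_nbh[OF s \<open>L \<in> sgp_nbh K N\<close> N1(1)]) (use N1 N4 in blast)
      obtain E h where E: "procyclic_over L E h" "E \<in> sgp_nbh L N1" "open_sgp E" using scattered_at_procyclic_over[OF sL] .
      have Es: "subgroup E G" "L \<subseteq> E" "E \<subseteq> normalizing L" using E by (auto simp: procyclic_over_def)
      define I where "I = L \<inter> K"
      have I: "I \<in> closed_sgps" unfolding I_def using closed_sgps_Int Lc K by blast
      have Ic: "I \<subseteq> carrier G" using I closed_sgps_subgroup sgp_sub by blast
      obtain l where l: "l \<in> L" "closed_gen (insert l I) = L"
        using scattered_at_generator_mod[OF F(1) K(1) sL LF] unfolding I_def .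
      have lc: "l \<in> carrier G" using l Ls sgp_mem by blast
      \<comment> \<open>Elements of \<open>D\<close> normalize \<open>L\<close> through
        \<open>E\<close>, belong to \<open>K\<close>, and are small enough to keep
        \<open>R x\<close> near \<open>L\<close>.\<close>
      define D where "D = K \<inter> E \<inter> N1"
      have Ds: "subgroup D G" unfolding D_def
        using subgroups_Inter_pair K(3) Es(1) NN_subgroup[OF N1(1)] by blast
      have Dc: "D \<subseteq> carrier G" using Ds sgp_sub by blast
      define R where "R x = closed_gen (insert (l \<otimes> x) I)" for x
      have Rclo: "R x \<in> closed_sgps" if "x \<in> D" for x
        unfolding R_def by (rule closed_gen_closed_sgps) (use that lc Ic Dc in auto)
      have "R x <#> N1 = K <#> N1" if "x \<in> D" for x
        unfolding R_def using closed_gen_insert_near_eq[OF Ic lc _ N1(1), of x] that l(2) Lc(2) by (simp add: D_def)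
      then have "R ` D \<subseteq> sgp_nbh L N1" using Rclo Lc(2) by (auto simp: sgp_nbh_def)
      moreover have "R ` D \<noteq> {}" using sgp_one[OF Ds] by blast
      moreover obtain ME where ME: "ME \<in> NN" "ME \<subseteq> E \<inter> F" using open_sgp_Int[OF E(3) F(3)] by (auto simp: open_sgp_def)
      moreover have MEN: "ME \<inter> N1 \<in> NN" using NN_Int ME N1 by blast
      ultimately obtain Y M6 where Y: "Y \<in> R ` D" "M6 \<in> NN" "M6 \<subseteq> ME \<inter> N1"
        and Yiso: "\<And>L'. L' \<in> R ` D \<Longrightarrow> L' <#> M6 = Y <#> M6 \<Longrightarrow> L' = Y"
        using scattered_at_isolated[OF sL] by metis
      obtain x where x: "x \<in> D" "Y = R x" using Y by blast
      have xc: "x \<in> carrier G" using x Dc by blast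
      have Ys: "subgroup Y G" using x Rclo closed_sgps_subgroup by blast
      define r where "r = l \<otimes> x"
      have rY: "r \<in> Y" "I \<subseteq> Y" unfolding x R_def r_def using closed_gen_subset[of "insert (l \<otimes> x) I"] by auto
      \<comment> \<open>Moving \<open>x\<close> by an element of \<open>K \<inter> M6\<close> stays
        in \<open>D\<close> and does not change \<open>R x\<close> modulo \<open>M6\<close>, so
        isolation puts this element into \<open>Y\<close>: the subgroup \<open>Y \<inter> K\<close>
        is open in \<open>K\<close>.\<close>
      have M6Y: "K \<inter> M6 \<subseteq> Y"
      proof
        fix m assume m: "m \<in> K \<inter> M6"
        have mc: "m \<in> carrier G" using m NN_carrier Y by blast
        have xm: "x \<otimes> m \<in> D" using sgp_mult[OF Ds x(1)] m Y ME by (auto simp: D_def)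
        have "R (x \<otimes> m) <#> M6 = Y <#> M6"
          using closed_gen_insert_near_eq[OF Ic _ _ Y(2), of "l \<otimes> x" m] m lc xc mc by (simp add: R_def x m_assoc)
        then have "R (x \<otimes> m) = Y" using Yiso xm by blast
        then have "l \<otimes> (x \<otimes> m) \<in> Y" unfolding R_def using closed_gen_subset by blast
        then have "inv r \<otimes> (l \<otimes> (x \<otimes> m)) \<in> Y" using sgp_mult[OF Ys] sgp_inv[OF Ys] rY by blast
        then show "m \<in> Y" unfolding r_def using lc xc mc by (simp add: grp_simps)
      qed
      have xN: "x \<in> normalizing L" "x \<in> normalizing K" "x \<in> K" "x \<in> F"
        using x Es Fs by (auto simp: D_def)
      have "l \<in> normalizing L" "l \<in> normalizing K" using l subset_normalizing_self[OF Ls] LK by blast+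
      then have "r \<in> normalizing L" "r \<in> normalizing K" unfolding r_def using xN normalizing_subgroup Ls K(3) sgp_mult by blast+
      then have rI: "r \<in> normalizing I" unfolding I_def by (rule normalizing_Int)
      have pY: "procyclic_over I Y r" unfolding x R_def r_def by (rule procyclic_over_closed_gen[OF I rI[unfolded r_def]])
      have YF: "Y \<subseteq> F" unfolding x R_def
        by (rule closed_gen_least[OF FF]) (use l LF xN sgp_mult[OF Fs(1)] I_def in auto)
      define A where "A = Y \<inter> K"
      have As: "subgroup A G" unfolding A_def using subgroups_Inter_pair Ys K(3) by blast
      have IA: "I \<subseteq> A" unfolding A_def using rY I_def by blast
      \<comment> \<open>As \<open>x\<close> lies in \<open>K\<close>, replacing \<open>l\<close> by
        \<open>l \<otimes> x\<close> does not change the product with \<open>V = K <#> M\<close>, so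
        \<open>rel_index Y V\<close> is the index of \<open>V\<close> in \<open>V <#> L\<close>. The
        other factor of \<open>rel_index F V\<close> is bounded by \<open>t\<close>, so this one
        grows with the index of \<open>K\<close>.\<close>
      have infY: "infinite_p_index p Y A"
        unfolding infinite_p_index_def
      proof
        fix n
        obtain M where M: "M \<in> NN" "M \<subseteq> ME" "p ^ (t + n) dvd rel_index F (K <#> M)"
          using infinite_p_indexE[OF infK Fs(1) K(3) ME(1)] .
        define V where "V = K <#> M"
        note V = mult_NN[OF K(3) M(1), folded V_def]
        have nV: "F \<subseteq> normalizing V" unfolding V_def by (rule nrmK[OF M(1)])
        have LV: "L \<subseteq> normalizing V" using nV LF by blast
        have YV: "Y \<subseteq> normalizing V" using nV YF by blast
        note VL = normalizing_set_mult_subgroup[OF V(2) Ls LV]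
        note VY = normalizing_set_mult_subgroup[OF V(2) Ys YV]
        have VLo: "open_sgp (V <#> L)" using open_sgp_mono[OF V(1)] VL by blast
        have VYo: "open_sgp (V <#> Y)" using open_sgp_mono[OF V(1)] VY by blast
        have VF: "V \<subseteq> F" unfolding V_def by (rule set_mult_least[OF Fs(1,2)]) (use M ME in blast)
        have "l \<in> V <#> L" "x \<in> V <#> L" "I \<subseteq> V <#> L" using l xN V VL I_def by blast+
        then have "insert (l \<otimes> x) I \<subseteq> V <#> L" using sgp_mult[OF VL(1)] by blast
        then have YVL: "Y \<subseteq> V <#> L" unfolding x R_def using closed_gen_least open_sgp_closed_sgps[OF VLo] by blast
        have "l = r \<otimes> inv x" unfolding r_def using lc xc by (simp add: grp_simps)
        moreover have "r \<in> V <#> Y" "inv x \<in> V <#> Y" using rY VY V xN sgp_inv[OF K(3)] by blast+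
        ultimately have "insert l I \<subseteq> V <#> Y" using sgp_mult[OF VY(1)] rY VY by auto
        then have LVY: "L \<subseteq> V <#> Y" using closed_gen_least open_sgp_closed_sgps[OF VYo] l(2) by blast
        have "V <#> L \<subseteq> V <#> Y" by (rule set_mult_least[OF VY(1) VY(3) LVY])
        moreover have "V <#> Y \<subseteq> V <#> L" by (rule set_mult_least[OF VL(1) VL(3) YVL])
        ultimately have eq: "V <#> L = V <#> Y" by blast
        have i1: "rel_index (V <#> Y) V = rel_index Y V"
          by (rule rel_index_set_mult_left[where K = V]) (use V VY sgp_sub[OF Ys] in auto)
        have "V <#> L \<subseteq> F" by (rule set_mult_least[OF Fs(1) VF LF])
        then have "rel_index F V = rel_index F (V <#> L) * rel_index (V <#> L) V"
          by (rule rel_index_tower'[OF Fs(1) VL(1) V(2) VL(3) _ open_sgp_finite'[OF V(1) Fs(1)]])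
        then have e: "rel_index F V = rel_index F (V <#> L) * rel_index Y V" using i1 eq by simp
        have "K <#> L \<subseteq> V <#> L" by (rule mult_NN_mono[OF order_refl V(3)])
        then have "\<not> p ^ t dvd rel_index F (V <#> L)" using t VLo by blast
        then have "p ^ n dvd rel_index Y V"
          by (rule prime_power_dvd_cofactor'[OF p(1)]) (use M(3) e V_def in simp)
        then show "\<exists>H. open_sgp H \<and> A \<subseteq> H \<and> p ^ n dvd rel_index Y H" using V A_def by blast
      qed
      \<comment> \<open>The bound for procyclic groups, applied to \<open>Y\<close> over
        \<open>I\<close>: since the index of \<open>A\<close> in \<open>Y\<close> is infinite at
        \<open>p\<close>, nothing at \<open>p\<close> is left for \<open>A\<close> over
        \<open>I\<close>.\<close>
      have nd: "\<not> p dvd rel_index A V" if "open_sgp V" "I \<subseteq> V" for V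
        by (rule procyclic_over_infinite_p_index[OF pY As IA _ p(1) infY that]) (simp add: A_def)
      \<comment> \<open>The powers of \<open>p\<close> that may be lost between the index of
        \<open>V\<close> in \<open>G\<close> and \<open>rel_index A V\<close>: \<open>?m1\<close>
        from \<open>F\<close> in \<open>G\<close>, less than \<open>t\<close> from
        \<open>K <#> V\<close> in \<open>F\<close>, \<open>?m2\<close> from \<open>M6\<close> in
        \<open>K\<close>, and at most \<open>?m3\<close> in passing from
        \<open>K \<inter> M6\<close> to \<open>A\<close>. The last 1 remains for
        \<open>rel_index A V\<close>, against \<open>nd\<close>.\<close>
      let ?m1 = "multiplicity p (rel_index (carrier G) F)" and ?m2 = "multiplicity p (rel_index K M6)"
        and ?m3 = "multiplicity p (rel_index (carrier G) M6)"
      note M6 = NN_subgroup[OF Y(2)] NN_open_sgp[OF Y(2)]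
      obtain M where M: "M \<in> NN" "M \<subseteq> M6"
        "p ^ (?m1 + (t + (?m2 + (?m3 + 1)))) dvd rel_index (carrier G) (L <#> M)"
        using infinite_p_indexE[OF infL subgroup_self Ls Y(2)] .
      define V where "V = L <#> M"
      note V = mult_NN[OF Ls M(1), folded V_def]
      have MF: "M \<subseteq> F" using M Y ME by blast
      have VF: "V \<subseteq> F" unfolding V_def by (rule set_mult_least[OF Fs(1) LF MF])
      have VK: "V \<subseteq> normalizing K" using VF Fs by blast
      note KV = normalizing_set_mult_subgroup[OF K(3) V(2) VK]
      have KVo: "open_sgp (K <#> V)" using open_sgp_mono[OF V(1)] KV by blast
      have KVF: "K <#> V \<subseteq> F" by (rule set_mult_least[OF Fs(1,2) VF])
      have "K <#> L \<subseteq> K <#> V" by (rule mult_NN_mono[OF V(3) order_refl])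
      then have tV: "\<not> p ^ t dvd rel_index F (K <#> V)" using t KVo by blast
      have e1: "rel_index (carrier G) V = rel_index (carrier G) F * rel_index F V"
        by (rule rel_index_tower'[OF subgroup_self Fs(1) V(2) VF sgp_sub[OF Fs(1)] open_sgp_finite'[OF V(1) subgroup_self]])
      have e2: "rel_index F V = rel_index F (K <#> V) * rel_index (K <#> V) V"
        by (rule rel_index_tower'[OF Fs(1) KV(1) V(2) KV(4) KVF open_sgp_finite'[OF V(1) Fs(1)]])
      have e3: "rel_index (K <#> V) V = rel_index K V"
        by (rule rel_index_set_mult_left[where K = V]) (use V KV sgp_sub[OF K(3)] in auto)
      have VM: "open_sgp (M6 \<inter> V)" "subgroup (M6 \<inter> V) G" using open_sgp_Int[OF M6(2) V(1)] open_sgp_subgroup by blast+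
      have e4: "rel_index K V dvd rel_index K (M6 \<inter> V)" by (rule rel_index_open_sgp_dvd[OF K(3) VM(1) _ V(2)]) simp
      have e5: "rel_index K (M6 \<inter> V) = rel_index K M6 * rel_index (K \<inter> M6) (M6 \<inter> V)"
        by (rule rel_index_tower[OF K(3) M6(1) VM(2) _ open_sgp_finite'[OF VM(1) K(3)]]) simp
      \<comment> \<open>Here the openness of \<open>A\<close> in \<open>K\<close> enters: inside
        \<open>M6\<close> the two coincide.\<close>
      have KA: "K \<inter> M6 = A \<inter> M6" using M6Y A_def by blast
      have AV: "subgroup (A \<inter> V) G" using subgroups_Inter_pair As V(2) by blast
      have a1: "rel_index A (M6 \<inter> V) = rel_index A M6 * rel_index (A \<inter> M6) (M6 \<inter> V)"
        by (rule rel_index_tower[OF As M6(1) VM(2) _ open_sgp_finite'[OF VM(1) As]]) simp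
      have a2: "rel_index A (M6 \<inter> V) = rel_index A V * rel_index (A \<inter> V) (M6 \<inter> V)"
        by (rule rel_index_tower[OF As V(2) VM(2) _ open_sgp_finite'[OF VM(1) As]]) simp
      have a3: "rel_index (A \<inter> V) (M6 \<inter> V) = rel_index (A \<inter> V) M6"
        using rel_index_inter[OF M6(1) V(2), of "A \<inter> V"] by (simp add: Int_commute)
      have a4: "rel_index (A \<inter> V) M6 dvd rel_index (carrier G) M6"
        by (rule rel_index_dvd_normal[OF AV subgroup_self M6(1) sgp_sub[OF AV] _ open_sgp_finite'[OF M6(2) subgroup_self]])
          (use NN_normalizing[OF Y(2)] in simp)
      have "rel_index (A \<inter> M6) (M6 \<inter> V) dvd rel_index A (M6 \<inter> V)" unfolding a1 by (rule dvd_triv_right)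
      also have "\<dots> = rel_index (A \<inter> V) M6 * rel_index A V" unfolding a2 a3 by (rule mult.commute)
      also have "\<dots> dvd rel_index (carrier G) M6 * rel_index A V" by (rule mult_dvd_mono[OF a4 dvd_refl])
      finally have e6: "rel_index (K \<inter> M6) (M6 \<inter> V) dvd rel_index (carrier G) M6 * rel_index A V" unfolding KA .
      have "rel_index (carrier G) V = rel_index (carrier G) F * (rel_index F (K <#> V) * rel_index K V)"
        unfolding e1 e2 e3 by simp
      then have "p ^ (t + (?m2 + (?m3 + 1))) dvd rel_index F (K <#> V) * rel_index K V"
        using prime_power_dvd_cofactor[OF p(1) rel_index_open_sgp_pos[OF F(3) subgroup_self]] M(3) V_def by metis
      then have "p ^ (?m2 + (?m3 + 1)) dvd rel_index K V"
        by (rule prime_power_dvd_cofactor'[OF p(1) tV])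
      then have "p ^ (?m2 + (?m3 + 1)) dvd rel_index K M6 * rel_index (K \<inter> M6) (M6 \<inter> V)"
        using e4 e5 dvd_trans by metis
      then have "p ^ (?m3 + 1) dvd rel_index (K \<inter> M6) (M6 \<inter> V)"
        by (rule prime_power_dvd_cofactor[OF p(1) rel_index_open_sgp_pos[OF M6(2) K(3)]])
      then have "p ^ (?m3 + 1) dvd rel_index (carrier G) M6 * rel_index A V" using e6 dvd_trans by blast
      then have "p ^ 1 dvd rel_index A V"
        by (rule prime_power_dvd_cofactor[OF p(1) rel_index_open_sgp_pos[OF M6(2) subgroup_self]])
      moreover have "I \<subseteq> V" using V I_def by blast
      ultimately show False using nd[OF V(1)] by simp
    qed
    ultimately show ?thesis by blast
  qed
  then show ?thesis using that N1 by blast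
qed

section \<open>Cantor-Bendixson derivatives of families of closed subgroups\<close>

definition sgp_derivative :: "'a set set \<Rightarrow> 'a set set" where
  "sgp_derivative D = {K \<in> D. \<forall>M\<in>NN. \<exists>L\<in>D. L <#> M = K <#> M \<and> L \<noteq> K}"

lemma sgp_derivative_subset: "sgp_derivative D \<subseteq> D" by (auto simp: sgp_derivative_def)

lemma sgp_derivative_pow_antimono: "m \<le> n \<Longrightarrow> (sgp_derivative ^^ n) D \<subseteq> (sgp_derivative ^^ m) D"
proof (induction n rule: dec_induct)
  case (step n)
  then show ?case using sgp_derivative_subset[of "(sgp_derivative ^^ n) D"] by auto
qed simp

text \<open>Near \<open>K\<close> every other subgroup has fewer infinite primes and, by induction,
  has left by stage \<open>card (infinite_primes K)\<close>. At that stage \<open>K\<close> is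
  isolated or already gone, and the \<open>Suc\<close> removes it.\<close>

lemma scattered_at_notin_sgp_derivative:
  assumes "scattered_at K N" shows "K \<notin> (sgp_derivative ^^ Suc (card (infinite_primes K))) closed_sgps"
  using assms
proof (induction "card (infinite_primes K)" arbitrary: K N rule: less_induct)
  case less
  note s = less.prems
  note K = scattered_atD[OF s]
  obtain N1 where N1: "N1 \<in> NN" "\<And>L. L \<in> sgp_nbh K N1 \<Longrightarrow> L \<noteq> K \<Longrightarrow> \<exists>p\<in>infinite_primes K. p \<notin> infinite_primes L"
    using near_infinite_primes_ne[OF s] by metis
  obtain N3 where N3: "N3 \<in> NN" "\<And>L. L \<in> sgp_nbh K N3 \<Longrightarrow> infinite_primes L \<subseteq> infinite_primes K"
    using near_infinite_primes_subset[OF s] by metis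
  define N' where "N' = N \<inter> (N1 \<inter> N3)"
  have N': "N' \<in> NN" unfolding N'_def by (rule NN_Int[OF K(2) NN_Int[OF N1(1) N3(1)]])
  let ?n = "card (infinite_primes K)"
  have "L = K" if L: "L \<in> (sgp_derivative ^^ ?n) closed_sgps" "L <#> N' = K <#> N'" for L
  proof (rule ccontr)
    assume ne: "L \<noteq> K"
    have "L \<in> closed_sgps" using L(1) sgp_derivative_pow_antimono[of 0 ?n closed_sgps] by auto
    then have "L \<in> sgp_nbh K N'" using L by (simp add: sgp_nbh_def)
    then have nb: "L \<in> sgp_nbh K N" "L \<in> sgp_nbh K N1" "L \<in> sgp_nbh K N3"
      using sgp_nbh_mono[OF K(1)] N' N1 N3 K unfolding N'_def by blast+
    have "infinite_primes L \<subset> infinite_primes K" using N1(2)[OF nb(2) ne] N3(2)[OF nb(3)] by blast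
    then have lt: "card (infinite_primes L) < ?n" using finite_infinite_primes[OF s] by (simp add: psubset_card_mono)
    have "scattered_at L N" using scattered_at_sgp_nbh[OF s nb(1) K(2)] by simp
    then have "L \<notin> (sgp_derivative ^^ Suc (card (infinite_primes L))) closed_sgps" using less.hyps lt by blast
    then show False using L(1) sgp_derivative_pow_antimono[of "Suc (card (infinite_primes L))" ?n closed_sgps] lt by auto
  qed
  then show ?case using N' by (auto simp: sgp_derivative_def)
qed

text \<open>A set \<open>C\<close> near \<open>K\<close> either lies in \<open>D\<close>, and is
  then reduced to \<open>K\<close>, or loses members at a finite stage. A member lost at the
  earliest such stage is isolated in a derivative that still contains all of \<open>C\<close>. The
  index set \<open>J\<close> covers a single finite stage as well as the limit.\<close>

lemma scattered_at_if_isolated: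
  assumes D: "D = (\<Inter>n\<in>J. (sgp_derivative ^^ n) closed_sgps)" and J: "J \<noteq> {}" and K: "K \<in> D" "K \<notin> sgp_derivative D"
  obtains N where "scattered_at K N"
proof -
  obtain N where N: "N \<in> NN" "\<And>L. L \<in> D \<Longrightarrow> L <#> N = K <#> N \<Longrightarrow> L = K"
    using K by (auto simp: sgp_derivative_def)
  have DC: "D \<subseteq> closed_sgps" using D J sgp_derivative_pow_antimono[of 0 _ closed_sgps] by fastforce
  have "\<exists>L\<in>C. \<exists>M\<in>NN. \<forall>L'\<in>C. L' <#> M = L <#> M \<longrightarrow> L' = L" if C: "C \<subseteq> sgp_nbh K N" "C \<noteq> {}" for C
  proof (cases "C \<subseteq> D")
    case True
    then have "\<forall>L\<in>C. L = K" using C N unfolding sgp_nbh_def by blast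
    then show ?thesis using C(2) N(1) by (metis ex_in_conv)
  next
    case False
    then have ex: "\<exists>n. \<not> C \<subseteq> (sgp_derivative ^^ n) closed_sgps" using D by blast
    define n where "n = (LEAST n. \<not> C \<subseteq> (sgp_derivative ^^ n) closed_sgps)"
    have n: "\<not> C \<subseteq> (sgp_derivative ^^ n) closed_sgps" unfolding n_def using ex by (rule LeastI_ex)
    have "n \<noteq> 0" using n C by (auto simp: sgp_nbh_def intro: ccontr)
    then obtain m where m: "n = Suc m" using not0_implies_Suc by blast
    have Cm: "C \<subseteq> (sgp_derivative ^^ m) closed_sgps" using not_less_Least[of m "\<lambda>n. \<not> C \<subseteq> (sgp_derivative ^^ n) closed_sgps"] m
      unfolding n_def by auto
    obtain L where L: "L \<in> C" "L \<notin> sgp_derivative ((sgp_derivative ^^ m) closed_sgps)" using n m by auto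
    then obtain M where "M \<in> NN" "\<forall>L'\<in>(sgp_derivative ^^ m) closed_sgps. L' <#> M = L <#> M \<longrightarrow> L' = L"
      using Cm unfolding sgp_derivative_def by blast
    then show ?thesis using Cm L(1) by blast
  qed
  then have "scattered_at K N" unfolding scattered_at_def using K DC N by blast
  then show ?thesis using that by blast
qed

theorem sgp_derivative_stationary:
  assumes "\<And>K. infinite_primes K \<subseteq> B" "finite B"
  shows "sgp_derivative ((sgp_derivative ^^ Suc (card B)) closed_sgps) = (sgp_derivative ^^ Suc (card B)) closed_sgps"
proof (rule ccontr)
  let ?D = "(sgp_derivative ^^ Suc (card B)) closed_sgps"
  assume "sgp_derivative ?D \<noteq> ?D"
  then obtain K where K: "K \<in> ?D" "K \<notin> sgp_derivative ?D" using sgp_derivative_subset by blast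
  obtain N where s: "scattered_at K N"
    by (rule scattered_at_if_isolated[of ?D "{Suc (card B)}" K]) (use K in auto)
  have "card (infinite_primes K) \<le> card B" using assms by (simp add: card_mono)
  then show False using scattered_at_notin_sgp_derivative[OF s] K(1) sgp_derivative_pow_antimono[of "Suc (card (infinite_primes K))" "Suc (card B)" closed_sgps]
    by auto
qed

text \<open>Serves the case of infinitely many primes: each scattered \<open>K\<close> has its own
  finite stage of removal, with no common bound on these stages.\<close>

theorem sgp_derivative_limit_stationary: "sgp_derivative (\<Inter>n. (sgp_derivative ^^ n) closed_sgps) = (\<Inter>n. (sgp_derivative ^^ n) closed_sgps)"
proof (rule ccontr)
  let ?D = "\<Inter>n. (sgp_derivative ^^ n) closed_sgps"
  assume "sgp_derivative ?D \<noteq> ?D"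
  then obtain K where K: "K \<in> ?D" "K \<notin> sgp_derivative ?D" using sgp_derivative_subset by blast
  obtain N where s: "scattered_at K N"
    by (rule scattered_at_if_isolated[of ?D UNIV K]) (use K in auto)
  then show False using scattered_at_notin_sgp_derivative[OF s] K(1) by blast
qed

end

section \<open>Profinite groups\<close>

text \<open>In a compact Hausdorff space two closed sets not joined by a connected set are separated
  by a clopen one; here the connected sets through \<open>x\<close> are trivial.\<close>

lemma clopen_neighbourhood:
  assumes "compact_space X" "Hausdorff_space X" "totally_disconnected_space X"
    and U: "openin X U" "x \<in> U"
  obtains C where "openin X C" "closedin X C" "x \<in> C" "C \<subseteq> U"
proof -
  have x: "x \<in> topspace X" using U openin_subset by blast
  have "separated_between X {x} (topspace X - U)"
  proof (rule cut_wire_fence_theorem[OF assms(1,2)])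
    show "closedin X {x}" by (rule closedin_Hausdorff_singleton[OF assms(2) x])
    show "closedin X (topspace X - U)" by (rule closedin_diff[OF closedin_topspace U(1)])
    fix C assume C: "connectedin X C"
    show "disjnt C {x} \<or> disjnt C (topspace X - U)"
    proof (cases "x \<in> C")
      case True
      have "C \<subseteq> connected_component_of_set X x"
        using connected_component_of_maximal[OF C True] .
      then have "C \<subseteq> {x}" using assms(3) x unfolding totally_disconnected_space_def by simp
      then show ?thesis using U by (auto simp: disjnt_def)
    qed (simp add: disjnt_def)
  qed
  then obtain V where V: "closedin X V" "openin X V" "{x} \<subseteq> V" "topspace X - U \<subseteq> topspace X - V"
    unfolding separated_between by blast
  then have "V \<subseteq> U" using closedin_subset[OF V(1)] by blast
  then show ?thesis using that V by blast
qed

locale profinite = group G for G (structure) and T +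
  assumes profin: "profinite_group G T"
begin

abbreviation "NT \<equiv> open_normal_subgroups G T"

lemma topsp: "topspace T = carrier G"
  using profin by (simp add: profinite_group_def topological_group_def)

lemma cptT: "compact_space T" and hausT: "Hausdorff_space T" and tdT: "totally_disconnected_space T"
  using profin by (simp_all add: profinite_group_def)

lemma continuous_mult:
  assumes "continuous_map T T f" "continuous_map T T g"
  shows "continuous_map T T (\<lambda>y. f y \<otimes> g y)"
proof -
  have "continuous_map (prod_topology T T) T (\<lambda>(x, y). x \<otimes> y)"
    using profin by (simp add: profinite_group_def topological_group_def)
  from continuous_map_compose[OF continuous_map_pairedI[OF assms] this]
  show ?thesis by (simp add: o_def)
qed

lemma continuous_inv: "continuous_map T T (\<lambda>y. inv y)"
  using profin by (simp add: profinite_group_def topological_group_def)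

lemma continuous_const: "x \<in> carrier G \<Longrightarrow> continuous_map T T (\<lambda>y. x)"
  using topsp by simp

lemma openin_vimage:
  assumes "continuous_map T T f" "openin T U"
  shows "openin T {y \<in> carrier G. f y \<in> U}"
  using openin_continuous_map_preimage[OF assms] by (simp add: topsp)

lemma continuous_ident: "continuous_map T T (\<lambda>y. y)"
  using continuous_map_id[of T] by (simp add: id_def)

lemmas continuous_group = continuous_mult continuous_inv continuous_const continuous_ident

lemma openin_rcos:
  assumes U: "openin T U" and x: "x \<in> carrier G"
  shows "openin T (U #> x)"
proof -
  have Uc: "U \<subseteq> carrier G" using U openin_subset topsp by metis
  have "{y \<in> carrier G. y \<otimes> inv x \<in> U} \<subseteq> U #> x"
  proof
    fix y assume y: "y \<in> {y \<in> carrier G. y \<otimes> inv x \<in> U}"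
    then have "y = (y \<otimes> inv x) \<otimes> x" using x by (simp add: grp_simps)
    then show "y \<in> U #> x" using y unfolding r_coset_def by blast
  qed
  moreover have "U #> x \<subseteq> {y \<in> carrier G. y \<otimes> inv x \<in> U}"
    using Uc x by (auto simp: r_coset_def grp_simps subset_iff)
  ultimately have "U #> x = {y \<in> carrier G. y \<otimes> inv x \<in> U}" by blast
  moreover have "openin T {y \<in> carrier G. y \<otimes> inv x \<in> U}"
    by (rule openin_vimage[OF _ U]) (use x in \<open>intro continuous_group; simp\<close>)
  ultimately show ?thesis by simp
qed

lemma openin_lcos:
  assumes U: "openin T U" and x: "x \<in> carrier G"
  shows "openin T {y \<in> carrier G. inv x \<otimes> y \<in> U}"
  by (rule openin_vimage[OF _ U]) (use x in \<open>intro continuous_group; simp\<close>)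

lemma finite_cosets_open:
  assumes H: "openin T H" "subgroup H G"
  shows "finite ((\<lambda>x. H #> x) ` carrier G)"
proof -
  let ?C = "(\<lambda>x. H #> x) ` carrier G"
  have "topspace T \<subseteq> \<Union> ?C" using rcos_self[OF _ H(2)] topsp by blast
  then obtain F where F: "finite F" "F \<subseteq> ?C" "topspace T \<subseteq> \<Union> F"
    using cptT openin_rcos[OF H(1)] unfolding compact_space_alt by (metis (no_types, lifting) image_iff)
  have "?C \<subseteq> F"
  proof
    fix C assume "C \<in> ?C"
    then obtain x where x: "x \<in> carrier G" "C = H #> x" by blast
    then obtain D where D: "D \<in> F" "x \<in> D" using F topsp by blast
    then obtain y where y: "y \<in> carrier G" "D = H #> y" using F by blast
    then have "C = D" using rcos_eq_mem_iff[OF H(2)] x D by simp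
    then show "C \<in> F" using D by simp
  qed
  then show ?thesis using F finite_subset by blast
qed

lemma openin_if_contains_open_subgroup:
  assumes "subgroup H G" "openin T W" "\<one> \<in> W" "W \<subseteq> H"
  shows "openin T H"
proof (subst openin_subopen, intro ballI)
  fix x assume x: "x \<in> H"
  have xc: "x \<in> carrier G" using x assms sgp_mem by blast
  have "x = \<one> \<otimes> x" using xc by simp
  then have "x \<in> W #> x" using assms(3) unfolding r_coset_def by blast
  moreover have "W #> x \<subseteq> H" using assms x sgp_mult[OF assms(1)] by (auto simp: r_coset_def)
  ultimately show "\<exists>U. openin T U \<and> x \<in> U \<and> U \<subseteq> H" using openin_rcos[OF assms(2) xc] by blast
qed

text \<open>Van Dantzig's argument: for a clopen \<open>C\<close> in \<open>U\<close> containing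
  \<open>\<one>\<close>, the elements whose right translation preserves \<open>C\<close> form a
  subgroup inside \<open>C\<close>, and the tube lemma puts a neighbourhood of \<open>\<one>\<close>
  into it.\<close>

lemma open_subgroup_neighbourhood:
  assumes U: "openin T U" "\<one> \<in> U"
  obtains H where "openin T H" "subgroup H G" "H \<subseteq> U"
proof -
  obtain C where C: "openin T C" "closedin T C" "\<one> \<in> C" "C \<subseteq> U"
    using clopen_neighbourhood[OF cptT hausT tdT U] .
  have Cc: "C \<subseteq> carrier G" using C openin_subset topsp by metis
  have cm: "continuous_map (prod_topology T T) T (\<lambda>(x, y). x \<otimes> y)"
    using profin by (simp add: profinite_group_def topological_group_def)
  define Z where "Z = {p \<in> topspace (prod_topology T T). (\<lambda>(x, y). x \<otimes> y) p \<in> C}"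
  have Z: "openin (prod_topology T T) Z"
    unfolding Z_def by (rule openin_continuous_map_preimage[OF cm C(1)])
  have "C \<times> {\<one>} \<subseteq> Z" using Cc by (auto simp: Z_def topsp)
  moreover have "compactin T C" using cptT C closedin_compact_space by blast
  ultimately obtain A W where W: "openin T W" "C \<subseteq> A" "\<one> \<in> W" "A \<times> W \<subseteq> Z"
    using tube_lemma_left[OF Z, of C \<one>] topsp by auto
  define V where "V = {v \<in> carrier G. \<forall>c\<in>C. c \<otimes> v \<in> C \<and> c \<otimes> inv v \<in> C}"
  have WV: "v \<in> carrier G \<and> (\<forall>c\<in>C. c \<otimes> v \<in> C)" if "v \<in> W" for v
    using that W openin_subset[OF W(1)] topsp by (fastforce simp: Z_def)
  have Vs: "subgroup V G"
  proof (rule subgroupI)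
    have "\<one> \<in> V" using Cc by (auto simp: V_def)
    then show "V \<noteq> {}" by blast
    show "inv v \<in> V" if "v \<in> V" for v using that by (simp add: V_def)
    show "v \<otimes> w \<in> V" if vw: "v \<in> V" "w \<in> V" for v w
    proof -
      have c: "v \<in> carrier G" "w \<in> carrier G" using vw by (auto simp: V_def)
      have "c \<otimes> (v \<otimes> w) \<in> C \<and> c \<otimes> inv (v \<otimes> w) \<in> C" if x: "c \<in> C" for c
      proof -
        have "(c \<otimes> v) \<otimes> w \<in> C" "(c \<otimes> inv w) \<otimes> inv v \<in> C" using vw x by (auto simp: V_def)
        then show ?thesis using c x Cc by (auto simp: grp_simps subset_iff)
      qed
      then show ?thesis using c by (simp add: V_def)
    qed
  qed (auto simp: V_def)
  let ?W = "W \<inter> {y \<in> carrier G. inv y \<in> W}"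
  have "openin T ?W" using W(1) openin_vimage[OF continuous_inv W(1)] by blast
  moreover have "\<one> \<in> ?W" using W by simp
  moreover have "?W \<subseteq> V" using WV by (auto simp: V_def)
  ultimately have "openin T V" using openin_if_contains_open_subgroup[OF Vs] by blast
  moreover have "V \<subseteq> C"
  proof
    fix v assume v: "v \<in> V"
    then have "\<one> \<otimes> v \<in> C" using C(3) unfolding V_def by blast
    then show "v \<in> C" using v by (simp add: V_def)
  qed
  ultimately show ?thesis using that Vs C by blast
qed

text \<open>The normal core of an open subgroup \<open>H\<close> is open: by finiteness of the index
  it is a finite intersection of conjugates, one for each representative in
  \<open>R\<close>.\<close>

lemma open_normal_neighbourhood:
  assumes U: "openin T U" "\<one> \<in> U"
  obtains N where "N \<in> NT" "N \<subseteq> U"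
proof -
  obtain H where H: "openin T H" "subgroup H G" "H \<subseteq> U" using open_subgroup_neighbourhood[OF U] .
  obtain R where R: "R \<subseteq> carrier G" "finite R" "(\<lambda>x. H #> x) ` carrier G = (\<lambda>x. H #> x) ` R"
    using finite_subset_image[OF finite_cosets_open[OF H(1,2)] order_refl] by metis
  define N where "N = {y \<in> carrier G. \<forall>x\<in>carrier G. x \<otimes> y \<otimes> inv x \<in> H}"
  have N: "N \<lhd> G"
    unfolding normal_inv_iff
  proof (intro conjI ballI)
    show "subgroup N G"
    proof (rule subgroupI)
      have "\<one> \<in> N" using sgp_one[OF H(2)] by (simp add: N_def)
      then show "N \<noteq> {}" by blast
      show "inv y \<in> N" if y: "y \<in> N" for y
      proof -
        have yc: "y \<in> carrier G" using y by (simp add: N_def)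
        have "x \<otimes> inv y \<otimes> inv x \<in> H" if x: "x \<in> carrier G" for x
        proof -
          have "inv (x \<otimes> y \<otimes> inv x) \<in> H" using y x sgp_inv[OF H(2)] by (simp add: N_def)
          then show ?thesis using x yc by (simp add: grp_simps)
        qed
        then show ?thesis using yc by (simp add: N_def)
      qed
      show "y \<otimes> z \<in> N" if yz: "y \<in> N" "z \<in> N" for y z
      proof -
        have c: "y \<in> carrier G" "z \<in> carrier G" using yz by (auto simp: N_def)
        have "x \<otimes> (y \<otimes> z) \<otimes> inv x \<in> H" if x: "x \<in> carrier G" for x
        proof -
          have "(x \<otimes> y \<otimes> inv x) \<otimes> (x \<otimes> z \<otimes> inv x) \<in> H" using yz x sgp_mult[OF H(2)] by (simp add: N_def)
          then show ?thesis using x c by (simp add: grp_simps)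
        qed
        then show ?thesis using c by (simp add: N_def)
      qed
    qed (auto simp: N_def)
    fix g y assume g: "g \<in> carrier G" and y: "y \<in> N"
    have yc: "y \<in> carrier G" using y by (simp add: N_def)
    have "x \<otimes> (g \<otimes> y \<otimes> inv g) \<otimes> inv x \<in> H" if x: "x \<in> carrier G" for x
    proof -
      have "(x \<otimes> g) \<otimes> y \<otimes> inv (x \<otimes> g) \<in> H" using y x g unfolding N_def by blast
      then show ?thesis using x g yc by (simp add: grp_simps)
    qed
    then show "g \<otimes> y \<otimes> inv g \<in> N" using g yc by (simp add: N_def)
  qed
  have eq: "N = carrier G \<inter> (\<Inter>r\<in>R. {y \<in> carrier G. r \<otimes> y \<otimes> inv r \<in> H})"
  proof
    show "N \<subseteq> carrier G \<inter> (\<Inter>r\<in>R. {y \<in> carrier G. r \<otimes> y \<otimes> inv r \<in> H})" using R by (auto simp: N_def)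
    show "carrier G \<inter> (\<Inter>r\<in>R. {y \<in> carrier G. r \<otimes> y \<otimes> inv r \<in> H}) \<subseteq> N"
    proof
      fix y assume y: "y \<in> carrier G \<inter> (\<Inter>r\<in>R. {y \<in> carrier G. r \<otimes> y \<otimes> inv r \<in> H})"
      have "x \<otimes> y \<otimes> inv x \<in> H" if x: "x \<in> carrier G" for x
      proof -
        obtain r where r: "r \<in> R" "H #> x = H #> r" using R x by (metis (no_types, lifting) image_iff)
        have rc: "r \<in> carrier G" using r R by blast
        have yc: "y \<in> carrier G" using y by blast
        have h: "x \<otimes> inv r \<in> H" using r rcos_eq_iff[OF H(2) x rc] by simp
        have "r \<otimes> y \<otimes> inv r \<in> H" using y r by blast
        then have "(x \<otimes> inv r) \<otimes> (r \<otimes> y \<otimes> inv r) \<otimes> inv (x \<otimes> inv r) \<in> H"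
          using h sgp_mult[OF H(2)] sgp_inv[OF H(2)] by blast
        then show ?thesis using x rc yc by (simp add: grp_simps)
      qed
      then show "y \<in> N" using y by (simp add: N_def)
    qed
  qed
  have op: "openin T {y \<in> carrier G. r \<otimes> y \<otimes> inv r \<in> H}" if "r \<in> R" for r
    by (rule openin_vimage[OF _ H(1)]) (use that R in \<open>intro continuous_group; auto\<close>)
  have "openin T (carrier G \<inter> (\<Inter>r\<in>R'. {y \<in> carrier G. r \<otimes> y \<otimes> inv r \<in> H}))" if "R' \<subseteq> R" for R'
    using finite_subset[OF that R(2)] that
  proof (induction R')
    case empty
    then show ?case using openin_topspace[of T] by (simp add: topsp)
  next
    case (insert r R')
    then have "openin T ((carrier G \<inter> (\<Inter>r\<in>R'. {y \<in> carrier G. r \<otimes> y \<otimes> inv r \<in> H})) \<inter> {y \<in> carrier G. r \<otimes> y \<otimes> inv r \<in> H})"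
      using op by blast
    moreover have "(carrier G \<inter> (\<Inter>r\<in>R'. {y \<in> carrier G. r \<otimes> y \<otimes> inv r \<in> H})) \<inter> {y \<in> carrier G. r \<otimes> y \<otimes> inv r \<in> H}
      = carrier G \<inter> (\<Inter>r\<in>insert r R'. {y \<in> carrier G. r \<otimes> y \<otimes> inv r \<in> H})" by auto
    ultimately show ?case by simp
  qed
  from this[of R] have "openin T N" unfolding eq by simp
  moreover have "N \<subseteq> U"
  proof
    fix y assume "y \<in> N"
    then have "\<one> \<otimes> y \<otimes> inv \<one> \<in> H" "y \<in> carrier G" unfolding N_def by blast+
    then show "y \<in> U" using H by auto
  qed
  ultimately show ?thesis using that N by (simp add: open_normal_subgroups_def)
qed

lemma normal_base_NT: "normal_base G NT"
proof (intro normal_base.intro normal_base_axioms.intro)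
  show "group G" by (rule is_group)
  have "carrier G \<in> NT"
    using normal_inv_iff subgroup_self openin_topspace[of T] topsp
    by (auto simp: open_normal_subgroups_def)
  then show "NT \<noteq> {}" by blast
  show "M \<lhd> G" if "M \<in> NT" for M using that by (simp add: open_normal_subgroups_def)
  show "finite (rcosets M)" if M: "M \<in> NT" for M
  proof -
    have "rcosets M = (\<lambda>x. M #> x) ` carrier G" unfolding RCOSETS_def by blast
    then show ?thesis
      using finite_cosets_open[of M] M normal_imp_subgroup[of M G]
      by (simp add: open_normal_subgroups_def)
  qed
  show "M \<inter> N \<in> NT" if "M \<in> NT" "N \<in> NT" for M N
    using that by (auto simp: open_normal_subgroups_def normal_inv_iff subgroups_Inter_pair)
qed

sublocale nb: normal_base G NT by (rule normal_base_NT)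

section \<open>The algebraic model agrees with the topology\<close>

lemma closed_sgps_eq: "nb.closed_sgps = closed_subgroups G T"
proof
  show "nb.closed_sgps \<subseteq> closed_subgroups G T"
  proof
    fix H assume H: "H \<in> nb.closed_sgps"
    have Hs: "subgroup H G" using H nb.closed_sgps_subgroup by blast
    have "openin T (carrier G - H)"
    proof (subst openin_subopen, intro ballI)
      fix x assume x: "x \<in> carrier G - H"
      then obtain M where M: "M \<in> NT" "x \<notin> H <#> M" using nb.closed_sgpsD[OF H] by blast
      have Mo: "openin T M" using M by (simp add: open_normal_subgroups_def)
      let ?U = "{y \<in> carrier G. inv x \<otimes> y \<in> M}"
      have "openin T ?U" using openin_lcos[OF Mo] x by blast
      moreover have "x \<in> ?U" using x sgp_one[OF nb.NN_subgroup[OF M(1)]] by simp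
      moreover have "?U \<subseteq> carrier G - H"
      proof
        fix y assume y: "y \<in> ?U"
        have "y \<notin> H"
        proof
          assume yH: "y \<in> H"
          have "inv (inv x \<otimes> y) \<in> M" using y sgp_inv[OF nb.NN_subgroup[OF M(1)]] by blast
          moreover have "x = y \<otimes> inv (inv x \<otimes> y)" using x y by (simp add: grp_simps)
          ultimately have "x \<in> H <#> M" using yH unfolding set_mult_def by blast
          then show False using M by blast
        qed
        then show "y \<in> carrier G - H" using y by blast
      qed
      ultimately show "\<exists>U. openin T U \<and> x \<in> U \<and> U \<subseteq> carrier G - H" by blast
    qed
    then have "closedin T H" using sgp_sub[OF Hs] by (simp add: closedin_def topsp)
    then show "H \<in> closed_subgroups G T" using Hs by (simp add: closed_subgroups_def)
  qed
  show "closed_subgroups G T \<subseteq> nb.closed_sgps"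
  proof
    fix H assume "H \<in> closed_subgroups G T"
    then have H: "subgroup H G" "closedin T H" by (auto simp: closed_subgroups_def)
    show "H \<in> nb.closed_sgps"
    proof (rule nb.closed_sgpsI[OF H(1)], rule ccontr)
      fix x assume x: "x \<in> carrier G" "\<And>M. M \<in> NT \<Longrightarrow> x \<in> H <#> M" and nx: "x \<notin> H"
      have "openin T (carrier G - H)" using H(2) by (simp add: closedin_def topsp)
      then have "openin T {y \<in> carrier G. x \<otimes> inv y \<in> carrier G - H}"
        by (rule openin_vimage[rotated]) (use x in \<open>intro continuous_group; simp\<close>)
      moreover have "\<one> \<in> {y \<in> carrier G. x \<otimes> inv y \<in> carrier G - H}" using x nx by simp
      ultimately obtain N where N: "N \<in> NT" "N \<subseteq> {y \<in> carrier G. x \<otimes> inv y \<in> carrier G - H}"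
        by (rule open_normal_neighbourhood)
      obtain h n where hn: "h \<in> H" "n \<in> N" "x = h \<otimes> n" using x(2)[OF N(1)] by (auto simp: set_mult_def)
      have "h \<in> carrier G" "n \<in> carrier G" using hn sgp_mem[OF H(1)] N by blast+
      then have "x \<otimes> inv n = h" using hn by (simp add: grp_simps)
      then show False using hn N by auto
    qed
  qed
qed

lemma open_sgp_openin: "nb.open_sgp H \<Longrightarrow> openin T H"
proof -
  assume "nb.open_sgp H"
  then obtain M where "M \<in> NT" "M \<subseteq> H" "subgroup H G" by (auto simp: nb.open_sgp_def)
  then show ?thesis
    using openin_if_contains_open_subgroup[of H M] sgp_one[OF nb.NN_subgroup[of M]]
    by (simp add: open_normal_subgroups_def)
qed

text \<open>If the claim failed, the closed sets \<open>E M'\<close> would be nonempty and directed,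
  so they would share a point. It lies in \<open>A\<close> and in every \<open>B <#> M'\<close>,
  hence in \<open>A \<inter> B\<close>, although \<open>W\<close> was removed.\<close>

lemma compact_Int_mult:
  assumes A: "A \<in> nb.closed_sgps" and B: "B \<in> nb.closed_sgps" and M: "M \<in> NT"
  shows "\<exists>M'\<in>NT. A \<inter> (B <#> M') \<subseteq> (A \<inter> B) <#> M"
proof (rule ccontr)
  assume neg: "\<not> ?thesis"
  have As: "subgroup A G" "closedin T A" using A unfolding closed_sgps_eq closed_subgroups_def by auto
  have Bs: "subgroup B G" using B nb.closed_sgps_subgroup by blast
  have AB: "subgroup (A \<inter> B) G" using subgroups_Inter_pair As Bs by blast
  define W where "W = (A \<inter> B) <#> M"
  have W: "openin T W" unfolding W_def by (rule open_sgp_openin[OF nb.mult_NN(1)[OF AB M]])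
  define E where "E M' = (A \<inter> (B <#> M')) - W" for M'
  have cl: "closedin T (E M')" if M': "M' \<in> NT" for M'
  proof -
    have "B <#> M' \<in> nb.closed_sgps" by (rule nb.open_sgp_closed_sgps[OF nb.mult_NN(1)[OF Bs M']])
    then have "closedin T (B <#> M')" unfolding closed_sgps_eq by (simp add: closed_subgroups_def)
    then show ?thesis unfolding E_def using As(2) W by blast
  qed
  have mono: "E M1 \<subseteq> E M2" if "M1 \<subseteq> M2" for M1 M2
    using nb.mult_NN_mono[OF that order_refl, of B] unfolding E_def by blast
  have fip: "\<exists>M0\<in>NT. \<forall>M'\<in>F. M0 \<subseteq> M'" if "finite F" "F \<subseteq> NT" for F
    using that
  proof (induction F)
    case empty
    then show ?case using nb.NN_nonempty by blast
  next
    case (insert M' F)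
    then obtain M0 where "M0 \<in> NT" "\<forall>M''\<in>F. M0 \<subseteq> M''" by blast
    then show ?case using nb.NN_Int[of M0 M'] insert by (intro bexI[of _ "M0 \<inter> M'"]) auto
  qed
  have "\<Inter>\<F> \<noteq> {}" if F: "finite \<F>" "\<F> \<subseteq> E ` NT" for \<F>
  proof -
    obtain F where "finite F" "F \<subseteq> NT" "\<F> = E ` F" using finite_subset_image[OF F] by blast
    moreover from this(1,2) obtain M0 where "M0 \<in> NT" "\<forall>M'\<in>F. M0 \<subseteq> M'" using fip by blast
    moreover have "E M0 \<noteq> {}" using neg \<open>M0 \<in> NT\<close> unfolding E_def W_def by blast
    ultimately show ?thesis using mono by blast
  qed
  then have "\<Inter>(E ` NT) \<noteq> {}"
    using cptT cl unfolding compact_space_fip by (metis (no_types, lifting) image_iff)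
  then obtain x where x: "\<And>M'. M' \<in> NT \<Longrightarrow> x \<in> E M'" by blast
  have "x \<in> A" "x \<notin> W" using x[OF M] by (auto simp: E_def)
  moreover have "x \<in> B"
    by (rule nb.closed_sgpsD[OF B]) (use x \<open>x \<in> A\<close> sgp_mem[OF As(1)] in \<open>auto simp: E_def\<close>)
  ultimately show False using nb.mult_NN(3)[OF AB M] unfolding W_def by blast
qed

sublocale pf: compact_normal_base G NT
  by (intro compact_normal_base.intro compact_normal_base_axioms.intro normal_base_NT compact_Int_mult)

text \<open>The index of an open subgroup divides the order of the quotient by any open normal
  subgroup inside it. This is what bounds the number of infinite primes by k.\<close>

lemma infinite_primes_subset: "nb.infinite_primes K \<subseteq> {p. prime p \<and> supernatural_order G T p = \<infinity>}"
proof
  fix p assume p: "p \<in> nb.infinite_primes K"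
  then have pp: "prime p" "nb.infinite_p_index p (carrier G) K" by (auto simp: nb.infinite_primes_def)
  have "enat n \<le> supernatural_order G T p" for n
  proof -
    obtain H where H: "nb.open_sgp H" "p ^ n dvd rel_index (carrier G) H"
      using pp(2) unfolding nb.infinite_p_index_def by blast
    then obtain M where M: "M \<in> NT" "M \<subseteq> H" by (auto simp: nb.open_sgp_def)
    have "rel_index (carrier G) H dvd rel_index (carrier G) M"
      by (rule nb.rel_index_open_sgp_dvd[OF subgroup_self nb.NN_open_sgp[OF M(1)] M(2) nb.open_sgp_subgroup[OF H(1)]])
    moreover have e: "rel_index (carrier G) M = order (G Mod M)"
      by (auto simp: rel_index_def order_def FactGroup_def RCOSETS_def intro!: arg_cong[of _ _ card])
    ultimately have "p ^ n dvd order (G Mod M)" using H(2) dvd_trans by metis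
    moreover have "order (G Mod M) \<noteq> 0"
      using nb.rel_index_open_sgp_pos[OF nb.NN_open_sgp[OF M(1)] subgroup_self] e by simp
    ultimately have "n \<le> multiplicity p (order (G Mod M))"
      using pp(1) by (intro multiplicity_geI) auto
    then have "enat n \<le> enat (multiplicity p (order (G Mod M)))" by simp
    also have "\<dots> \<le> supernatural_order G T p"
      unfolding supernatural_order_def using M(1) by (rule SUP_upper)
    finally show ?thesis .
  qed
  then have "supernatural_order G T p = \<infinity>"
    by (metis enat_ord_simps(1) not_less_eq_eq order_refl enat.exhaust)
  then show "p \<in> {p. prime p \<and> supernatural_order G T p = \<infinity>}" using pp by simp
qed

lemma cb_derivative_eq:
  assumes D: "D \<subseteq> closed_subgroups G T"
  shows "cb_derivative (subgroup_space G T) D = pf.sgp_derivative D"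
proof -
  let ?X = "subgroup_space G T"
  have tg: "topological_group G T" using profin by (simp add: profinite_group_def)
  have ts: "topspace ?X = closed_subgroups G T" by (rule topspace_subgroup_space[OF tg])
  have nbo: "openin ?X (subgroup_nhd G T K M)" if "K \<in> closed_subgroups G T" "M \<in> NT" for K M
    unfolding subgroup_space_def using that by (intro topology_generated_by_Basis) blast
  have iso: "K \<in> isolated_points (subtopology ?X D) \<longleftrightarrow> (\<exists>M\<in>NT. \<forall>L\<in>D. L <#> M = K <#> M \<longrightarrow> L = K)"
    if K: "K \<in> D" for K
  proof
    assume "K \<in> isolated_points (subtopology ?X D)"
    then have "openin (subtopology ?X D) {K}" by (simp add: isolated_points_def)
    then obtain U where U: "openin ?X U" "{K} = U \<inter> D" unfolding openin_subtopology by blast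
    then obtain M where M: "M \<in> NT" "subgroup_nhd G T K M \<subseteq> U"
      using U(1)[unfolded openin_subgroup_space_iff[OF tg]] by blast
    then have "\<forall>L\<in>D. L <#> M = K <#> M \<longrightarrow> L = K" using U D unfolding subgroup_nhd_def by blast
    then show "\<exists>M\<in>NT. \<forall>L\<in>D. L <#> M = K <#> M \<longrightarrow> L = K" using M by blast
  next
    assume "\<exists>M\<in>NT. \<forall>L\<in>D. L <#> M = K <#> M \<longrightarrow> L = K"
    then obtain M where M: "M \<in> NT" "\<forall>L\<in>D. L <#> M = K <#> M \<longrightarrow> L = K" by blast
    have o: "openin ?X (subgroup_nhd G T K M)" by (rule nbo) (use M K D in auto)
    have e: "{K} = subgroup_nhd G T K M \<inter> D" using M K D unfolding subgroup_nhd_def by blast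
    have "openin (subtopology ?X D) {K}" unfolding e by (rule openin_subtopology_Int[OF o])
    then show "K \<in> isolated_points (subtopology ?X D)"
      using K D ts unfolding isolated_points_def by auto
  qed
  show ?thesis
  proof (rule Set.set_eqI)
    fix K show "K \<in> cb_derivative ?X D \<longleftrightarrow> K \<in> pf.sgp_derivative D"
      using iso[of K] unfolding cb_derivative_def pf.sgp_derivative_def by (cases "K \<in> D") auto
  qed
qed

end

section \<open>Iterated derivatives along well-orders\<close>

lemma immediate_pred_underS:
  assumes r: "Well_order r" and j: "immediate_pred r j i"
  shows "underS r i = insert j (underS r j)" "j \<in> Field r" "j \<notin> underS r j"
proof -
  interpret wo_rel r using r by (simp add: wo_rel_def)
  have ji: "(j, i) \<in> r" "j \<noteq> i" and max: "\<And>k. k \<in> underS i \<Longrightarrow> (k, j) \<in> r"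
    using j by (auto simp: immediate_pred_def underS_def)
  show "j \<in> Field r" using ji by (auto simp: Field_def)
  show "j \<notin> underS j" by (simp add: underS_def)
  show "underS i = insert j (underS j)"
  proof
    show "underS i \<subseteq> insert j (underS j)" using max by (auto simp: underS_def)
    show "insert j (underS j) \<subseteq> underS i"
      using ji TRANS ANTISYM unfolding underS_def trans_def antisym_def by blast
  qed
qed

text \<open>A finite nonempty chain has a greatest element; limit steps therefore occur only at
  infinite stages.\<close>

lemma finite_underS_immediate_pred:
  assumes r: "Well_order r" and fin: "finite (underS r i)" and ne: "underS r i \<noteq> {}"
  shows "\<exists>j. immediate_pred r j i"
proof -
  interpret wo_rel r using r by (simp add: wo_rel_def)
  have "\<exists>j\<in>A. \<forall>k\<in>A. (k, j) \<in> r" if "finite A" "A \<noteq> {}" "A \<subseteq> Field r" for A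
    using that
  proof (induction A rule: finite_ne_induct)
    case (singleton x)
    then show ?case using REFL by (auto simp: refl_on_def)
  next
    case (insert x A)
    then obtain j where j: "j \<in> A" "\<forall>k\<in>A. (k, j) \<in> r" by blast
    have xx: "(x, x) \<in> r" using insert.prems REFL by (auto simp: refl_on_def)
    have "(x, j) \<in> r \<or> (j, x) \<in> r" using insert.prems j TOTALS by blast
    then show ?case
    proof
      assume "(j, x) \<in> r"
      then have "\<forall>k\<in>insert x A. (k, x) \<in> r" using j xx TRANS unfolding trans_def by blast
      then show ?case by blast
    qed (use j in blast)
  qed
  moreover have "underS i \<subseteq> Field r" by (auto simp: underS_def Field_def)
  ultimately show ?thesis using fin ne unfolding immediate_pred_def by blast
qed

lemma iterated_derivative_finite:
  assumes r: "Well_order r" and fin: "finite (underS r i)"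
  shows "iterated_derivative X r i = (cb_derivative X ^^ card (underS r i)) (topspace X)"
  using fin
proof (induction "card (underS r i)" arbitrary: i)
  case 0
  then show ?case using iterated_derivative_zero[OF r] by simp
next
  case (Suc n)
  then obtain j where j: "immediate_pred r j i" using finite_underS_immediate_pred[OF r] by force
  note u = immediate_pred_underS[OF r j]
  have "finite (underS r j)" "card (underS r i) = Suc (card (underS r j))" using u Suc.prems by auto
  then have "iterated_derivative X r j = (cb_derivative X ^^ card (underS r j)) (topspace X)"
    using Suc.hyps by simp
  then show ?case
    using iterated_derivative_Suc[OF r j, of X] \<open>card (underS r i) = Suc (card (underS r j))\<close> by simp
qed

lemma cb_derivative_funpow_antimono:
  "m \<le> n \<Longrightarrow> (cb_derivative X ^^ n) S \<subseteq> (cb_derivative X ^^ m) S"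
proof (induction n rule: dec_induct)
  case (step n)
  then show ?case by (auto simp: cb_derivative_def)
qed simp

lemma underS_strict_mono:
  assumes r: "Well_order r" and "j \<in> underS r i"
  shows "underS r j \<subset> underS r i"
proof -
  interpret wo_rel r using r by (simp add: wo_rel_def)
  have "underS j \<subseteq> underS i"
    using assms(2) TRANS ANTISYM unfolding underS_def trans_def antisym_def by blast
  moreover have "j \<notin> underS j" by (simp add: underS_def)
  ultimately show ?thesis using assms(2) by blast
qed

text \<open>\<open>i\<close> represents the ordinal \<omega>. Its predecessors have strictly nested
  finite predecessor sets, hence sets of unbounded size, and since the derivatives decrease, the
  intersection runs over all natural numbers.\<close>

lemma iterated_derivative_omega:
  assumes r: "Well_order r" and inf: "infinite (underS r i)"
    and fin: "\<And>j. j \<in> underS r i \<Longrightarrow> finite (underS r j)"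
  shows "iterated_derivative X r i = (\<Inter>n. (cb_derivative X ^^ n) (topspace X))"
proof -
  interpret wo_rel r using r by (simp add: wo_rel_def)
  have "\<nexists>j. immediate_pred r j i"
  proof
    assume "\<exists>j. immediate_pred r j i"
    then obtain j where j: "immediate_pred r j i" by blast
    then show False using immediate_pred_underS[OF r j] fin[of j] inf by (simp add: immediate_pred_def)
  qed
  then have eq: "iterated_derivative X r i = (\<Inter>j\<in>underS i. iterated_derivative X r j)"
    using iterated_derivative_limit[OF r] inf by (metis finite.emptyI)
  have inj: "inj_on (\<lambda>j. card (underS j)) (underS i)"
  proof (rule inj_onI, rule ccontr)
    fix j k assume jk: "j \<in> underS i" "k \<in> underS i" "card (underS j) = card (underS k)" "j \<noteq> k"
    have "j \<in> Field r" "k \<in> Field r" using jk by (auto simp: underS_def Field_def)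
    then have "j \<in> underS k \<or> k \<in> underS j" using TOTALS jk(4) by (auto simp: underS_def)
    then have "underS j \<subset> underS k \<or> underS k \<subset> underS j" using underS_strict_mono[OF r] by blast
    then show False using fin[OF jk(1)] fin[OF jk(2)] jk(3) psubset_card_mono by (metis nat_neq_iff)
  qed
  have "\<exists>j\<in>underS i. n \<le> card (underS j)" for n
  proof (rule ccontr)
    assume "\<not> ?thesis"
    then have "(\<lambda>j. card (underS j)) ` underS i \<subseteq> {..<n}" by auto
    then show False using inj inf finite_imageD finite_subset by blast
  qed
  then show ?thesis unfolding eq
    using iterated_derivative_finite[OF r fin] cb_derivative_funpow_antimono by fastforce
qed

text \<open>Each stage before the stationary one is finite by \<open>lim\<close>, with at most
  \<open>card B\<close> predecessors when \<open>B\<close> is finite. Were the bound false,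
  \<open>|B| +c cone\<close> would embed into the predecessors of such a stage; so \<open>B\<close>
  would be finite and the stage would have at least \<open>Suc (card B)\<close>
  predecessors.\<close>

lemma scattered_height_ordLeq:
  fixes X :: "'a topology" and B :: "'b set"
  assumes fin: "finite B \<Longrightarrow> cb_derivative X ((cb_derivative X ^^ Suc (card B)) (topspace X)) =
      (cb_derivative X ^^ Suc (card B)) (topspace X)"
    and lim: "cb_derivative X (\<Inter>n. (cb_derivative X ^^ n) (topspace X)) =
      (\<Inter>n. (cb_derivative X ^^ n) (topspace X))"
  shows "scattered_height X \<le>o |B| +c cone"
proof -
  define r where "r = cardSuc |topspace X|"
  have r: "Well_order r" by (simp add: r_def cardSuc_Well_order card_of_Card_order)
  interpret wo_rel r using r by (simp add: wo_rel_def)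
  let ?D = "iterated_derivative X r" and ?F = "\<lambda>n. (cb_derivative X ^^ n) (topspace X)"
  define S where "S = {i \<in> Field r. ?D i = cb_derivative X (?D i)}"
  define i0 where "i0 = height_index X"
  have i0: "i0 = minim S" by (simp add: i0_def height_index_def Let_def r_def S_def)
  have SF: "S \<subseteq> Field r" by (auto simp: S_def)
  have notS: "a \<notin> S" if a: "a \<in> underS i0" for a
  proof
    assume "a \<in> S"
    then have "(i0, a) \<in> r" unfolding i0 by (rule minim_least[OF SF])
    then show False using a ANTISYM unfolding underS_def antisym_def by blast
  qed
  have finS: "finite (underS a)" if a: "a \<in> underS i0" for a
  proof (rule ccontr)
    assume inf: "infinite (underS a)"
    \<comment> \<open>The least element with infinitely many predecessors is the stage \<omega>,
      which is stationary; it would precede \<open>i0\<close>, against minimality.\<close>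
    define J where "J = {i \<in> Field r. infinite (underS i)}"
    have aJ: "a \<in> J" using a inf by (auto simp: J_def underS_def Field_def)
    have JF: "J \<subseteq> Field r" by (auto simp: J_def)
    define i where "i = minim J"
    have iJ: "i \<in> J" unfolding i_def using aJ by (intro minim_in[OF JF]) blast
    have ia: "(i, a) \<in> r" unfolding i_def by (rule minim_least[OF JF aJ])
    have "finite (underS j)" if j: "j \<in> underS i" for j
    proof (rule ccontr)
      assume "infinite (underS j)"
      then have "j \<in> J" using j by (auto simp: J_def underS_def Field_def)
      then have "(i, j) \<in> r" unfolding i_def by (rule minim_least[OF JF])
      then show False using j ANTISYM unfolding underS_def antisym_def by blast
    qed
    then have "?D i = (\<Inter>n. ?F n)"
      by (intro iterated_derivative_omega[OF r]) (use iJ in \<open>simp_all add: J_def\<close>)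
    then have "i \<in> S" using lim iJ by (simp add: S_def J_def)
    moreover have "i \<in> underS i0"
      using ia a TRANS ANTISYM unfolding underS_def trans_def antisym_def by blast
    ultimately show False using notS by blast
  qed
  have cardS: "card (underS a) < Suc (card B)" if B: "finite B" and a: "a \<in> underS i0" for a
  proof (rule ccontr)
    assume "\<not> ?thesis"
    then have le: "Suc (card B) \<le> card (underS a)" by simp
    have F: "?F n = ?F (Suc (card B))" if "Suc (card B) \<le> n" for n
      using that
    proof (induction n rule: dec_induct)
      case (step n)
      then show ?case using fin[OF B] by simp
    qed simp
    have "?D a = ?F (Suc (card B))" using iterated_derivative_finite[OF r finS[OF a], of X] F[OF le] by simp
    then have "a \<in> S" using fin[OF B] a by (auto simp: S_def underS_def Field_def)
    then show False using notS a by blast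
  qed
  define s where "s = Restr r (underS i0)"
  have s: "Well_order s" unfolding s_def using r by (rule Well_order_Restr)
  have sF: "Field s \<subseteq> underS i0" unfolding s_def by (auto simp: Field_def)
  have cc: "|B| +c cone = |B <+> {()}|" by (simp add: csum_def BNF_Cardinal_Arithmetic.cone_def Field_card_of)
  have "\<not> |B <+> {()}| <o s"
  proof
    assume "|B <+> {()}| <o s"
    then obtain a where a: "a \<in> Field s" "|B <+> {()}| =o Restr s (Order_Relation.underS s a)"
      using ordLess_iff_ordIso_Restr[OF s card_of_Well_order] by blast
    have au: "a \<in> underS i0" using a sF by blast
    have sub: "Field (Restr s (Order_Relation.underS s a)) \<subseteq> underS a"
      unfolding s_def by (auto simp: Field_def underS_def)
    obtain f where "BNF_Wellorder_Embedding.iso (card_of (B <+> {()})) (Restr s (Order_Relation.underS s a)) f"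
      using a(2) unfolding ordIso_def by blast
    then have bij: "bij_betw f (B <+> {()}) (Field (Restr s (Order_Relation.underS s a)))"
      unfolding BNF_Wellorder_Embedding.iso_def by (simp add: Field_card_of)
    have fF: "finite (Field (Restr s (Order_Relation.underS s a)))"
      using sub finS[OF au] finite_subset by blast
    then have finB: "finite B" using bij bij_betw_finite by (metis finite_Plus_iff)
    have "card (B <+> {()}) \<le> card (underS a)"
      using bij_betw_same_card[OF bij] card_mono[OF finS[OF au] sub] by simp
    then show False using cardS[OF finB au] finB by (simp add: card_Plus)
  qed
  then have "s \<le>o |B <+> {()}|"
    using not_ordLess_iff_ordLeq[OF s card_of_Well_order] by blast
  moreover have "scattered_height X = s"
    by (simp add: scattered_height_def Let_def s_def r_def i0_def)
  ultimately show ?thesis unfolding cc by simp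
qed

theorem theorem3p8:
  fixes G :: "('a, 'b) monoid_scheme" and T :: "'a topology"
  assumes "profinite_group G T"
  shows "(\<not> perfect_topology (subgroup_space G T) \<longrightarrow>
            scattered_height (subgroup_space G T)
              \<le>o |{p::nat. prime p \<and> supernatural_order G T p = \<infinity>}| +c cone) \<and>
         (\<forall>p::nat. prime p \<and> pro_p_group p G T \<longrightarrow>
            scattered_height (subgroup_space G T) \<le>o ctwo)"
proof -
  have tg: "topological_group G T" using assms by (simp add: profinite_group_def)
  then have "group G" by (simp add: topological_group_def)
  then interpret profinite G T
    using assms by (simp add: profinite_def profinite_axioms_def)
  define B where "B = {p::nat. prime p \<and> supernatural_order G T p = \<infinity>}"
  let ?X = "subgroup_space G T"
  have sub: "(pf.sgp_derivative ^^ n) nb.closed_sgps \<subseteq> closed_subgroups G T" for n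
    using pf.sgp_derivative_pow_antimono[of 0 n nb.closed_sgps] closed_sgps_eq by simp
  have pow: "(cb_derivative ?X ^^ n) (topspace ?X) = (pf.sgp_derivative ^^ n) nb.closed_sgps" for n
  proof (induction n)
    case 0
    then show ?case using topspace_subgroup_space[OF tg] closed_sgps_eq by simp
  next
    case (Suc n)
    then show ?case using cb_derivative_eq[OF sub] by simp
  qed
  have bound: "scattered_height ?X \<le>o |B| +c cone"
  proof (rule scattered_height_ordLeq)
    show "cb_derivative ?X ((cb_derivative ?X ^^ Suc (card B)) (topspace ?X)) =
        (cb_derivative ?X ^^ Suc (card B)) (topspace ?X)" if "finite B"
      unfolding pow cb_derivative_eq[OF sub]
      using infinite_primes_subset that by (intro pf.sgp_derivative_stationary) (simp_all add: B_def)
    have "(\<Inter>n. (pf.sgp_derivative ^^ n) nb.closed_sgps) \<subseteq> closed_subgroups G T" using sub by blast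
    from cb_derivative_eq[OF this]
    show "cb_derivative ?X (\<Inter>n. (cb_derivative ?X ^^ n) (topspace ?X)) =
        (\<Inter>n. (cb_derivative ?X ^^ n) (topspace ?X))"
      unfolding pow pf.sgp_derivative_limit_stationary .
  qed
  have "scattered_height ?X \<le>o ctwo" if p: "prime p" "pro_p_group p G T" for p
  proof -
    \<comment> \<open>The finite continuous quotients have \<open>p\<close>-power order, so at any
      other prime the exponent of the order is a supremum of zeros.\<close>
    have "q = p" if q: "q \<in> B" for q
    proof (rule ccontr)
      assume "q \<noteq> p"
      have "multiplicity q (order (G Mod N)) = 0" if N: "N \<in> NT" for N
      proof -
        obtain n where "order (G Mod N) = p ^ n" using p(2) N unfolding pro_p_group_def by blast
        moreover have "\<not> q dvd p ^ n"
          using q p(1) \<open>q \<noteq> p\<close> prime_dvd_power[of q p n] primes_dvd_imp_eq[of q p] by (auto simp: B_def)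
        ultimately show ?thesis by (simp add: not_dvd_imp_multiplicity_0)
      qed
      then have "supernatural_order G T q = (SUP N\<in>NT. 0)"
        unfolding supernatural_order_def by (intro SUP_cong) (simp_all add: zero_enat_def)
      also have "\<dots> = 0" using nb.NN_nonempty by simp
      finally show False using q by (simp add: B_def)
    qed
    then have Bp: "B \<subseteq> {p}" by blast
    \<comment> \<open>Sends the at most one element of \<open>B\<close> and the extra point to
      different truth values.\<close>
    define f :: "nat + unit \<Rightarrow> bool" where "f x = (case x of Inl _ \<Rightarrow> True | Inr _ \<Rightarrow> False)" for x
    have "inj_on f (B <+> {()})" using Bp by (auto simp: inj_on_def f_def)
    then have "|B <+> {()}| \<le>o |UNIV :: bool set|" using card_of_ordLeq by blast
    then have "|B| +c cone \<le>o ctwo"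
      by (simp add: csum_def BNF_Cardinal_Arithmetic.cone_def ctwo_def Field_card_of)
    with bound show ?thesis by (rule ordLeq_transitive)
  qed
  then show ?thesis using bound unfolding B_def by blast
qed

end
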